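(* Let $d\ge1$, $\alpha\in(0,1)$ and $M>0$. Then, for any $z>0$, $$\lim_{m\to1}U_{\alpha,m,M}(z)=U_{\alpha,1,M}(z),$$ where $U_{\alpha,m,M}$ is the self-similar profile of mass $M$ (defined in the context).
   Context: Notation: $d\ge1$ is an integer, $m_c=\max\{0,1-\frac2d\}$; $|\partial B_1|$ is the surface measure of the unit sphere of $\mathbb R^d$ (equal to $2$ if $d=1$); for $m>m_c$, $b=b_{\alpha,m}=\frac\alpha{2+d(m-1)}$. For $0<z\le\rho$, $$K(z,\rho)=\rho\,Q(z/\rho),\qquad Q(\eta)=\frac1{\Gamma(1-\alpha)}\int_\eta^1(1-\sigma^{1/b})^{-\alpha}\sigma^{1-d}\,d\sigma.$$ For nonnegative $f$ let $\mathfrak Kf(z)=\big(\int_z^\infty K(z,\rho)f(\rho)\,d\rho\big)^{1/m}$. The profile equation is $U=\mathfrak KU$ on $(0,\infty)$. Canonical profiles $\mathcal U_{\alpha,m}$ (nonnegative continuous solutions of the profile equation on $(0,\infty)$ with $z^{d-1}\mathcal U_{\alpha,m}\in L^1(0,\infty)$): (i) $m>1$: let $\mathcal V_{\alpha,m}(z)=(1-z)_+^{\frac{2-\alpha}{m-1}}$ for $z\ge1/2$, and for $z\in(0,1/2)$ let $\mathcal V_{\alpha,m}(z)^m=z^{-(d-2)}$ if $d\ge3$, $|\log z|$ if $d=2$, $1$ if $d=1$. Choose $c>0$ so small that $c\mathcal V_{\alpha,m}\le\mathfrak K(c\mathcal V_{\alpha,m})$. Then $\mathcal U_{\alpha,m}=\lim_n\mathfrak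 K^n(c\mathcal V_{\alpha,m})$; it is the solution with support $[0,1]$. (ii) $m_c<m<1$: let $U^*_{\alpha,m}(z)=c^*_{\alpha,m}z^{-\frac2{1-m}}$ with $c^*_{\alpha,m}=\left(\frac{(1-m)b_{\alpha,m}}{2m}\frac{\Gamma(\frac\alpha{1-m})}{\Gamma(1-\alpha+\frac\alpha{1-m})}\right)^{-\frac1{1-m}}$; let $\mathsf Q(\gamma)=\int_0^1Q(\sigma)\sigma^{\gamma-3}d\sigma$ for $\gamma>\max\{2,d\}$ and let $\gamma^*>0$ be the unique number with $\mathsf Q(\frac2{1-m}+\gamma^* )=m\mathsf Q(\frac2{1-m})$. Then $\mathcal U_{\alpha,m}=\lim_n\mathfrak K^n\underline{\mathcal U}$ with $\underline{\mathcal U}(z)=U^*_{\alpha,m}(z)(1-z^{-\gamma^*})_+$. (iii) $m=1$: $\mathcal U_{\alpha,1}(z)=Z(1,ze_1)$, where $Z(t,\cdot)$ is the inverse Fourier transform (convention $\widehat f(\xi)=\int f(x)e^{-ix\cdot\xi}dx$, so that $\Delta$ has symbol $-|\xi|^2$) of $\xi\mapsto E_\alpha(-|\xi|^2t^\alpha)$, $E_\alpha(s)=\sum_{k\ge0}\frac{s^k}{\Gamma(\alpha k+1)}$ being the Mittag-Leffler function and $e_1$ a unit vector; this profile has mass $1$. Profile of mass $M$: $U_{\alpha,m,M}(z)=A\,\mathcal U_{\alpha,m}(A^{-\frac{m-1}2}z)$ with $A^{1+\frac{(m-1)d}2}=M\big/\big(|\partial B_1|\int_0^\infty\mathcal U_{\alpha,m}(\rho)\rho^{d-1}d\rho\big)$,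 so that $|\partial B_1|\int_0^\infty U_{\alpha,m,M}\rho^{d-1}d\rho=M$. In particular $U_{\alpha,1,M}=M\,\mathcal U_{\alpha,1}$. *)

theory Defs
  imports "HOL-Analysis.Analysis"
begin

text \<open>
  The radial notions take the dimension \<open>d\<close> as a natural number; the fundamental solution for
  \<open>m = 1\<close> lives on a Euclidean space \<open>'a\<close>, and there \<open>d = DIM('a)\<close>.
  All profiles are relevant only on \<open>(0,\<infinity>)\<close>, and only for \<open>m > max 0 (1 - 2/d)\<close>.
  Integrals are real-valued Lebesgue integrals.  In that range of \<open>m\<close> every integral below
  converges for the functions it is applied to, so the value \<open>0\<close> that the library
  gives to a divergent integral plays no role.
\<close>

definition sphere_area :: "nat \<Rightarrow> real" where
  "sphere_area d = real d * unit_ball_vol (real d)"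

definition b_exp :: "nat \<Rightarrow> real \<Rightarrow> real \<Rightarrow> real" where
  "b_exp d \<alpha> m = \<alpha> / (2 + real d * (m - 1))"

definition Q_fun :: "nat \<Rightarrow> real \<Rightarrow> real \<Rightarrow> real \<Rightarrow> real" where
  "Q_fun d \<alpha> m \<eta> = 1 / Gamma (1 - \<alpha>) *
     (LINT \<sigma>:{\<eta>..1}|lborel. (1 - \<sigma> powr (1 / b_exp d \<alpha> m)) powr (-\<alpha>) * \<sigma> powr (1 - real d))"

definition K_ker :: "nat \<Rightarrow> real \<Rightarrow> real \<Rightarrow> real \<Rightarrow> real \<Rightarrow> real" where
  "K_ker d \<alpha> m z \<rho> = \<rho> * Q_fun d \<alpha> m (z / \<rho>)"

definition K_op :: "nat \<Rightarrow> real \<Rightarrow> real \<Rightarrow> (real \<Rightarrow> real) \<Rightarrow> real \<Rightarrow> real" where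
  "K_op d \<alpha> m f z = (LINT \<rho>:{z..}|lborel. K_ker d \<alpha> m z \<rho> * f \<rho>) powr (1 / m)"

subsection \<open>Canonical profile, \<open>m > 1\<close>\<close>

definition V_fun :: "nat \<Rightarrow> real \<Rightarrow> real \<Rightarrow> real \<Rightarrow> real" where
  "V_fun d \<alpha> m z =
     (if z \<ge> 1/2 then (max 0 (1 - z)) powr ((2 - \<alpha>) / (m - 1))
      else (if d \<ge> 3 then z powr (- (real d - 2))
            else if d = 2 then \<bar>ln z\<bar>
            else 1) powr (1 / m))"

text \<open>
  The starting constant is any sufficiently small one; the limit of the iteration does not depend on it.
\<close>

definition V_const :: "nat \<Rightarrow> real \<Rightarrow> real \<Rightarrow> real" where
  "V_const d \<alpha> m =
     (SOME c. c > 0 \<and> (\<forall>z>0. c * V_fun d \<alpha> m z \<le> K_op d \<alpha> m (\<lambda>r. c * V_fun d \<alpha> m r) z))"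

definition profile_slow :: "nat \<Rightarrow> real \<Rightarrow> real \<Rightarrow> real \<Rightarrow> real" where
  "profile_slow d \<alpha> m z =
     lim (\<lambda>n. (K_op d \<alpha> m ^^ n) (\<lambda>r. V_const d \<alpha> m * V_fun d \<alpha> m r) z)"

subsection \<open>Canonical profile, \<open>m < 1\<close>\<close>

definition c_star :: "nat \<Rightarrow> real \<Rightarrow> real \<Rightarrow> real" where
  "c_star d \<alpha> m =
     ((1 - m) * b_exp d \<alpha> m / (2 * m) *
       (Gamma (\<alpha> / (1 - m)) / Gamma (1 - \<alpha> + \<alpha> / (1 - m)))) powr (- (1 / (1 - m)))"

definition U_star :: "nat \<Rightarrow> real \<Rightarrow> real \<Rightarrow> real \<Rightarrow> real" where
  "U_star d \<alpha> m z = c_star d \<alpha> m * z powr (- (2 / (1 - m)))"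

definition Q_moment :: "nat \<Rightarrow> real \<Rightarrow> real \<Rightarrow> real \<Rightarrow> real" where
  "Q_moment d \<alpha> m \<gamma> = (LINT \<sigma>:{0<..<1}|lborel. Q_fun d \<alpha> m \<sigma> * \<sigma> powr (\<gamma> - 3))"

definition gamma_star :: "nat \<Rightarrow> real \<Rightarrow> real \<Rightarrow> real" where
  "gamma_star d \<alpha> m =
     (THE g. g > 0 \<and> Q_moment d \<alpha> m (2 / (1 - m) + g) = m * Q_moment d \<alpha> m (2 / (1 - m)))"

definition U_lower :: "nat \<Rightarrow> real \<Rightarrow> real \<Rightarrow> real \<Rightarrow> real" where
  "U_lower d \<alpha> m z = U_star d \<alpha> m z * max 0 (1 - z powr (- gamma_star d \<alpha> m))"

definition profile_fast :: "nat \<Rightarrow> real \<Rightarrow> real \<Rightarrow> real \<Rightarrow> real" where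
  "profile_fast d \<alpha> m z = lim (\<lambda>n. (K_op d \<alpha> m ^^ n) (U_lower d \<alpha> m) z)"

subsection \<open>Canonical profile, \<open>m = 1\<close>\<close>

definition mittag_leffler :: "real \<Rightarrow> real \<Rightarrow> real" where
  "mittag_leffler \<alpha> s = (\<Sum>k. s ^ k / Gamma (\<alpha> * real k + 1))"

definition fourier :: "('a::euclidean_space \<Rightarrow> complex) \<Rightarrow> 'a \<Rightarrow> complex" where
  "fourier f \<xi> = (LINT x|lborel. f x * exp (- \<i> * complex_of_real (x \<bullet> \<xi>)))"

text \<open>
  The symbol decays only like \<open>1/|\<xi>|^2\<close>, so for \<open>d \<ge> 2\<close> it is not integrable and its inverse
  Fourier transform is not given by an absolutely convergent integral.  It is the integrable
  function whose Fourier transform is the symbol.  Integrable functions are determined by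
  their Fourier transform up to null sets; continuity away from the origin (where the function
  is singular for \<open>d \<ge> 2\<close>) makes the values at all \<open>x \<noteq> 0\<close> unique.
\<close>

definition is_inverse_fourier :: "('a::euclidean_space \<Rightarrow> complex) \<Rightarrow> ('a \<Rightarrow> real) \<Rightarrow> bool" where
  "is_inverse_fourier g f \<longleftrightarrow>
     integrable lborel f \<and> continuous_on (- {0}) f \<and>
     (\<forall>\<xi>. fourier (\<lambda>x. complex_of_real (f x)) \<xi> = g \<xi>)"

definition Z_fun :: "real \<Rightarrow> real \<Rightarrow> 'a::euclidean_space \<Rightarrow> real" where
  "Z_fun \<alpha> t = (SOME f. is_inverse_fourier
     (\<lambda>\<xi>. complex_of_real (mittag_leffler \<alpha> (- ((norm \<xi>)\<^sup>2 * t powr \<alpha>)))) f)"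

subsection \<open>Profiles of given mass\<close>

text \<open>
  The argument \<open>e\<close> is a unit vector of \<open>'a\<close>.  It fixes the dimension and is otherwise used only
  for \<open>m = 1\<close>, where the choice is immaterial because \<open>Z\<close> is radial.
\<close>

definition canonical_profile :: "'a::euclidean_space \<Rightarrow> real \<Rightarrow> real \<Rightarrow> real \<Rightarrow> real" where
  "canonical_profile e \<alpha> m z =
     (if m > 1 then profile_slow DIM('a) \<alpha> m z
      else if m < 1 then profile_fast DIM('a) \<alpha> m z
      else Z_fun \<alpha> 1 (z *\<^sub>R e))"

definition canonical_mass :: "'a::euclidean_space \<Rightarrow> real \<Rightarrow> real \<Rightarrow> real" where
  "canonical_mass e \<alpha> m =
     sphere_area DIM('a) *
     (LINT \<rho>:{0<..}|lborel. canonical_profile e \<alpha> m \<rho> * \<rho> ^ (DIM('a) - 1))"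

definition mass_scale :: "'a::euclidean_space \<Rightarrow> real \<Rightarrow> real \<Rightarrow> real \<Rightarrow> real" where
  "mass_scale e \<alpha> m M =
     (M / canonical_mass e \<alpha> m) powr (1 / (1 + (m - 1) * real DIM('a) / 2))"

definition mass_profile :: "'a::euclidean_space \<Rightarrow> real \<Rightarrow> real \<Rightarrow> real \<Rightarrow> real \<Rightarrow> real" where
  "mass_profile e \<alpha> m M z =
     (let A = mass_scale e \<alpha> m M
      in A * canonical_profile e \<alpha> m (A powr (- (m - 1) / 2) * z))"

end

theory Submission
  imports Defs "HOL-Probability.Probability"
begin

text \<open>
  A profile \<open>u\<close> solves \<open>u(z)\<^sup>m = \<integral> K(z,\<rho>) u(\<rho>) d\<rho>\<close>.  It is nonincreasing, and integrating the
  equation against \<open>z\<^bsup>d-1\<^esup>\<close> expresses its moment of order \<open>d + 1\<close> through the integral of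
  \<open>z\<^bsup>d-1\<^esup> u\<^sup>m\<close>; for \<open>m\<close> near \<open>1\<close> this bounds that moment uniformly.  Hence the profiles of mass \<open>M\<close> have
  a common integrable majorant, Helly's theorem gives pointwise convergent subsequences, and the
  limits solve the linear equation (\<open>m = 1\<close>) with the same mass.  The Mellin transform of the linear
  equation determines all even moments of a solution \<open>f\<close>, and these are the Taylor coefficients of
  the Fourier transform of \<open>f(|x|)\<close>, which is therefore the Mittag-Leffler symbol; in particular
  \<open>Z\<close> exists and every limit equals \<open>M Z\<close>.

  The canonical profiles are monotone limits between a sub- and a supersolution.  For \<open>m < 1\<close> the
  function \<open>U\<^sup>*\<close> is itself a supersolution, but it is not integrable at \<open>0\<close>; a smaller
  supersolution is obtained from a truncated quadratic correction of \<open>U\<^sup>*\<close> in powers of \<open>z\<^bsup>-\<gamma>*\<^esup>\<close>,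
  capped near \<open>0\<close> by a multiple of a slightly less singular power.  Feeding the resulting bound back
  into the equation improves the exponent until the profile is integrable.
\<close>

subsection \<open>The kernel\<close>

text \<open>The barriers degenerate as \<open>m\<close> tends to 1: their exponents
  \<open>(2 - \<alpha>) / (m - 1)\<close> and \<open>2 / (1 - m)\<close> blow up. They therefore
  serve only to show, for each fixed \<open>m\<close>, that the canonical profile solves the
  equation with positive finite mass and a finite moment of order \<open>d + 1\<close>. Rescaling to
  mass \<open>M\<close> preserves the equation exactly, and every bound uniform in \<open>m\<close>
  is derived afterwards from the equation and the mass. The moment of order \<open>d + 1\<close>
  prevents loss of mass at infinity. At the origin, where solutions may be unbounded, monotonicity
  is too weak and the kernel bound \<open>K_le\<close> takes over; it involves the moment of order
  \<open>d\<close>, which lies between the two that are known. Uniqueness enters through the linear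
  equation alone. Its even moments are quotients of Gamma values, and the resulting series converges
  at every frequency because \<open>Gamma (\<alpha> k + 1)\<close> outgrows all powers. No inversion
  formula is available for a symbol that is not integrable, so the limit is identified by
  injectivity of the transform on integrable functions.\<close>

lemma powr_less_one':
  fixes x a :: real
  assumes "0 < x" "x < 1" "0 < a"
  shows "x powr a < 1"
  using powr_less_mono2[of a x 1] assms by simp

text \<open>The substitution \<open>t = \<sigma> powr (1/b)\<close> gives Euler's Beta integral with
  parameters \<open>b * p\<close> and \<open>1 - \<alpha>\<close>. All explicit moments of the
  kernel come from here.\<close>

lemma nn_integral_Beta_powr:
  fixes \<alpha> b p :: real
  assumes "0 < b" "\<alpha> < 1" "0 < p"
  shows "(\<integral>\<^sup>+\<sigma>\<in>{0<..<1}. ennreal ((1 - \<sigma> powr (1/b)) powr (-\<alpha>) * \<sigma> powr (p - 1)) \<partial>lborel)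
    = ennreal (b * Beta (b * p) (1 - \<alpha>))"
proof -
  define f where "f = (\<lambda>t::real. b * (t powr (b*p - 1) * (1 - t) powr ((1-\<alpha>) - 1)))"
  define g where "g = (\<lambda>x::real. x powr (1/b))"
  define g' where "g' = (\<lambda>x::real. (1/b) * x powr (1/b - 1))"
  have "((\<lambda>t. t powr (b*p - 1) * (1 - t) powr ((1-\<alpha>) - 1)) has_integral Beta (b*p) (1-\<alpha>)) {0<..<1}"
    using has_integral_Beta_real[of "b*p" "1-\<alpha>"] assms by (simp add: has_integral_Icc_iff_Ioo)
  then have hf: "(f has_integral b * Beta (b*p) (1-\<alpha>)) {0<..<1}"
    unfolding f_def by (rule has_integral_mult_right)
  have fnn: "f x \<ge> 0" for x unfolding f_def using assms by simp
  have fa: "f absolutely_integrable_on {0<..<1}"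
    using hf fnn by (intro nonnegative_absolutely_integrable_1) (auto intro: has_integral_integrable)
  have img: "g ` {0<..<1} = {0<..<1}"
  proof
    show "g ` {0<..<1} \<subseteq> {0<..<1}"
      unfolding g_def using assms by (auto simp: powr_less_one')
    show "{0<..<1} \<subseteq> g ` {0<..<1}"
    proof
      fix x :: real assume x: "x \<in> {0<..<1}"
      then have "x = g (x powr b)" "x powr b \<in> {0<..<1}"
        unfolding g_def using assms by (auto simp: powr_powr powr_less_one')
      then show "x \<in> g ` {0<..<1}" by blast
    qed
  qed
  have inj: "inj_on g {0<..<1}"
  proof (rule inj_onI)
    fix x y :: real assume xy: "x \<in> {0<..<1}" "y \<in> {0<..<1}" "g x = g y"
    then have "(g x) powr b = (g y) powr b" by simp
    then show "x = y" unfolding g_def using assms xy by (auto simp: powr_powr)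
  qed
  have der: "(g has_field_derivative g' x) (at x within {0<..<1})" if "x \<in> {0<..<1}" for x
    unfolding g_def g'_def using that
    by (intro has_field_derivative_at_within[OF has_real_derivative_powr]) simp
  have "(\<lambda>x. \<bar>g' x\<bar> * f (g x)) absolutely_integrable_on {0<..<1} \<and>
      integral {0<..<1} (\<lambda>x. \<bar>g' x\<bar> * f (g x)) = b * Beta (b*p) (1-\<alpha>)"
    using has_absolute_integral_change_of_variables_1'[of "{0<..<1}" g g' f] der inj img fa hf
    by (auto simp: integral_unique)
  then have hi: "((\<lambda>x. \<bar>g' x\<bar> * f (g x)) has_integral b * Beta (b*p) (1-\<alpha>)) {0<..<1}"
    by (metis absolutely_integrable_on_def has_integral_integral)
  have "ennreal (b * Beta (b*p) (1-\<alpha>))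
      = (\<integral>\<^sup>+x. ennreal (indicator {0<..<1} x * (\<bar>g' x\<bar> * f (g x))) \<partial>lborel)"
    using nn_integral_has_integral_lebesgue[OF _ hi] fnn by simp
  also have "\<dots> = (\<integral>\<^sup>+\<sigma>\<in>{0<..<1}. ennreal ((1 - \<sigma> powr (1/b)) powr (-\<alpha>) * \<sigma> powr (p - 1)) \<partial>lborel)"
  proof (intro nn_integral_cong)
    fix x :: real
    show "ennreal (indicator {0<..<1} x * (\<bar>g' x\<bar> * f (g x)))
       = ennreal ((1 - x powr (1/b)) powr (-\<alpha>) * x powr (p - 1)) * indicator {0<..<1} x"
    proof (cases "x \<in> {0<..<1}")
      case True
      have "(x powr (1/b)) powr (b*p - 1) = x powr (p - 1/b)"
        using assms by (simp add: powr_powr field_simps)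
      moreover have "x powr (1/b - 1) * x powr (p - 1/b) = x powr (p - 1)"
        by (simp add: powr_add[symmetric])
      ultimately have "\<bar>g' x\<bar> * f (g x) = (1 - x powr (1/b)) powr (-\<alpha>) * x powr (p - 1)"
        unfolding g'_def f_def g_def using assms by (simp add: abs_mult field_simps)
      with True show ?thesis by simp
    qed simp
  qed
  finally show ?thesis by simp
qed


section \<open>Integrals of powers, and the passage between the two integrals\<close>

lemma nn_integral_powr_from_0:
  fixes r s :: real
  assumes "0 < s" "0 \<le> r"
  shows "(\<integral>\<^sup>+z\<in>{0..r}. ennreal (z powr (s - 1)) \<partial>lborel) = ennreal (r powr s / s)"
proof -
  have "((\<lambda>x. x powr (s-1)) has_integral (r powr s / s)) {0..r}"
    using has_integral_powr_from_0[of "s-1" r] assms by simp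
  from nn_integral_has_integral_lebesgue[OF _ this]
  have "(\<integral>\<^sup>+x. ennreal (indicator {0..r} x * x powr (s-1)) \<partial>lborel) = ennreal (r powr s / s)"
    by simp
  then show ?thesis by (simp add: ennreal_mult' ennreal_indicator mult.commute)
qed

lemma nn_integral_powr_to_inf:
  fixes r s :: real
  assumes "0 < s" "0 < r"
  shows "(\<integral>\<^sup>+z\<in>{r..}. ennreal (z powr (- s - 1)) \<partial>lborel) = ennreal (r powr (-s) / s)"
proof -
  have "(\<integral>\<^sup>+z. ennreal (z powr (- s - 1)) * indicator {r..} z \<partial>lborel) = ennreal (0 - (- (r powr (-s) / s)))"
  proof (rule nn_integral_FTC_atLeast[where F = "\<lambda>z. - (z powr (-s) / s)"])
    show "((\<lambda>z. - (z powr - s / s)) has_field_derivative x powr (- s - 1)) (at x)" if "r \<le> x" for x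
      using that assms by (auto intro!: derivative_eq_intros has_real_derivative_powr simp: powr_diff)
    have "((\<lambda>z::real. z powr (-s)) \<longlongrightarrow> 0) at_top"
      using assms by (intro tendsto_neg_powr) (auto simp: filterlim_ident)
    then have "((\<lambda>z::real. - (z powr (-s) / s)) \<longlongrightarrow> - (0/s)) at_top"
      using assms by (intro tendsto_intros) auto
    then show "((\<lambda>z::real. - (z powr (-s) / s)) \<longlongrightarrow> 0) at_top" by simp
  qed (use assms in auto)
  then show ?thesis by simp
qed

text \<open>Integrands are mostly nonnegative, so integrals are computed in \<open>ennreal\<close>,
  where Tonelli and monotone convergence need no integrability; this lemma and the next two
  translate to the real integrals of the definitions.\<close>

lemma set_lebesgue_integral_nonneg_eq:
  fixes f :: "real \<Rightarrow> real"
  assumes "f \<in> borel_measurable borel" "A \<in> sets borel" "\<And>x. x \<in> A \<Longrightarrow> 0 \<le> f x"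
  shows "(LINT x:A|lborel. f x) = enn2real (\<integral>\<^sup>+x\<in>A. ennreal (f x) \<partial>lborel)"
proof -
  have "(\<integral>\<^sup>+x\<in>A. ennreal (f x) \<partial>lborel) = (\<integral>\<^sup>+x. ennreal (indicator A x *\<^sub>R f x) \<partial>lborel)"
    by (intro nn_integral_cong) (auto simp: indicator_def)
  then show ?thesis unfolding set_lebesgue_integral_def using assms
    by (subst integral_eq_nn_integral) (auto simp: indicator_def)
qed

lemma set_integrable_iff_nn_integral:
  fixes f :: "real \<Rightarrow> real"
  assumes "f \<in> borel_measurable borel" "A \<in> sets borel" "\<And>x. x \<in> A \<Longrightarrow> 0 \<le> f x"
  shows "set_integrable lborel A f \<longleftrightarrow> (\<integral>\<^sup>+x\<in>A. ennreal (f x) \<partial>lborel) < \<infinity>"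
proof -
  have "(\<integral>\<^sup>+x\<in>A. ennreal (f x) \<partial>lborel) = (\<integral>\<^sup>+x. ennreal (norm (indicator A x *\<^sub>R f x)) \<partial>lborel)"
    using assms by (intro nn_integral_cong) (auto simp: indicator_def)
  then show ?thesis unfolding set_integrable_def integrable_iff_bounded using assms by auto
qed

lemma set_nn_integral_eq_lebesgue:
  fixes f :: "real \<Rightarrow> real"
  assumes "f \<in> borel_measurable borel" "A \<in> sets borel" "\<And>x. x \<in> A \<Longrightarrow> 0 \<le> f x"
    "set_integrable lborel A f"
  shows "(\<integral>\<^sup>+x\<in>A. ennreal (f x) \<partial>lborel) = ennreal (LINT x:A|lborel. f x)"
  using assms set_integrable_iff_nn_integral[OF assms(1-3)]
  by (simp add: set_lebesgue_integral_nonneg_eq)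

text \<open>The last assumption says \<open>m > 1 - 2/d\<close>, so that \<open>b\<close> is
  positive; together with \<open>0 < m\<close> this is the range \<open>m > m_c\<close>.\<close>

locale profile_params =
  fixes d :: nat and \<alpha> m :: real
  assumes d: "1 \<le> d" and \<alpha>: "0 < \<alpha>" "\<alpha> < 1" and m: "0 < m" "0 < 2 + real d * (m - 1)"
begin

abbreviation "b \<equiv> b_exp d \<alpha> m"
abbreviation "Q \<equiv> Q_fun d \<alpha> m"
abbreviation "K \<equiv> K_ker d \<alpha> m"

definition wt :: "real \<Rightarrow> real" where
  "wt \<sigma> = (1 - \<sigma> powr (1 / b)) powr (-\<alpha>) * \<sigma> powr (1 - real d)"

text \<open>Closed form of \<open>Q_moment\<close> (see \<open>Q_moment_eq\<close>), that is, of the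
  Mellin transform of \<open>Q\<close> at \<open>\<gamma> - 2\<close>. It is meaningful for \<gamma>
  above both 2 and \<open>d\<close>.\<close>

definition QF :: "real \<Rightarrow> real" where
  "QF \<gamma> = b / (\<gamma> - 2) * (Gamma (b * (\<gamma> - real d)) / Gamma (1 - \<alpha> + b * (\<gamma> - real d)))"

text \<open>The integral of \<open>(1 - \<sigma> powr (1/b)) powr (-\<alpha>)\<close> over the unit
  interval, normalised as in \<open>Q\<close>.\<close>

definition QC :: real where
  "QC = b * Beta b (1 - \<alpha>) / Gamma (1 - \<alpha>)"

lemma b_pos: "0 < b"
  using \<alpha> m by (simp add: b_exp_def)

lemma Gamma_pos: "0 < Gamma (1 - \<alpha>)"
  using \<alpha> by (simp add: Gamma_real_pos)

lemma QC_pos: "0 < QC"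
  unfolding QC_def Beta_def using b_pos Gamma_pos \<alpha>
  by (intro divide_pos_pos mult_pos_pos Gamma_real_pos) auto

lemma QF_pos: "2 < \<gamma> \<Longrightarrow> real d < \<gamma> \<Longrightarrow> 0 < QF \<gamma>"
  unfolding QF_def using b_pos \<alpha>
  by (intro mult_pos_pos divide_pos_pos Gamma_real_pos) (auto intro: add_pos_pos)

lemma wt_nonneg: "0 \<le> wt \<sigma>"
  by (simp add: wt_def)

lemma wt_measurable [measurable]: "wt \<in> borel_measurable borel"
  unfolding wt_def by measurable

lemma nn_integral_wt_powr:
  assumes "real d - 2 < p"
  shows "(\<integral>\<^sup>+\<sigma>\<in>{0<..<1}. ennreal (wt \<sigma> * \<sigma> powr p) \<partial>lborel)
    = ennreal (b * Beta (b * (p + 2 - real d)) (1 - \<alpha>))"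
proof -
  have "(\<integral>\<^sup>+\<sigma>\<in>{0<..<1}. ennreal (wt \<sigma> * \<sigma> powr p) \<partial>lborel)
    = (\<integral>\<^sup>+\<sigma>\<in>{0<..<1}. ennreal ((1 - \<sigma> powr (1/b)) powr (-\<alpha>) * \<sigma> powr ((p + 2 - real d) - 1)) \<partial>lborel)"
    by (intro nn_integral_cong)
       (auto simp: indicator_def wt_def mult.assoc powr_add[symmetric] algebra_simps)
  also have "\<dots> = ennreal (b * Beta (b * (p + 2 - real d)) (1 - \<alpha>))"
    using b_pos \<alpha> assms by (intro nn_integral_Beta_powr) auto
  finally show ?thesis .
qed

text \<open>The factor \<open>\<sigma> powr (1 - d)\<close> is largest at the left end \<eta>; what
  remains is the Beta integral with \<open>p = 1\<close>.\<close>

lemma nn_integral_wt_le: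
  assumes "0 < \<eta>"
  shows "(\<integral>\<^sup>+\<sigma>\<in>{\<eta>..1}. ennreal (wt \<sigma>) \<partial>lborel) \<le> ennreal (\<eta> powr (1 - real d) * (b * Beta b (1 - \<alpha>)))"
proof -
  have "(\<integral>\<^sup>+\<sigma>\<in>{\<eta>..1}. ennreal (wt \<sigma>) \<partial>lborel)
      \<le> (\<integral>\<^sup>+\<sigma>. ennreal (\<eta> powr (1 - real d)) * (ennreal ((1 - \<sigma> powr (1/b)) powr (-\<alpha>) * \<sigma> powr (1 - 1)) * indicator {0<..<1} \<sigma>) \<partial>lborel)"
  proof (rule nn_integral_mono_AE)
    have "AE x in lborel. x \<noteq> (1::real)" by (rule AE_lborel_singleton)
    then show "AE x in lborel. ennreal (wt x) * indicator {\<eta>..1} x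
        \<le> ennreal (\<eta> powr (1 - real d)) * (ennreal ((1 - x powr (1 / b)) powr - \<alpha> * x powr (1 - 1)) * indicator {0<..<1} x)"
    proof eventually_elim
      case (elim x)
      show ?case
      proof (cases "x \<in> {\<eta>..<1}")
        case True
        then have "x powr (1 - real d) \<le> \<eta> powr (1 - real d)"
          using assms d by (intro powr_mono2') auto
        then have "wt x \<le> \<eta> powr (1 - real d) * ((1 - x powr (1 / b)) powr - \<alpha> * x powr (1 - 1))"
          unfolding wt_def using True assms by (simp add: mult.commute mult_right_mono)
        with True assms show ?thesis by (simp add: ennreal_mult'[symmetric])
      qed (use elim in \<open>auto simp: indicator_def\<close>)
    qed
  qed
  also have "\<dots> = ennreal (\<eta> powr (1 - real d)) * ennreal (b * Beta (b*1) (1 - \<alpha>))"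
    using nn_integral_Beta_powr[of b \<alpha> 1] b_pos \<alpha> by (subst nn_integral_cmult) auto
  finally show ?thesis by (simp add: ennreal_mult'[symmetric])
qed

lemma set_integrable_wt:
  assumes "0 < \<eta>"
  shows "set_integrable lborel {\<eta>..1} wt"
proof -
  have "(\<integral>\<^sup>+ x. ennreal (norm (indicator {\<eta>..1} x *\<^sub>R wt x)) \<partial>lborel) = (\<integral>\<^sup>+\<sigma>\<in>{\<eta>..1}. ennreal (wt \<sigma>) \<partial>lborel)"
    by (intro nn_integral_cong) (auto simp: indicator_def wt_nonneg)
  with nn_integral_wt_le[OF assms] show ?thesis
    unfolding set_integrable_def by (intro integrableI_bounded) (auto simp: top.extremum_strict intro: le_less_trans)
qed

lemma Q_eq: "Q \<eta> = 1 / Gamma (1 - \<alpha>) * (LINT \<sigma>:{\<eta>..1}|lborel. wt \<sigma>)"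
  unfolding Q_fun_def wt_def by simp

lemma Q_nonneg: "0 \<le> Q \<eta>"
  unfolding Q_eq set_lebesgue_integral_def using Gamma_pos wt_nonneg by simp

lemma ennreal_Q:
  assumes "0 < \<eta>"
  shows "ennreal (Q \<eta>) = ennreal (1 / Gamma (1 - \<alpha>)) * (\<integral>\<^sup>+\<sigma>\<in>{\<eta>..1}. ennreal (wt \<sigma>) \<partial>lborel)"
proof -
  have "(\<integral>\<^sup>+\<sigma>\<in>{\<eta>..1}. ennreal (wt \<sigma>) \<partial>lborel) = ennreal (LINT \<sigma>:{\<eta>..1}|lborel. wt \<sigma>)"
    using set_integrable_wt[OF assms]
    by (intro set_nn_integral_eq_lebesgue) (auto simp: wt_nonneg)
  moreover have "(LINT \<sigma>:{\<eta>..1}|lborel. wt \<sigma>) \<ge> 0"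
    unfolding set_lebesgue_integral_def using wt_nonneg by simp
  ultimately show ?thesis unfolding Q_eq using Gamma_pos by (subst ennreal_mult') auto
qed

lemma Q_le:
  assumes "0 < \<eta>"
  shows "Q \<eta> \<le> QC * \<eta> powr (1 - real d)"
proof -
  have "ennreal (Q \<eta>) \<le> ennreal (1 / Gamma (1 - \<alpha>)) * ennreal (\<eta> powr (1 - real d) * (b * Beta b (1 - \<alpha>)))"
    unfolding ennreal_Q[OF assms] by (intro mult_left_mono nn_integral_wt_le assms) auto
  also have "\<dots> = ennreal (QC * \<eta> powr (1 - real d))"
    using Gamma_pos by (simp add: ennreal_mult'[symmetric] QC_def field_simps)
  finally show ?thesis using QC_pos by (subst (asm) ennreal_le_iff) auto
qed

text \<open>For \<open>\<eta> = 1\<close> the domain is a single point, beyond that it is empty.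
  Hence \<open>K z \<rho>\<close> vanishes for \<open>\<rho> \<le> z\<close>, and integrals over
  \<open>{z..}\<close> may be extended to the half-line.\<close>

lemma Q_zero:
  assumes "1 \<le> \<eta>"
  shows "Q \<eta> = 0"
proof -
  have "(LINT \<sigma>:{\<eta>..1}|lborel. wt \<sigma>) = 0"
    unfolding set_lebesgue_integral_def
  proof (rule integral_eq_zero_AE, rule AE_I[of _ _ "{1}"])
    show "{x \<in> space lborel. indicat_real {\<eta>..1} x *\<^sub>R wt x \<noteq> 0} \<subseteq> {1}"
      using assms by (auto simp: indicator_def)
  qed auto
  then show ?thesis unfolding Q_eq by simp
qed

lemma Q_measurable [measurable]: "Q \<in> borel_measurable borel"
proof -
  have "(\<lambda>\<eta>. 1 / Gamma (1 - \<alpha>) * (LINT \<sigma>|lborel. (if \<eta> \<le> \<sigma> \<and> \<sigma> \<le> 1 then wt \<sigma> else 0))) \<in> borel_measurable borel"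
    by measurable
  also have "(\<lambda>\<eta>. 1 / Gamma (1 - \<alpha>) * (LINT \<sigma>|lborel. (if \<eta> \<le> \<sigma> \<and> \<sigma> \<le> 1 then wt \<sigma> else 0))) = Q"
    unfolding Q_eq set_lebesgue_integral_def
    by (intro ext arg_cong2[where f="(*)"] refl Bochner_Integration.integral_cong) (auto simp: indicator_def)
  finally show ?thesis .
qed

lemma K_measurable [measurable]: "(\<lambda>(z, \<rho>). K z \<rho>) \<in> borel_measurable (borel \<Otimes>\<^sub>M borel)"
  unfolding K_ker_def by measurable

lemma K_measurable2 [measurable]: "K z \<in> borel_measurable borel"
  unfolding K_ker_def by measurable

lemma Q_antimono:
  assumes "0 < \<eta>" "\<eta> \<le> \<eta>'"
  shows "Q \<eta>' \<le> Q \<eta>"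
proof -
  have "ennreal (Q \<eta>') \<le> ennreal (Q \<eta>)"
    using assms by (simp only: ennreal_Q less_le_trans, intro mult_left_mono nn_integral_mono)
      (auto simp: indicator_def)
  then show ?thesis using Q_nonneg by (subst (asm) ennreal_le_iff) auto
qed

lemma wt_ge:
  assumes "0 < \<sigma>" "\<sigma> < 1"
  shows "\<sigma> powr (1 - real d) \<le> wt \<sigma>"
proof -
  have "0 < \<sigma> powr (1/b)" "\<sigma> powr (1/b) < 1" using assms b_pos powr_less_one'[of \<sigma> "1/b"] by auto
  then have "1 \<le> (1 - \<sigma> powr (1/b)) powr (-\<alpha>)"
    using \<alpha> powr_mono2'[of "-\<alpha>" "1 - \<sigma> powr (1/b)" 1] by simp
  then show ?thesis unfolding wt_def
    using mult_right_mono[of 1 "(1 - \<sigma> powr (1/b)) powr (-\<alpha>)" "\<sigma> powr (1 - real d)"] by simp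
qed

lemma Q_ge_integral:
  assumes "0 < \<eta>" "\<And>\<sigma>. \<eta> < \<sigma> \<Longrightarrow> \<sigma> < 1 \<Longrightarrow> f \<sigma> \<le> wt \<sigma>" "(f has_integral I) {\<eta>..1}"
  shows "I / Gamma (1 - \<alpha>) \<le> Q \<eta>"
proof -
  have wi: "(wt has_integral (LINT \<sigma>:{\<eta>..1}|lborel. wt \<sigma>)) {\<eta>..1}"
    using set_borel_integral_eq_integral[OF set_integrable_wt[OF assms(1)]] by (simp add: has_integral_integral)
  have "I \<le> (LINT \<sigma>:{\<eta>..1}|lborel. wt \<sigma>)"
    using assms wi unfolding has_integral_Icc_iff_Ioo by (elim has_integral_le) auto
  then show ?thesis unfolding Q_eq using Gamma_pos by (simp add: divide_right_mono)
qed

text \<open>Write \<open>Q\<close> as an integral and swap by Tonelli: for fixed \<sigma> the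
  variable \<open>z\<close> runs up to \<open>\<rho> * \<sigma>\<close> and gives a pure power, and
  the integral over \<sigma> is a Beta value. This formula for the adjoint yields the Mellin
  identity for solutions.\<close>

lemma nn_integral_powr_K:
  assumes "0 < s" "real d < s + 2" "0 < \<rho>"
  shows "(\<integral>\<^sup>+z\<in>{0<..}. ennreal (z powr (s - 1) * K z \<rho>) \<partial>lborel) = ennreal (\<rho> powr (s + 1) * QF (s + 2))"
proof -
  have "(\<integral>\<^sup>+z\<in>{0<..}. ennreal (z powr (s - 1) * K z \<rho>) \<partial>lborel)
      = (\<integral>\<^sup>+z. (\<integral>\<^sup>+\<sigma>. ennreal (1/Gamma (1-\<alpha>) * \<rho>) * (ennreal (z powr (s - 1)) * (if 0 < z \<and> z \<le> \<rho> * \<sigma> then 1 else 0) * 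
           (if 0 < \<sigma> \<and> \<sigma> \<le> 1 then ennreal (wt \<sigma>) else 0)) \<partial>lborel) \<partial>lborel)" (is "_ = (\<integral>\<^sup>+z. ?R z \<partial>lborel)")
  proof (intro nn_integral_cong)
    fix z :: real
    show "ennreal (z powr (s - 1) * K z \<rho>) * indicator {0<..} z = ?R z"
    proof (cases "0 < z")
      case True
      have "ennreal (z powr (s - 1) * K z \<rho>) = ennreal (z powr (s-1) * \<rho>) * ennreal (Q (z/\<rho>))"
        unfolding K_ker_def using assms Q_nonneg by (simp add: ennreal_mult'[symmetric] mult_ac)
      also have "\<dots> = ennreal (z powr (s-1) * \<rho>) * (ennreal (1 / Gamma (1 - \<alpha>)) * (\<integral>\<^sup>+\<sigma>\<in>{z/\<rho>..1}. ennreal (wt \<sigma>) \<partial>lborel))"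
        using True assms by (subst ennreal_Q) auto
      also have "\<dots> = (\<integral>\<^sup>+\<sigma>. ennreal (z powr (s-1) * \<rho>) * (ennreal (1 / Gamma (1 - \<alpha>)) * (ennreal (wt \<sigma>) * indicator {z/\<rho>..1} \<sigma>)) \<partial>lborel)"
        by (subst nn_integral_cmult[symmetric], simp, subst nn_integral_cmult[symmetric]) auto
      also have "\<dots> = ?R z"
      proof (intro nn_integral_cong)
        fix \<sigma>
        have "z/\<rho> \<le> \<sigma> \<longleftrightarrow> z \<le> \<rho> * \<sigma>" using assms by (simp add: field_simps)
        moreover have "z \<le> \<rho> * \<sigma> \<Longrightarrow> 0 < \<sigma>" using True assms by (meson less_le_trans zero_less_mult_pos)
        moreover have "ennreal (z powr (s-1) * \<rho>) * ennreal (1 / Gamma (1 - \<alpha>)) = ennreal (1 / Gamma (1 - \<alpha>) * \<rho>) * ennreal (z powr (s-1))"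
          using assms Gamma_pos by (simp add: ennreal_mult'[symmetric] mult_ac)
        ultimately show "ennreal (z powr (s-1) * \<rho>) * (ennreal (1 / Gamma (1 - \<alpha>)) * (ennreal (wt \<sigma>) * indicator {z/\<rho>..1} \<sigma>))
          = ennreal (1/Gamma (1-\<alpha>) * \<rho>) * (ennreal (z powr (s - 1)) * (if 0 < z \<and> z \<le> \<rho> * \<sigma> then 1 else 0) * 
           (if 0 < \<sigma> \<and> \<sigma> \<le> 1 then ennreal (wt \<sigma>) else 0))"
          using True by (auto simp: indicator_def mult.assoc[symmetric])
      qed
      finally show ?thesis using True by simp
    qed simp
  qed
  also have "\<dots> = (\<integral>\<^sup>+\<sigma>. (\<integral>\<^sup>+z. ennreal (1/Gamma (1-\<alpha>) * \<rho>) * (ennreal (z powr (s - 1)) * (if 0 < z \<and> z \<le> \<rho> * \<sigma> then 1 else 0) * 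
           (if 0 < \<sigma> \<and> \<sigma> \<le> 1 then ennreal (wt \<sigma>) else 0)) \<partial>lborel) \<partial>lborel)"
    by (rule lborel_pair.Fubini'[symmetric]) measurable
  also have "\<dots> = (\<integral>\<^sup>+\<sigma>. ennreal (1/Gamma (1-\<alpha>) * \<rho> powr (s+1) / s) * (ennreal (wt \<sigma> * \<sigma> powr s) * indicator {0<..<1} \<sigma>) \<partial>lborel)"
  proof (rule nn_integral_cong_AE)
    have "AE x in lborel. x \<noteq> (1::real)" by (rule AE_lborel_singleton)
    then show "AE x in lborel. (\<integral>\<^sup>+z. ennreal (1/Gamma (1-\<alpha>) * \<rho>) * (ennreal (z powr (s - 1)) * (if 0 < z \<and> z \<le> \<rho> * x then 1 else 0) * 
           (if 0 < x \<and> x \<le> 1 then ennreal (wt x) else 0)) \<partial>lborel) = ennreal (1/Gamma (1-\<alpha>) * \<rho> powr (s+1) / s) * (ennreal (wt x * x powr s) * indicator {0<..<1} x)"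
    proof eventually_elim
      case (elim \<sigma>)
      show ?case
      proof (cases "\<sigma> \<in> {0<..<1}")
        case \<sigma>: True
        have "(\<integral>\<^sup>+z. ennreal (1/Gamma (1-\<alpha>) * \<rho>) * (ennreal (z powr (s - 1)) * (if 0 < z \<and> z \<le> \<rho> * \<sigma> then 1 else 0) * 
             (if 0 < \<sigma> \<and> \<sigma> \<le> 1 then ennreal (wt \<sigma>) else 0)) \<partial>lborel)
          = (\<integral>\<^sup>+z. ennreal (1/Gamma (1-\<alpha>) * \<rho> * wt \<sigma>) * (ennreal (z powr (s - 1)) * indicator {0..\<rho>*\<sigma>} z) \<partial>lborel)"
        using \<sigma> assms Gamma_pos wt_nonneg by (intro nn_integral_cong) (auto simp: indicator_def ennreal_mult'[symmetric] mult_ac)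
      also have "\<dots> = ennreal (1/Gamma (1-\<alpha>) * \<rho> * wt \<sigma>) * ennreal ((\<rho> * \<sigma>) powr s / s)"
        using assms \<sigma> nn_integral_powr_from_0[of s "\<rho> * \<sigma>"] by (subst nn_integral_cmult) auto
      also have "\<dots> = ennreal (1/Gamma (1-\<alpha>) * \<rho> powr (s+1) / s) * (ennreal (wt \<sigma> * \<sigma> powr s) * indicator {0<..<1} \<sigma>)"
        using \<sigma> assms Gamma_pos wt_nonneg by (simp add: ennreal_mult'[symmetric] powr_mult powr_add field_simps)
      finally show ?thesis .
      qed (use elim in \<open>auto simp: indicator_def\<close>)
    qed
  qed
  also have "\<dots> = ennreal (1/Gamma (1-\<alpha>) * \<rho> powr (s+1) / s) * ennreal (b * Beta (b * (s + 2 - real d)) (1 - \<alpha>))"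
    using assms using nn_integral_wt_powr[of s] by (subst nn_integral_cmult) auto
  also have "\<dots> = ennreal (\<rho> powr (s + 1) * QF (s + 2))"
    unfolding QF_def Beta_def using Gamma_pos assms
    by (simp add: ennreal_mult'[symmetric] field_simps)
  finally show ?thesis .
qed

text \<open>\<open>K\<close> is homogeneous of degree 1, so powers are mapped to powers. The factor
  is again \<open>QF\<close>, as both formulas reduce to the Mellin transform of \<open>Q\<close> in
  the variable \<open>z / \<rho>\<close>. The barriers for \<open>m < 1\<close> are evaluated with
  this.\<close>

lemma nn_integral_K_powr:
  assumes "2 < \<gamma>" "real d < \<gamma>" "0 < z"
  shows "(\<integral>\<^sup>+\<rho>\<in>{z..}. ennreal (K z \<rho> * \<rho> powr (-\<gamma>)) \<partial>lborel) = ennreal (z powr (2 - \<gamma>) * QF \<gamma>)"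
proof -
  have "(\<integral>\<^sup>+\<rho>\<in>{z..}. ennreal (K z \<rho> * \<rho> powr (-\<gamma>)) \<partial>lborel)
      = (\<integral>\<^sup>+\<rho>. (\<integral>\<^sup>+\<sigma>. ennreal (1/Gamma (1-\<alpha>)) * (ennreal (\<rho> powr (1 - \<gamma>)) * (if z \<le> \<rho> \<and> z \<le> \<rho> * \<sigma> then 1 else 0) * 
           (if 0 < \<sigma> \<and> \<sigma> \<le> 1 then ennreal (wt \<sigma>) else 0)) \<partial>lborel) \<partial>lborel)" (is "_ = (\<integral>\<^sup>+\<rho>. ?R \<rho> \<partial>lborel)")
  proof (intro nn_integral_cong)
    fix \<rho> :: real
    show "ennreal (K z \<rho> * \<rho> powr (-\<gamma>)) * indicator {z..} \<rho> = ?R \<rho>"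
    proof (cases "z \<le> \<rho>")
      case True
      then have \<rho>: "0 < \<rho>" using assms by auto
      have "ennreal (K z \<rho> * \<rho> powr (-\<gamma>)) = ennreal (\<rho> powr (1-\<gamma>)) * ennreal (Q (z/\<rho>))"
        unfolding K_ker_def using \<rho> Q_nonneg by (simp add: ennreal_mult'[symmetric] powr_diff powr_minus_divide field_simps)
      also have "\<dots> = ennreal (\<rho> powr (1-\<gamma>)) * (ennreal (1 / Gamma (1 - \<alpha>)) * (\<integral>\<^sup>+\<sigma>\<in>{z/\<rho>..1}. ennreal (wt \<sigma>) \<partial>lborel))"
        using \<rho> assms by (subst ennreal_Q) auto
      also have "\<dots> = (\<integral>\<^sup>+\<sigma>. ennreal (\<rho> powr (1-\<gamma>)) * (ennreal (1 / Gamma (1 - \<alpha>)) * (ennreal (wt \<sigma>) * indicator {z/\<rho>..1} \<sigma>)) \<partial>lborel)"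
        by (subst nn_integral_cmult[symmetric], simp, subst nn_integral_cmult[symmetric]) auto
      also have "\<dots> = ?R \<rho>"
      proof (intro nn_integral_cong)
        fix \<sigma>
        have "z/\<rho> \<le> \<sigma> \<longleftrightarrow> z \<le> \<rho> * \<sigma>" using \<rho> by (simp add: field_simps)
        moreover have "z \<le> \<rho> * \<sigma> \<Longrightarrow> 0 < \<sigma>" using \<rho> assms by (meson less_le_trans zero_less_mult_pos)
        ultimately show "ennreal (\<rho> powr (1-\<gamma>)) * (ennreal (1 / Gamma (1 - \<alpha>)) * (ennreal (wt \<sigma>) * indicator {z/\<rho>..1} \<sigma>))
          = ennreal (1/Gamma (1-\<alpha>)) * (ennreal (\<rho> powr (1 - \<gamma>)) * (if z \<le> \<rho> \<and> z \<le> \<rho> * \<sigma> then 1 else 0) * 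
           (if 0 < \<sigma> \<and> \<sigma> \<le> 1 then ennreal (wt \<sigma>) else 0))"
          using True by (auto simp: indicator_def mult_ac)
      qed
      finally show ?thesis using True by simp
    qed simp
  qed
  also have "\<dots> = (\<integral>\<^sup>+\<sigma>. (\<integral>\<^sup>+\<rho>. ennreal (1/Gamma (1-\<alpha>)) * (ennreal (\<rho> powr (1 - \<gamma>)) * (if z \<le> \<rho> \<and> z \<le> \<rho> * \<sigma> then 1 else 0) * 
           (if 0 < \<sigma> \<and> \<sigma> \<le> 1 then ennreal (wt \<sigma>) else 0)) \<partial>lborel) \<partial>lborel)"
    by (rule lborel_pair.Fubini'[symmetric]) measurable
  also have "\<dots> = (\<integral>\<^sup>+\<sigma>. ennreal (1/Gamma (1-\<alpha>) * z powr (2-\<gamma>) / (\<gamma> - 2)) * (ennreal (wt \<sigma> * \<sigma> powr (\<gamma> - 2)) * indicator {0<..<1} \<sigma>) \<partial>lborel)"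
  proof (rule nn_integral_cong_AE)
    have "AE x in lborel. x \<noteq> (1::real)" by (rule AE_lborel_singleton)
    then show "AE x in lborel. (\<integral>\<^sup>+\<rho>. ennreal (1/Gamma (1-\<alpha>)) * (ennreal (\<rho> powr (1 - \<gamma>)) * (if z \<le> \<rho> \<and> z \<le> \<rho> * x then 1 else 0) * 
           (if 0 < x \<and> x \<le> 1 then ennreal (wt x) else 0)) \<partial>lborel) = ennreal (1/Gamma (1-\<alpha>) * z powr (2-\<gamma>) / (\<gamma> - 2)) * (ennreal (wt x * x powr (\<gamma> - 2)) * indicator {0<..<1} x)"
    proof eventually_elim
      case (elim \<sigma>)
      show ?case
      proof (cases "\<sigma> \<in> {0<..<1}")
        case \<sigma>: True
        have zs: "z \<le> \<rho> \<and> z \<le> \<rho> * \<sigma> \<longleftrightarrow> z / \<sigma> \<le> \<rho>" for \<rho>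
      proof -
        have "z \<le> z / \<sigma>" using \<sigma> assms by (simp add: field_simps)
        then show ?thesis using \<sigma> order_trans[of z "z/\<sigma>" \<rho>] pos_divide_le_eq[of \<sigma> z \<rho>] by auto
      qed
      have "(\<integral>\<^sup>+\<rho>. ennreal (1/Gamma (1-\<alpha>)) * (ennreal (\<rho> powr (1 - \<gamma>)) * (if z \<le> \<rho> \<and> z \<le> \<rho> * \<sigma> then 1 else 0) * 
             (if 0 < \<sigma> \<and> \<sigma> \<le> 1 then ennreal (wt \<sigma>) else 0)) \<partial>lborel)
          = (\<integral>\<^sup>+\<rho>. ennreal (1/Gamma (1-\<alpha>) * wt \<sigma>) * (ennreal (\<rho> powr (-(\<gamma> - 2) - 1)) * indicator {z/\<sigma>..} \<rho>) \<partial>lborel)"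
        unfolding zs
        using \<sigma> assms Gamma_pos wt_nonneg by (intro nn_integral_cong) (auto simp: indicator_def ennreal_mult'[symmetric] mult_ac)
      also have "\<dots> = ennreal (1/Gamma (1-\<alpha>) * wt \<sigma>) * ennreal ((z / \<sigma>) powr (-(\<gamma> - 2)) / (\<gamma> - 2))"
        using assms \<sigma> nn_integral_powr_to_inf[of "\<gamma> - 2" "z / \<sigma>"] by (subst nn_integral_cmult) auto
      also have "(z / \<sigma>) powr (-(\<gamma> - 2)) = z powr (2 - \<gamma>) * \<sigma> powr (\<gamma> - 2)"
        using \<sigma> assms by (simp add: powr_divide powr_diff field_simps powr_minus_divide)
      also have "ennreal (1/Gamma (1-\<alpha>) * wt \<sigma>) * ennreal (z powr (2 - \<gamma>) * \<sigma> powr (\<gamma> - 2) / (\<gamma> - 2))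
        = ennreal (1/Gamma (1-\<alpha>) * z powr (2-\<gamma>) / (\<gamma> - 2)) * (ennreal (wt \<sigma> * \<sigma> powr (\<gamma> - 2)) * indicator {0<..<1} \<sigma>)"
        using \<sigma> assms Gamma_pos wt_nonneg by (simp add: ennreal_mult'[symmetric] mult_ac)
      finally show ?thesis .
      qed (use elim in \<open>auto simp: indicator_def\<close>)
    qed
  qed
  also have "\<dots> = ennreal (1/Gamma (1-\<alpha>) * z powr (2-\<gamma>) / (\<gamma> - 2)) * ennreal (b * Beta (b * ((\<gamma> - 2) + 2 - real d)) (1 - \<alpha>))"
    using assms using nn_integral_wt_powr[of "\<gamma> - 2"] by (subst nn_integral_cmult) auto
  also have "\<dots> = ennreal (z powr (2 - \<gamma>) * QF \<gamma>)"
  proof -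
    have "b * (\<gamma> - 2 + 2 - real d) + (1 - \<alpha>) = 1 - \<alpha> + b * (\<gamma> - real d)"
      "Gamma (b * (\<gamma> - real d) + (1 - \<alpha>)) = Gamma (1 - \<alpha> + b * (\<gamma> - real d))"
      by (simp_all add: add.commute)
    then show ?thesis
      unfolding QF_def Beta_def using Gamma_pos assms by (simp add: ennreal_mult'[symmetric])
  qed
  finally show ?thesis .
qed

lemma Q_moment_eq:
  assumes "2 < \<gamma>" "real d < \<gamma>"
  shows "Q_moment d \<alpha> m \<gamma> = QF \<gamma>"
proof -
  have "(\<integral>\<^sup>+z\<in>{0<..}. ennreal (z powr ((\<gamma> - 2) - 1) * K z 1) \<partial>lborel) = ennreal (1 powr ((\<gamma> - 2) + 1) * QF ((\<gamma>-2) + 2))"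
    by (rule nn_integral_powr_K) (use assms in auto)
  also have "(\<integral>\<^sup>+z\<in>{0<..}. ennreal (z powr ((\<gamma> - 2) - 1) * K z 1) \<partial>lborel)
     = (\<integral>\<^sup>+z. ennreal (indicator {0<..<1} z *\<^sub>R (Q z * z powr (\<gamma> - 3))) \<partial>lborel)"
    by (intro nn_integral_cong) (auto simp: indicator_def K_ker_def mult.commute Q_zero)
  finally have *: "(\<integral>\<^sup>+z. ennreal (indicator {0<..<1} z *\<^sub>R (Q z * z powr (\<gamma> - 3))) \<partial>lborel) = ennreal (QF \<gamma>)" by simp
  show ?thesis
    unfolding Q_moment_def set_lebesgue_integral_def
    using * QF_pos[OF assms] Q_nonneg
    by (subst integral_eq_nn_integral) auto
qed

end

subsection \<open>Solutions of the profile equation\<close>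

context profile_params
begin

lemma continuous_on_Q: "continuous_on {0<..} Q"
proof -
  have *: "continuous_on {a..} Q" if a: "0 < a" "a < 1" for a
  proof -
    have wi: "wt integrable_on {a..1}"
      using set_borel_integral_eq_integral(1)[OF set_integrable_wt[OF a(1)]] .
    have Qe: "Q x = 1 / Gamma (1-\<alpha>) * integral {x..1} wt" if "a \<le> x" for x
    proof -
      have "0 < x" using that a by simp
      then show ?thesis unfolding Q_eq using set_borel_integral_eq_integral(2)[OF set_integrable_wt] by simp
    qed
    have "continuous_on {a..1} (\<lambda>x. 1 / Gamma (1-\<alpha>) * integral {x..1} wt)"
      by (intro continuous_intros indefinite_integral_continuous_1' wi)
    then have "continuous_on {a..1} Q"
      by (rule continuous_on_eq) (simp add: Qe)
    then have "continuous_on {a..} (\<lambda>x. Q (min x 1))"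
      by (rule continuous_on_compose2[of _ Q]) (use a in \<open>auto intro!: continuous_intros\<close>)
    \<comment> \<open>\<open>Q\<close> is a primitive of an integrable function on
      \<open>[a, 1]\<close> and vanishes from 1 on, so cutting the argument at 1 changes
      nothing.\<close>
    moreover have "Q (min x 1) = Q x" for x by (cases "x \<le> 1") (auto simp: Q_zero)
    ultimately show ?thesis by simp
  qed
  have "isCont Q x" if "x \<in> {0<..}" for x
  proof -
    have "min x 1 / 2 > 0" "min x 1 / 2 < 1" using that by auto
    then have "continuous_on {min x 1 / 2<..} Q" by (rule continuous_on_subset[OF *]) auto
    then show ?thesis using that by (subst (asm) continuous_on_eq_continuous_at) (auto simp: min_def)
  qed
  then show ?thesis by (intro continuous_at_imp_continuous_on) auto
qed

lemma K_nonneg: "0 \<le> \<rho> \<Longrightarrow> 0 \<le> K z \<rho>"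
  unfolding K_ker_def using Q_nonneg by simp

lemma K_zero: "0 < \<rho> \<Longrightarrow> \<rho> \<le> z \<Longrightarrow> K z \<rho> = 0"
  unfolding K_ker_def by (simp add: Q_zero)

text \<open>The factor \<open>\<rho> powr d\<close> is the reason why the moment of order
  \<open>d\<close>, one above the mass, has to be controlled later.\<close>

lemma K_le:
  assumes "0 < z" "0 < \<rho>"
  shows "K z \<rho> \<le> QC * z powr (1 - real d) * \<rho> powr real d"
proof -
  have "K z \<rho> \<le> \<rho> * (QC * (z / \<rho>) powr (1 - real d))"
    unfolding K_ker_def using assms by (intro mult_left_mono Q_le) auto
  also have "\<dots> = QC * z powr (1 - real d) * \<rho> powr real d"
    using assms by (simp add: powr_divide powr_diff field_simps)
  finally show ?thesis .
qed

lemma K_antimono: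
  assumes "0 < z" "z \<le> z'" "0 < \<rho>"
  shows "K z' \<rho> \<le> K z \<rho>"
  unfolding K_ker_def using assms by (intro mult_left_mono Q_antimono) (auto simp: divide_right_mono)

text \<open>An equation in \<open>ennreal\<close> includes finiteness of the integral. With the
  power \<open>m\<close> on the right no root is taken, and Tonelli applies to both sides.
  Continuity is a consequence, given a moment bound (\<open>sol_continuous_on\<close>).\<close>

definition sol :: "(real \<Rightarrow> real) \<Rightarrow> bool" where
  "sol u \<longleftrightarrow> u \<in> borel_measurable borel \<and> (\<forall>z>0. 0 \<le> u z) \<and>
     (\<forall>z>0. (\<integral>\<^sup>+\<rho>\<in>{z..}. ennreal (K z \<rho> * u \<rho>) \<partial>lborel) = ennreal (u z powr m))"

end

text \<open>\<open>mom (d - 1)\<close> is the mass divided by the area of the unit sphere.\<close>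

definition mom :: "real \<Rightarrow> (real \<Rightarrow> real) \<Rightarrow> ennreal" where
  "mom s u = (\<integral>\<^sup>+\<rho>\<in>{0<..}. ennreal (\<rho> powr s * u \<rho>) \<partial>lborel)"

text \<open>Pointwise, \<open>\<rho> powr s\<close> is at most the sum of its two neighbours. With
  \<open>s = d\<close> this bounds the moment needed for \<open>K_le\<close> by the mass and the
  moment of order \<open>d + 1\<close>.\<close>

lemma mom_interpolate:
  assumes "u \<in> borel_measurable borel" "\<And>z. 0 < z \<Longrightarrow> 0 \<le> u z"
  shows "mom s u \<le> mom (s - 1) u + mom (s + 1) u"
proof -
  have "mom s u \<le> (\<integral>\<^sup>+\<rho>. ennreal (\<rho> powr (s - 1) * u \<rho>) * indicator {0<..} \<rho> + ennreal (\<rho> powr (s + 1) * u \<rho>) * indicator {0<..} \<rho> \<partial>lborel)"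
    unfolding mom_def
  proof (intro nn_integral_mono)
    fix \<rho> :: real
    show "ennreal (\<rho> powr s * u \<rho>) * indicator {0<..} \<rho> \<le> ennreal (\<rho> powr (s - 1) * u \<rho>) * indicator {0<..} \<rho> + ennreal (\<rho> powr (s + 1) * u \<rho>) * indicator {0<..} \<rho>"
    proof (cases "0 < \<rho>")
      case True
      have "\<rho> powr s \<le> \<rho> powr (s-1) + \<rho> powr (s+1)"
      proof (cases "\<rho> \<le> 1")
        case T: True
        then have "\<rho> powr s \<le> \<rho> powr (s-1)" using True by (intro powr_mono') auto
        then show ?thesis using powr_ge_zero[of \<rho> "s+1"] by linarith
      next
        case False
        then have "\<rho> powr s \<le> \<rho> powr (s+1)" using True by (intro powr_mono) auto
        then show ?thesis using powr_ge_zero[of \<rho> "s-1"] by linarith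
      qed
      then have "\<rho> powr s * u \<rho> \<le> \<rho> powr (s-1) * u \<rho> + \<rho> powr (s+1) * u \<rho>"
        using assms(2)[OF True] by (metis distrib_right mult_right_mono)
      then show ?thesis using True assms(2)[OF True] by (simp add: ennreal_plus[symmetric] del: ennreal_plus)
    qed simp
  qed
  also have "\<dots> = mom (s - 1) u + mom (s + 1) u"
    unfolding mom_def using assms(1) by (intro nn_integral_add) auto
  finally show ?thesis .
qed

text \<open>A Chebyshev bound: for nonincreasing \<open>u\<close>, the value \<open>u z\<close>
  times the integral of \<open>\<rho> powr s\<close> over \<open>[0, z]\<close> is at most the
  moment.\<close>

lemma antimono_le_mom:
  assumes "\<And>z. 0 < z \<Longrightarrow> 0 \<le> u z" "\<And>z z'. 0 < z \<Longrightarrow> z \<le> z' \<Longrightarrow> u z' \<le> u z"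
    and "-1 < s" "0 < z" "mom s u \<le> ennreal c" "0 \<le> c"
  shows "u z \<le> c * (s + 1) * z powr (- (s + 1))"
proof -
  have "(\<integral>\<^sup>+\<rho>. ennreal (u z) * (ennreal (\<rho> powr ((s + 1) - 1)) * indicator {0..z} \<rho>) \<partial>lborel) \<le> mom s u"
    unfolding mom_def
  proof (intro nn_integral_mono_AE)
    have "AE x in lborel. x \<noteq> (0::real)" by (rule AE_lborel_singleton)
    then show "AE \<rho> in lborel. ennreal (u z) * (ennreal (\<rho> powr ((s + 1) - 1)) * indicator {0..z} \<rho>) \<le> ennreal (\<rho> powr s * u \<rho>) * indicator {0<..} \<rho>"
      by eventually_elim (use assms in \<open>auto simp: indicator_def ennreal_mult'[symmetric] mult.commute mult_right_mono\<close>)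
  qed
  also have "(\<integral>\<^sup>+\<rho>. ennreal (u z) * (ennreal (\<rho> powr ((s + 1) - 1)) * indicator {0..z} \<rho>) \<partial>lborel) = ennreal (u z) * ennreal (z powr (s+1) / (s+1))"
    using assms nn_integral_powr_from_0[of "s+1" z] by (subst nn_integral_cmult) auto
  also note assms(5)
  finally have "ennreal (u z * (z powr (s+1) / (s+1))) \<le> ennreal c"
    using assms(1,3,4) by (simp add: ennreal_mult'[symmetric])
  then have "u z * (z powr (s+1) / (s+1)) \<le> c" using assms(6) by (subst (asm) ennreal_le_iff) auto
  then have "u z \<le> c * (s + 1) / z powr (s + 1)" using assms(3,4) by (simp add: pos_le_divide_eq pos_divide_le_eq)
  then show ?thesis unfolding powr_minus by (simp add: divide_inverse)
qed

section \<open>Monotonicity, Mellin identity and continuity of solutions\<close>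

context profile_params
begin

lemma sol_measurable: "sol u \<Longrightarrow> u \<in> borel_measurable borel"
  and sol_nonneg: "sol u \<Longrightarrow> 0 < z \<Longrightarrow> 0 \<le> u z"
  and sol_eq: "sol u \<Longrightarrow> 0 < z \<Longrightarrow> (\<integral>\<^sup>+\<rho>\<in>{z..}. ennreal (K z \<rho> * u \<rho>) \<partial>lborel) = ennreal (u z powr m)"
  unfolding sol_def by auto

lemma nn_integral_K_extend:
  assumes "0 < z"
  shows "(\<integral>\<^sup>+\<rho>\<in>{z..}. ennreal (K z \<rho> * u \<rho>) \<partial>lborel) = (\<integral>\<^sup>+\<rho>\<in>{0<..}. ennreal (K z \<rho> * u \<rho>) \<partial>lborel)"
  using assms K_zero[of _ z] by (intro nn_integral_cong) (auto simp: indicator_def)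

text \<open>The kernel is nonincreasing in \<open>z\<close>. Once both integrals are extended to the
  half-line they compare pointwise, and the power \<open>m > 0\<close> is stripped.\<close>

lemma sol_antimono:
  assumes "sol u" "0 < z" "z \<le> z'"
  shows "u z' \<le> u z"
proof -
  have "ennreal (u z' powr m) \<le> ennreal (u z powr m)"
    unfolding sol_eq[OF assms(1), symmetric, OF assms(2)] sol_eq[OF assms(1), symmetric, OF less_le_trans[OF assms(2,3)]]
      nn_integral_K_extend[OF assms(2)] nn_integral_K_extend[OF less_le_trans[OF assms(2,3)]]
    using assms sol_nonneg[OF assms(1)]
    by (intro nn_integral_mono) (auto simp: indicator_def intro!: ennreal_leI mult_right_mono K_antimono)
  then have "u z' powr m \<le> u z powr m" by (simp add: ennreal_le_iff)
  then show ?thesis using m assms sol_nonneg[OF assms(1)] by (meson powr_less_mono2 not_le less_le_trans)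
qed

lemma nn_integral_powr_T:
  assumes [measurable]: "u \<in> borel_measurable borel" and nn: "\<And>z. 0 < z \<Longrightarrow> 0 \<le> u z" and "0 < s" "real d < s + 2"
  shows "(\<integral>\<^sup>+z\<in>{0<..}. ennreal (z powr (s - 1)) * (\<integral>\<^sup>+\<rho>\<in>{z..}. ennreal (K z \<rho> * u \<rho>) \<partial>lborel) \<partial>lborel)
    = ennreal (QF (s + 2)) * mom (s + 1) u"
proof -
  have "(\<integral>\<^sup>+z\<in>{0<..}. ennreal (z powr (s - 1)) * (\<integral>\<^sup>+\<rho>\<in>{z..}. ennreal (K z \<rho> * u \<rho>) \<partial>lborel) \<partial>lborel)
    = (\<integral>\<^sup>+z. (\<integral>\<^sup>+\<rho>. ennreal (z powr (s - 1) * K z \<rho>) * indicator {0<..} z * (ennreal (u \<rho>) * indicator {0<..} \<rho>) \<partial>lborel) \<partial>lborel)"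
  proof (intro nn_integral_cong)
    fix z :: real
    show "ennreal (z powr (s - 1)) * (\<integral>\<^sup>+\<rho>\<in>{z..}. ennreal (K z \<rho> * u \<rho>) \<partial>lborel) * indicator {0<..} z =
      (\<integral>\<^sup>+\<rho>. ennreal (z powr (s - 1) * K z \<rho>) * indicator {0<..} z * (ennreal (u \<rho>) * indicator {0<..} \<rho>) \<partial>lborel)"
    proof (cases "0 < z")
      case True
      then show ?thesis
        unfolding nn_integral_K_extend[OF True] using K_nonneg
        by (subst nn_integral_cmult[symmetric])
           (auto intro!: nn_integral_cong simp: indicator_def ennreal_mult'[symmetric] nn mult.assoc)
    qed simp
  qed
  also have "\<dots> = (\<integral>\<^sup>+\<rho>. (\<integral>\<^sup>+z. ennreal (z powr (s - 1) * K z \<rho>) * indicator {0<..} z * (ennreal (u \<rho>) * indicator {0<..} \<rho>) \<partial>lborel) \<partial>lborel)"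
    by (rule lborel_pair.Fubini'[symmetric]) measurable
  also have "\<dots> = (\<integral>\<^sup>+\<rho>. ennreal (QF (s+2)) * (ennreal (\<rho> powr (s+1) * u \<rho>) * indicator {0<..} \<rho>) \<partial>lborel)"
  proof (intro nn_integral_cong)
    fix \<rho> :: real
    show "(\<integral>\<^sup>+z. ennreal (z powr (s - 1) * K z \<rho>) * indicator {0<..} z * (ennreal (u \<rho>) * indicator {0<..} \<rho>) \<partial>lborel)
       = ennreal (QF (s+2)) * (ennreal (\<rho> powr (s+1) * u \<rho>) * indicator {0<..} \<rho>)"
    proof (cases "0 < \<rho>")
      case True
      then have "(\<integral>\<^sup>+z. ennreal (z powr (s - 1) * K z \<rho>) * indicator {0<..} z * (ennreal (u \<rho>) * indicator {0<..} \<rho>) \<partial>lborel)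
         = ennreal (\<rho> powr (s + 1) * QF (s + 2)) * ennreal (u \<rho>)"
        using assms nn_integral_powr_K[of s \<rho>] by (subst nn_integral_multc) auto
      then show ?thesis using assms QF_pos[of "s+2"] nn[OF True] True
        by (simp add: ennreal_mult'[symmetric] mult_ac)
    qed simp
  qed
  also have "\<dots> = ennreal (QF (s + 2)) * mom (s + 1) u"
    unfolding mom_def by (intro nn_integral_cmult) auto
  finally show ?thesis .
qed

text \<open>On the Mellin side the operator becomes multiplication by \<open>QF (s + 2)\<close> and
  a shift of the order by 2. The case \<open>s = d\<close> gives the uniform moment bound; the cases
  \<open>s = d + 2 k\<close> with \<open>m = 1\<close> give all even moments.\<close>

lemma sol_mellin:
  assumes "sol u" "0 < s" "real d < s + 2"
  shows "(\<integral>\<^sup>+z\<in>{0<..}. ennreal (z powr (s - 1) * u z powr m) \<partial>lborel) = ennreal (QF (s + 2)) * mom (s + 1) u"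
proof -
  have "(\<integral>\<^sup>+z\<in>{0<..}. ennreal (z powr (s - 1) * u z powr m) \<partial>lborel)
     = (\<integral>\<^sup>+z\<in>{0<..}. ennreal (z powr (s - 1)) * (\<integral>\<^sup>+\<rho>\<in>{z..}. ennreal (K z \<rho> * u \<rho>) \<partial>lborel) \<partial>lborel)"
  proof (intro nn_integral_cong)
    fix z :: real
    show "ennreal (z powr (s - 1) * u z powr m) * indicator {0<..} z
      = ennreal (z powr (s - 1)) * (\<integral>\<^sup>+\<rho>\<in>{z..}. ennreal (K z \<rho> * u \<rho>) \<partial>lborel) * indicator {0<..} z"
      by (cases "0 < z") (simp_all only: sol_eq[OF assms(1)], simp_all add: ennreal_mult')
  qed
  also have "\<dots> = ennreal (QF (s + 2)) * mom (s + 1) u"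
    using assms by (intro nn_integral_powr_T) (auto simp: sol_measurable sol_nonneg)
  finally show ?thesis .
qed

lemma nn_integral_K_le_mom:
  assumes [measurable]: "u \<in> borel_measurable borel" and nn: "\<And>z. 0 < z \<Longrightarrow> 0 \<le> u z" and z: "0 < z"
  shows "(\<integral>\<^sup>+\<rho>\<in>{z..}. ennreal (K z \<rho> * u \<rho>) \<partial>lborel) \<le> ennreal (QC * z powr (1 - real d)) * mom (real d) u"
proof -
  have "(\<integral>\<^sup>+\<rho>\<in>{z..}. ennreal (K z \<rho> * u \<rho>) \<partial>lborel) \<le> (\<integral>\<^sup>+\<rho>. ennreal (QC * z powr (1 - real d)) * (ennreal (\<rho> powr (real d) * u \<rho>) * indicator {0<..} \<rho>) \<partial>lborel)"
    unfolding nn_integral_K_extend[OF z]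
    using QC_pos nn z
    by (intro nn_integral_mono)
       (auto simp: indicator_def ennreal_mult'[symmetric] mult.assoc[symmetric] intro!: ennreal_leI mult_right_mono K_le)
  also have "\<dots> = ennreal (QC * z powr (1 - real d)) * mom (real d) u"
    unfolding mom_def by (intro nn_integral_cmult) auto
  finally show ?thesis .
qed

lemma sol_le_mom:
  assumes "sol u" "mom (real d) u \<le> ennreal c" "0 \<le> c" "0 < z"
  shows "u z powr m \<le> QC * z powr (1 - real d) * c"
proof -
  have "ennreal (u z powr m) \<le> ennreal (QC * z powr (1 - real d)) * ennreal c"
    using nn_integral_K_le_mom[of u z] assms sol_measurable sol_nonneg mult_left_mono[OF assms(2)]
    unfolding sol_eq[OF assms(1,4)] by (meson order_trans zero_le)
  then show ?thesis using QC_pos assms by (simp add: ennreal_mult'[symmetric] ennreal_le_iff)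
qed

text \<open>Dominated convergence, with a majorant from \<open>K_le\<close> that is uniform on
  \<open>[a, \<infinity>)\<close>. Continuity is used twice: Helly's theorem asks for
  right-continuous functions, and an inverse Fourier transform has to be continuous off the
  origin.\<close>

lemma sol_continuous_on:
  assumes u: "sol u" and fin: "mom (real d) u < \<infinity>"
  shows "continuous_on {0<..} u"
proof -
  have [measurable]: "u \<in> borel_measurable borel" using u by (rule sol_measurable)
  have i: "set_integrable lborel {0<..} (\<lambda>\<rho>. \<rho> powr real d * u \<rho>)"
    using fin sol_nonneg[OF u] unfolding mom_def by (subst set_integrable_iff_nn_integral) auto
  have e: "(LINT \<rho>:{0<..}|lborel. K z \<rho> * u \<rho>) = u z powr m" if "0 < z" for z
    using that sol_nonneg[OF u] K_nonneg
    by (subst set_lebesgue_integral_nonneg_eq) (auto simp: nn_integral_K_extend[symmetric] sol_eq[OF u])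
  have *: "continuous_on {a..} (\<lambda>z. LINT \<rho>:{0<..}|lborel. K z \<rho> * u \<rho>)" if a: "0 < a" for a
    unfolding continuous_on_sequentially o_def
  proof (intro allI ballI impI, elim conjE)
    fix X z assume z: "z \<in> {a..}" and X: "\<forall>n. X n \<in> {a..}" "X \<longlonglongrightarrow> z"
    show "(\<lambda>n. LINT \<rho>:{0<..}|lborel. K (X n) \<rho> * u \<rho>) \<longlonglongrightarrow> (LINT \<rho>:{0<..}|lborel. K z \<rho> * u \<rho>)"
      unfolding set_lebesgue_integral_def
    proof (rule integral_dominated_convergence)
      show "integrable lborel (\<lambda>\<rho>. QC * a powr (1 - real d) * (indicator {0<..} \<rho> *\<^sub>R (\<rho> powr real d * u \<rho>)))"
        using i unfolding set_integrable_def by (rule integrable_mult_right)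
      show "AE \<rho> in lborel. (\<lambda>n. indicator {0<..} \<rho> *\<^sub>R (K (X n) \<rho> * u \<rho>)) \<longlonglongrightarrow> indicator {0<..} \<rho> *\<^sub>R (K z \<rho> * u \<rho>)"
      proof (rule AE_I2)
        fix \<rho> :: real
        show "(\<lambda>n. indicator {0<..} \<rho> *\<^sub>R (K (X n) \<rho> * u \<rho>)) \<longlonglongrightarrow> indicator {0<..} \<rho> *\<^sub>R (K z \<rho> * u \<rho>)"
        proof (cases "0 < \<rho>")
          case True
          have "isCont Q (z / \<rho>)" using True z a continuous_on_Q by (auto simp: continuous_on_eq_continuous_at)
          moreover have "(\<lambda>n. X n / \<rho>) \<longlonglongrightarrow> z / \<rho>" using X True by (intro tendsto_intros) auto
          ultimately have "(\<lambda>n. Q (X n / \<rho>)) \<longlonglongrightarrow> Q (z / \<rho>)" by (rule isCont_tendsto_compose)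
          then show ?thesis unfolding K_ker_def by (intro tendsto_intros)
        qed simp
      qed
      fix n
      show "AE \<rho> in lborel. norm (indicator {0<..} \<rho> *\<^sub>R (K (X n) \<rho> * u \<rho>)) \<le> QC * a powr (1 - real d) * (indicator {0<..} \<rho> *\<^sub>R (\<rho> powr real d * u \<rho>))"
      proof (rule AE_I2)
        fix \<rho> :: real
        have "K (X n) \<rho> * u \<rho> \<le> QC * a powr (1 - real d) * \<rho> powr real d * u \<rho>" if \<rho>: "0 < \<rho>"
        proof (rule mult_right_mono)
          have "K (X n) \<rho> \<le> QC * X n powr (1 - real d) * \<rho> powr real d" using X a \<rho> less_le_trans[OF a] by (intro K_le) auto
          also have "\<dots> \<le> QC * a powr (1 - real d) * \<rho> powr real d"
            using X a QC_pos d by (intro mult_right_mono mult_left_mono powr_mono2') auto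
          finally show "K (X n) \<rho> \<le> QC * a powr (1 - real d) * \<rho> powr real d" .
        qed (use sol_nonneg[OF u \<rho>] in auto)
        then show "norm (indicator {0<..} \<rho> *\<^sub>R (K (X n) \<rho> * u \<rho>)) \<le> QC * a powr (1 - real d) * (indicator {0<..} \<rho> *\<^sub>R (\<rho> powr real d * u \<rho>))"
          using K_nonneg[of \<rho> "X n"] sol_nonneg[OF u, of \<rho>] by (cases "0 < \<rho>") (auto simp: mult.assoc)
      qed
    qed auto
  qed
  have "continuous_on {0<..} (\<lambda>z. LINT \<rho>:{0<..}|lborel. K z \<rho> * u \<rho>)"
  proof (intro continuous_at_imp_continuous_on ballI)
    fix z :: real assume z: "z \<in> {0<..}"
    then have "continuous_on {z/2<..} (\<lambda>z. LINT \<rho>:{0<..}|lborel. K z \<rho> * u \<rho>)"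
      by (intro continuous_on_subset[OF *[of "z/2"]]) auto
    then show "isCont (\<lambda>z. LINT \<rho>:{0<..}|lborel. K z \<rho> * u \<rho>) z"
      using z by (subst (asm) continuous_on_eq_continuous_at) auto
  qed
  then have "continuous_on {0<..} (\<lambda>z. (LINT \<rho>:{0<..}|lborel. K z \<rho> * u \<rho>) powr (1/m))"
    using m e by (intro continuous_on_powr') (auto simp: powr_ge_zero)
  then show ?thesis
  proof (rule continuous_on_eq)
    fix z :: real assume "z \<in> {0<..}"
    then show "(LINT \<rho>:{0<..}|lborel. K z \<rho> * u \<rho>) powr (1/m) = u z"
      using m sol_nonneg[OF u, of z] by (simp add: e powr_powr)
  qed
qed

end

subsection \<open>The canonical profile for \<open>m > 1\<close>\<close>

context profile_params
begin

abbreviation "T \<equiv> K_op d \<alpha> m"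

text \<open>The integral inside \<open>K_op\<close>, valued in \<open>ennreal\<close>.
  \<open>K_op\<close> uses a real integral, which is 0 when it diverges, so comparisons are made for
  \<open>NT\<close> and transferred only where \<open>NT\<close> is finite.\<close>

definition NT :: "(real \<Rightarrow> real) \<Rightarrow> real \<Rightarrow> ennreal" where
  "NT f z = (\<integral>\<^sup>+\<rho>\<in>{z..}. ennreal (K z \<rho> * f \<rho>) \<partial>lborel)"

lemma K_op_measurable:
  assumes [measurable]: "f \<in> borel_measurable borel"
  shows "T f \<in> borel_measurable borel"
proof -
  have "(\<lambda>z. (LINT \<rho>|lborel. (if z \<le> \<rho> then K z \<rho> * f \<rho> else 0)) powr (1/m)) \<in> borel_measurable borel"
    by measurable
  also have "(\<lambda>z. (LINT \<rho>|lborel. (if z \<le> \<rho> then K z \<rho> * f \<rho> else 0)) powr (1/m)) = T f"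
    unfolding K_op_def set_lebesgue_integral_def
    by (intro ext arg_cong2[where f="(powr)"] refl Bochner_Integration.integral_cong) (auto simp: indicator_def)
  finally show ?thesis .
qed

lemma K_op_nonneg: "0 \<le> T f z"
  unfolding K_op_def by simp

lemma K_op_powr:
  assumes "f \<in> borel_measurable borel" "\<And>z. 0 < z \<Longrightarrow> 0 \<le> f z" "0 < z" "NT f z < \<infinity>"
  shows "ennreal (T f z powr m) = NT f z"
proof -
  have "(LINT \<rho>:{z..}|lborel. K z \<rho> * f \<rho>) = enn2real (NT f z)"
    unfolding NT_def using assms K_nonneg by (intro set_lebesgue_integral_nonneg_eq) auto
  then show ?thesis using m assms unfolding K_op_def by (simp add: powr_powr)
qed

lemma NT_mono:
  assumes "\<And>\<rho>. z \<le> \<rho> \<Longrightarrow> f \<rho> \<le> g \<rho>" "0 < z"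
  shows "NT f z \<le> NT g z"
  unfolding NT_def using assms K_nonneg
  by (intro nn_integral_mono) (auto simp: indicator_def intro!: ennreal_leI mult_left_mono)

lemma NT_cmult:
  assumes "f \<in> borel_measurable borel" "0 \<le> c" "0 < z"
  shows "NT (\<lambda>\<rho>. c * f \<rho>) z = ennreal c * NT f z"
proof -
  have "NT (\<lambda>\<rho>. c * f \<rho>) z = (\<integral>\<^sup>+\<rho>. ennreal c * (ennreal (K z \<rho> * f \<rho>) * indicator {z..} \<rho>) \<partial>lborel)"
    unfolding NT_def using assms
    by (intro nn_integral_cong) (auto simp: indicator_def ennreal_mult'[symmetric] mult_ac)
  also have "\<dots> = ennreal c * NT f z"
    unfolding NT_def using assms by (intro nn_integral_cmult) auto
  finally show ?thesis .
qed

lemma K_op_ge: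
  assumes "f \<in> borel_measurable borel" "\<And>z. 0 < z \<Longrightarrow> 0 \<le> f z" "0 < z" "NT f z < \<infinity>"
    and "0 \<le> y" "ennreal (y powr m) \<le> NT f z"
  shows "y \<le> T f z"
proof -
  have "y powr m \<le> T f z powr m"
    using assms(6) K_op_powr[OF assms(1-4)] by (metis ennreal_le_iff powr_ge_zero)
  then show ?thesis using m assms(5) K_op_nonneg[of f z] by (meson powr_less_mono2 not_le)
qed

lemma K_op_le:
  assumes "f \<in> borel_measurable borel" "\<And>z. 0 < z \<Longrightarrow> 0 \<le> f z" "0 < z"
    and "0 \<le> y" "NT f z \<le> ennreal (y powr m)"
  shows "T f z \<le> y"
proof -
  have "NT f z < \<infinity>" using assms(5) by (simp add: le_less_trans)
  then have "T f z powr m \<le> y powr m"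
    using assms K_op_powr[OF assms(1-3)] by (metis ennreal_le_iff powr_ge_zero)
  then show ?thesis using m assms(4) K_op_nonneg[of f z] by (meson powr_less_mono2 not_le)
qed

text \<open>The operator is order preserving where it is finite, so the iterates increase and stay
  below \<open>W\<close>, and monotone convergence gives the equation for the limit. The
  supersolution property is stated for \<open>NT\<close> because it also supplies the finiteness
  under which \<open>T\<close> and \<open>NT\<close> correspond.\<close>

lemma sol_iterate:
  assumes f [measurable]: "f \<in> borel_measurable borel" and f0: "\<And>z. 0 < z \<Longrightarrow> 0 \<le> f z"
    and sub: "\<And>z. 0 < z \<Longrightarrow> f z \<le> T f z"
    and W [measurable]: "W \<in> borel_measurable borel" and fW: "\<And>z. 0 < z \<Longrightarrow> f z \<le> W z"
    and super: "\<And>z. 0 < z \<Longrightarrow> NT W z \<le> ennreal (W z powr m)"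
  defines "U \<equiv> (\<lambda>z. lim (\<lambda>n. (T ^^ n) f z))"
  shows "sol U \<and> (\<forall>z>0. f z \<le> U z \<and> U z \<le> W z)"
proof -
  define u where "u n = (T ^^ n) f" for n
  have u0: "u 0 = f" and us: "u (Suc n) = T (u n)" for n unfolding u_def by auto
  have um [measurable]: "u n \<in> borel_measurable borel" for n
    by (induction n) (auto simp: u0 us K_op_measurable)
  have unn: "0 \<le> u n z" if "0 < z" for n z
    using that by (cases n) (auto simp: u0 us K_op_nonneg f0)
  have W0: "0 \<le> W z" if "0 < z" for z using f0[OF that] fW[OF that] by simp
  have uW: "u n z \<le> W z" if "0 < z" for n z
    using that
  proof (induction n arbitrary: z)
    case (Suc n)
    have "NT (u n) z \<le> NT W z" using Suc by (intro NT_mono) auto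
    also note super[OF Suc.prems]
    finally show ?case unfolding us using Suc.prems unn W0 um by (intro K_op_le)
  qed (use fW u0 in auto)
  have fin: "NT (u n) z < \<infinity>" if "0 < z" for n z
  proof -
    have "NT (u n) z \<le> NT W z" using that uW by (intro NT_mono) auto
    also note super[OF that]
    finally show ?thesis by (simp add: le_less_trans)
  qed
  have inc: "u n z \<le> u (Suc n) z" if "0 < z" for n z
    using that
  proof (induction n arbitrary: z)
    case (Suc n)
    have "NT (u n) z \<le> NT (u (Suc n)) z" using Suc by (intro NT_mono) auto
    then have "NT (u n) z \<le> ennreal (u (Suc (Suc n)) z powr m)"
      using K_op_powr[of "u (Suc n)" z] um unn Suc.prems fin[OF Suc.prems] unfolding us[of "Suc n"] by simp
    then show ?case unfolding us[of n] using Suc.prems unn um by (intro K_op_le) auto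
  qed (use sub u0 us in auto)
  have incs: "incseq (\<lambda>n. u n z)" if "0 < z" for z
    using inc[OF that] by (rule incseq_SucI)
  have conv: "(\<lambda>n. u n z) \<longlonglongrightarrow> U z" if z: "0 < z" for z
  proof -
    obtain L where "(\<lambda>n. u n z) \<longlonglongrightarrow> L"
      using incseq_convergent[OF incs[OF z], of "W z"] uW[OF z] by blast
    then show ?thesis unfolding U_def u_def using limI by metis
  qed
  have U [measurable]: "U \<in> borel_measurable borel"
    unfolding U_def using um unfolding u_def by (intro borel_measurable_lim_metric) auto
  have fU: "f z \<le> U z" if "0 < z" for z
    using LIMSEQ_le_const[OF conv[OF that]] incseqD[OF incs[OF that], of 0] u0 by auto
  have UW: "U z \<le> W z" if "0 < z" for z
    using LIMSEQ_le_const2[OF conv[OF that]] uW[OF that] by auto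
  have "NT U z = ennreal (U z powr m)" if z: "0 < z" for z
  proof -
    have "(\<lambda>n. NT (u n) z) \<longlonglongrightarrow> NT U z"
      unfolding NT_def
    proof (rule nn_integral_LIMSEQ)
      show "incseq (\<lambda>n \<rho>. ennreal (K z \<rho> * u n \<rho>) * indicator {z..} \<rho>)"
      proof (rule incseq_SucI, rule le_funI)
        fix n and \<rho> :: real
        show "ennreal (K z \<rho> * u n \<rho>) * indicator {z..} \<rho> \<le> ennreal (K z \<rho> * u (Suc n) \<rho>) * indicator {z..} \<rho>"
          using inc[of \<rho> n] K_nonneg[of \<rho> z] z by (auto simp: indicator_def intro!: ennreal_leI mult_left_mono)
      qed
      fix \<rho> :: real
      show "(\<lambda>n. ennreal (K z \<rho> * u n \<rho>) * indicator {z..} \<rho>) \<longlonglongrightarrow> ennreal (K z \<rho> * U \<rho>) * indicator {z..} \<rho>"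
      proof (cases "z \<le> \<rho>")
        case True
        then have "(\<lambda>n. ennreal (K z \<rho> * u n \<rho>)) \<longlonglongrightarrow> ennreal (K z \<rho> * U \<rho>)"
          using conv[of \<rho>] z by (intro tendsto_ennrealI tendsto_intros) auto
        then show ?thesis using True by simp
      qed simp
    qed auto
    moreover have "(\<lambda>n. NT (u n) z) \<longlonglongrightarrow> ennreal (U z powr m)"
    proof -
      have "NT (u n) z = ennreal (u (Suc n) z powr m)" for n
        using K_op_powr[OF um unn z fin[OF z]] us by auto
      moreover have "(\<lambda>n. ennreal (u (Suc n) z powr m)) \<longlonglongrightarrow> ennreal (U z powr m)"
        using m LIMSEQ_Suc[OF conv[OF z]] unn[OF z]
        by (intro tendsto_ennrealI tendsto_powr') (auto intro!: always_eventually)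
      ultimately show ?thesis by simp
    qed
    ultimately show ?thesis by (rule LIMSEQ_unique)
  qed
  then have "sol U" unfolding sol_def NT_def using U fU f0 by (meson order_trans)
  then show ?thesis using fU UW by blast
qed

text \<open>The qualitative facts about a canonical profile on which the limit rests. Positive mass
  is included because \<open>mass_scale\<close> divides by it.\<close>

definition admissible :: "(real \<Rightarrow> real) \<Rightarrow> bool" where
  "admissible u \<longleftrightarrow> sol u \<and> 0 < mom (real d - 1) u \<and> mom (real d - 1) u < \<infinity> \<and> mom (real d + 1) u < \<infinity>"

lemma mom_pos:
  assumes [measurable]: "u \<in> borel_measurable borel" and "0 < r" "r < R" "\<And>z. r < z \<Longrightarrow> z < R \<Longrightarrow> 0 < u z"
  shows "0 < mom s u"
proof (rule ccontr)
  assume "\<not> 0 < mom s u"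
  then have "mom s u = 0" by simp
  then have "AE \<rho> in lborel. ennreal (\<rho> powr s * u \<rho>) * indicator {0<..} \<rho> = 0"
    unfolding mom_def by (subst (asm) nn_integral_0_iff_AE) auto
  then have "AE \<rho> in lborel. \<rho> \<notin> {r<..<R}"
    by eventually_elim (use assms in \<open>force simp: indicator_def ennreal_eq_0_iff mult_le_0_iff not_le split: if_splits\<close>)
  moreover have "{\<rho> \<in> space lborel. \<not> \<rho> \<notin> {r<..<R}} = {r<..<R}" by auto
  ultimately have "emeasure lborel {r<..<R} = 0"
    by (subst (asm) AE_iff_measurable[where N = "{r<..<R}"]) auto
  then show False using assms by simp
qed

text \<open>Bernoulli's inequality with an integer \<open>n \<ge> 1/b\<close> gives
  \<open>1 - \<sigma> powr (1/b) \<le> n * (1 - \<sigma>)\<close>, so the weight is at least of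
  order \<open>(1 - \<eta>) powr (-\<alpha>)\<close> on an interval of length
  \<open>1 - \<eta>\<close>. This rate fixes the exponent of \<open>V\<close> at the edge of the
  support.\<close>

lemma Q_ge_powr: "\<exists>c>0. \<forall>\<eta>. 0 < \<eta> \<longrightarrow> \<eta> < 1 \<longrightarrow> c * (1 - \<eta>) powr (1 - \<alpha>) \<le> Q \<eta>"
proof -
  define n where "n = nat \<lceil>1/b\<rceil>"
  have n: "1/b \<le> real n" unfolding n_def using b_pos by (simp add: real_nat_ceiling_ge)
  then have n0: "0 < real n" using b_pos by (meson less_le_trans zero_less_divide_1_iff)
  have "real n powr (-\<alpha>) / Gamma (1 - \<alpha>) * (1 - \<eta>) powr (1 - \<alpha>) \<le> Q \<eta>" if \<eta>: "0 < \<eta>" "\<eta> < 1" for \<eta>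
  proof -
    have "(real n powr (-\<alpha>) * (1 - \<eta>) powr (-\<alpha>)) * (1 - \<eta>) / Gamma (1 - \<alpha>) \<le> Q \<eta>"
    proof (rule Q_ge_integral[OF \<eta>(1)])
      show "((\<lambda>_. real n powr (-\<alpha>) * (1 - \<eta>) powr (-\<alpha>)) has_integral (real n powr (-\<alpha>) * (1 - \<eta>) powr (-\<alpha>)) * (1 - \<eta>)) {\<eta>..1}"
        using has_integral_const_real[of "real n powr (-\<alpha>) * (1 - \<eta>) powr (-\<alpha>)" \<eta> 1] \<eta> by (simp add: mult.commute)
      fix \<sigma> assume s: "\<eta> < \<sigma>" "\<sigma> < 1"
      then have s0: "0 < \<sigma>" using \<eta> by simp
      have "1 - real n * (1 - \<sigma>) \<le> (1 + (\<sigma> - 1)) ^ n"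
        using Bernoulli_inequality[of "\<sigma> - 1" n] s0 by (simp add: algebra_simps)
      also have "\<dots> = \<sigma> powr real n" using s0 by (simp add: powr_realpow)
      also have "\<dots> \<le> \<sigma> powr (1/b)" using n s s0 by (intro powr_mono') auto
      finally have "1 - \<sigma> powr (1/b) \<le> real n * (1 - \<sigma>)" by simp
      also have "\<dots> \<le> real n * (1 - \<eta>)" using s by (simp add: mult_left_mono)
      finally have "(real n * (1 - \<eta>)) powr (-\<alpha>) \<le> (1 - \<sigma> powr (1/b)) powr (-\<alpha>)"
        using \<alpha> powr_less_one'[OF s0 s(2), of "1/b"] b_pos by (intro powr_mono2') auto
      moreover have "1 \<le> \<sigma> powr (1 - real d)"
        using powr_mono'[of "1 - real d" 0 \<sigma>] s s0 d by simp
      ultimately show "real n powr (-\<alpha>) * (1 - \<eta>) powr (-\<alpha>) \<le> wt \<sigma>"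
        unfolding wt_def using \<eta> n0
        by (metis (no_types, lifting) diff_ge_0_iff_ge less_eq_real_def mult.right_neutral mult_mono powr_ge_zero powr_mult zero_le_one)
    qed
    moreover have "(1 - \<eta>) powr (-\<alpha>) * (1 - \<eta>) = (1 - \<eta>) powr (1 - \<alpha>)"
      using \<eta> by (simp add: powr_diff powr_minus_divide)
    ultimately show ?thesis by (simp add: mult.assoc)
  qed
  moreover have "real n powr (-\<alpha>) / Gamma (1 - \<alpha>) > 0" using n0 Gamma_pos by simp
  ultimately show ?thesis by blast
qed

section \<open>The barriers for \<open>m > 1\<close>\<close>

abbreviation "V \<equiv> V_fun d \<alpha> m"

lemma V_measurable [measurable]: "V \<in> borel_measurable borel"
  unfolding V_fun_def by measurable

lemma V_nonneg: "0 \<le> V z"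
  unfolding V_fun_def by simp

lemma NT_ge_const:
  assumes "0 < z" "z \<le> r" "r \<le> R" "0 \<le> y" "\<And>\<rho>. r \<le> \<rho> \<Longrightarrow> \<rho> \<le> R \<Longrightarrow> y \<le> K z \<rho> * f \<rho>"
  shows "ennreal (y * (R - r)) \<le> NT f z"
proof -
  have "ennreal (y * (R - r)) = (\<integral>\<^sup>+\<rho>. ennreal y * indicator {r..R} \<rho> \<partial>lborel)"
    using assms by (simp add: nn_integral_cmult_indicator ennreal_mult')
  also have "\<dots> \<le> NT f z"
    unfolding NT_def using assms by (intro nn_integral_mono) (auto simp: indicator_def intro!: ennreal_leI)
  finally show ?thesis .
qed

text \<open>On the middle third of \<open>[z, 1]\<close>, of length \<open>h = (1 - z) / 3\<close>,
  the kernel is at least of order \<open>h powr (1 - \<alpha>)\<close> and \<open>V\<close> of order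
  \<open>h powr p\<close>. With the length this gives the power
  \<open>(1 - \<alpha>) + p + 1\<close>, and \<open>p = (2 - \<alpha>) / (m - 1)\<close> is exactly
  the exponent for which it equals \<open>m * p\<close>.\<close>

lemma V_sub_near_one:
  assumes "1 < m"
  shows "\<exists>\<epsilon>>0. \<forall>z. 1/2 \<le> z \<longrightarrow> z < 1 \<longrightarrow> ennreal (\<epsilon> * V z powr m) \<le> NT V z"
proof -
  define p where "p = (2 - \<alpha>) / (m - 1)"
  have mp: "m * p = 1 - \<alpha> + p + 1" unfolding p_def using assms by (simp add: field_simps)
  have p0: "0 < p" unfolding p_def using assms \<alpha> by simp
  obtain c where c: "0 < c" "\<And>\<eta>. 0 < \<eta> \<Longrightarrow> \<eta> < 1 \<Longrightarrow> c * (1 - \<eta>) powr (1 - \<alpha>) \<le> Q \<eta>"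
    using Q_ge_powr by blast
  have "ennreal (c/2 * (1/3) powr (m * p) * V z powr m) \<le> NT V z" if z: "1/2 \<le> z" "z < 1" for z
  proof -
    define h where "h = (1 - z) / 3"
    have h: "0 < h" "3 * h = 1 - z" using z unfolding h_def by auto
    have "ennreal ((c / 2 * h powr (1 - \<alpha>) * h powr p) * ((z + 2*h) - (z + h))) \<le> NT V z"
    proof (rule NT_ge_const)
      fix \<rho> assume r: "z + h \<le> \<rho>" "\<rho> \<le> z + 2 * h"
      then have r1: "0 < \<rho>" "\<rho> < 1" "h \<le> 1 - \<rho>" "h \<le> \<rho> - z" "1/2 \<le> \<rho>" using z h by auto
      have "c / 2 * h powr (1 - \<alpha>) \<le> K z \<rho>"
      proof -
        have "h \<le> 1 - z / \<rho>"
        proof -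
          have "(\<rho> - z) * \<rho> \<le> \<rho> - z" using r1 h by (intro mult_left_le) auto
          then have "\<rho> - z \<le> (\<rho> - z) / \<rho>" using r1 by (simp add: field_simps)
          also have "\<dots> = 1 - z / \<rho>" using r1 by (simp add: field_simps)
          finally show ?thesis using r1 by simp
        qed
        then have "h powr (1 - \<alpha>) \<le> (1 - z / \<rho>) powr (1 - \<alpha>)" using h \<alpha> by (intro powr_mono2) auto
        then have "c * h powr (1 - \<alpha>) \<le> Q (z / \<rho>)"
          using c(1) c(2)[of "z/\<rho>"] r1 z h by (smt (verit) divide_less_eq_1_pos divide_pos_pos mult_left_mono)
        then have "1/2 * (c * h powr (1 - \<alpha>)) \<le> \<rho> * Q (z / \<rho>)"
          using r1 c by (intro mult_mono) auto
        then show ?thesis unfolding K_ker_def by simp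
      qed
      moreover have "h powr p \<le> V \<rho>"
        unfolding V_fun_def using r1 z h p0 r by (simp add: p_def[symmetric] powr_mono2)
      ultimately show "c / 2 * h powr (1 - \<alpha>) * h powr p \<le> K z \<rho> * V \<rho>"
        using c r1 by (intro mult_mono) (auto intro: K_nonneg)
    qed (use z h c in auto)
    moreover have "(c / 2 * h powr (1 - \<alpha>) * h powr p) * ((z + 2*h) - (z + h)) = c/2 * (1/3) powr (m * p) * V z powr m"
    proof -
      have "h powr (1 - \<alpha>) * h powr p * h = h powr (m * p)"
        unfolding mp powr_add using h by simp
      moreover have "V z powr m = (1 - z) powr (m * p)"
        unfolding V_fun_def p_def[symmetric] using z by (simp add: powr_powr mult.commute)
      moreover have "h powr (m * p) = (1/3) powr (m*p) * (1 - z) powr (m * p)"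
        unfolding h_def using z by (simp add: powr_divide)
      ultimately show ?thesis by (simp add: mult.assoc)
    qed
    ultimately show ?thesis by (simp only:)
  qed
  moreover have "0 < c/2 * (1/3) powr (m * p)" using c by simp
  ultimately show ?thesis by blast
qed

text \<open>Near 0 the power \<open>V z powr m\<close> has the singularity of \<open>Q\<close>, the
  integral of \<open>\<sigma> powr (1 - d)\<close>: a power, a logarithm or a constant. The argument
  \<open>8 * z / 5\<close> is the largest value of \<open>z / \<rho>\<close> for
  \<open>\<rho> \<ge> 5/8\<close>, which is how the bound is used next.\<close>

lemma Q_ge_V:
  "\<exists>c>0. \<forall>z. 0 < z \<longrightarrow> z < 1/2 \<longrightarrow> c * V z powr m \<le> Q (8 * z / 5)"
proof -
  have Vm: "V z powr m = (if d \<ge> 3 then z powr (- (real d - 2)) else if d = 2 then \<bar>ln z\<bar> else 1)" if "0 < z" "z < 1/2" for z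
    unfolding V_fun_def using that m by (auto simp: powr_powr)
  have wtg: "\<sigma> powr (1 - real d) \<le> wt \<sigma>" if "8 * z / 5 < \<sigma>" "\<sigma> < 1" "0 < z" for z \<sigma>
    using that by (intro wt_ge) auto
  consider "3 \<le> d" | "d = 2" | "d = 1" using d by linarith
  then show ?thesis
  proof cases
    case 1
    have "(1/5 * 2 powr (2 - real d)) / Gamma (1 - \<alpha>) * V z powr m \<le> Q (8*z/5)" if z: "0 < z" "z < 1/2" for z
    proof -
      \<comment> \<open>The piece \<open>[8 z / 5, 2 z]\<close> of the domain already gives the
        order \<open>z powr (2 - d)\<close>; it lies below 1 because \<open>z < 1/2\<close>.\<close>
      have "((2*z) powr (1 - real d) * (2 * z / 5)) / Gamma (1 - \<alpha>) \<le> Q (8 * z/5)"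
      proof (rule Q_ge_integral)
        have "((\<lambda>x. (2*z) powr (1 - real d)) has_integral ((2*z) powr (1 - real d) * (2 * z / 5))) {8*z/5..2*z}"
          using has_integral_const_real[of "(2*z) powr (1 - real d)" "8*z/5" "2*z"] z by (simp add: mult.commute)
        then show "((\<lambda>x. if x \<in> {8*z/5..2*z} then (2*z) powr (1 - real d) else 0) has_integral ((2*z) powr (1 - real d) * (2 * z / 5))) {8*z/5..1}"
          using z by (subst has_integral_restrict) auto
        fix \<sigma> assume s: "8*z/5 < \<sigma>" "\<sigma> < 1"
        show "(if \<sigma> \<in> {8*z/5..2*z} then (2*z) powr (1 - real d) else 0) \<le> wt \<sigma>"
        proof (cases "\<sigma> \<in> {8*z/5..2*z}")
          case True
          then have "(2*z) powr (1 - real d) \<le> \<sigma> powr (1 - real d)" using z s d by (intro powr_mono2') auto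
          then show ?thesis using True wtg[OF s z(1)] by simp
        qed (auto simp: wt_nonneg)
      qed (use z in auto)
      also have "(2*z) powr (1 - real d) * (2 * z / 5) = 1/5 * 2 powr (2 - real d) * V z powr m"
        unfolding Vm[OF z] using 1 z by (simp add: powr_mult powr_diff powr_minus_divide power2_eq_square field_simps)
      finally show ?thesis by simp
    qed
    moreover have "(1/5 * 2 powr (2 - real d)) / Gamma (1 - \<alpha>) > 0" using Gamma_pos by simp
    ultimately show ?thesis by blast
  next
    case 2
    have "(1/5) / Gamma (1 - \<alpha>) * V z powr m \<le> Q (8*z/5)" if z: "0 < z" "z < 1/2" for z
    proof -
      have "(- ln (8*z/5)) / Gamma (1 - \<alpha>) \<le> Q (8 * z/5)"
      proof (rule Q_ge_integral)
        have "((\<lambda>x. 1 / x) has_integral (ln 1 - ln (8*z/5))) {8*z/5..1}"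
          using z by (intro fundamental_theorem_of_calculus)
            (auto intro!: derivative_eq_intros simp: has_real_derivative_iff_has_vector_derivative[symmetric])
        then show "((\<lambda>x. 1/x) has_integral (- ln (8*z/5))) {8*z/5..1}" by simp
        fix \<sigma> assume s: "8*z/5 < \<sigma>" "\<sigma> < 1"
        show "1/\<sigma> \<le> wt \<sigma>" using wtg[OF s z(1)] s z 2 by (simp add: powr_minus_divide)
      qed (use z in auto)
      moreover have "1/5 * V z powr m \<le> - ln (8*z/5)"
      proof -
        have "ln z < ln (1/2)" using z by (subst ln_less_cancel_iff) auto
        then have l: "ln z \<le> - ln 2" by (simp add: ln_div)
        \<comment> \<open>\<open>(8/5)^5 \<le> 2^4\<close> and \<open>z < 1/2\<close> show that
          \<open>ln (8/5)\<close> costs at most four fifths of \<open>- ln z\<close>; the remaining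
          fifth is the constant \<open>1/5\<close>.\<close>
        have "5 * ln (8/5::real) = ln ((8/5)^5)" by (simp add: ln_realpow)
        also have "\<dots> \<le> ln (2^4)" by (subst ln_le_cancel_iff) (auto simp: power_divide)
        also have "\<dots> = 4 * ln 2" by (subst ln_realpow) auto
        finally have "5 * ln (8/5::real) \<le> 4 * ln 2" .
        moreover have "ln (8*z/5) = ln z + ln (8/5)" using z by (simp add: ln_mult ln_div)
        moreover have "ln z < 0" using l by (smt (verit) ln_gt_zero)
        ultimately show ?thesis unfolding Vm[OF z] using 2 l by simp
      qed
      ultimately show ?thesis using Gamma_pos by (simp add: divide_simps)
    qed
    moreover have "(1/5) / Gamma (1 - \<alpha>) > 0" using Gamma_pos by simp
    ultimately show ?thesis by blast
  next
    case 3
    have "(1/5) / Gamma (1 - \<alpha>) * V z powr m \<le> Q (8*z/5)" if z: "0 < z" "z < 1/2" for z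
    proof -
      have "(1 - 8*z/5) / Gamma (1 - \<alpha>) \<le> Q (8 * z/5)"
      proof (rule Q_ge_integral)
        show "((\<lambda>x. 1) has_integral (1 - 8*z/5)) {8*z/5..1}"
          using has_integral_const_real[of "1::real" "8*z/5" 1] z by simp
        fix \<sigma> assume s: "8*z/5 < \<sigma>" "\<sigma> < 1"
        show "1 \<le> wt \<sigma>" using wtg[OF s z(1)] s z 3 by simp
      qed (use z in auto)
      moreover have "1/5 * V z powr m \<le> 1 - 8*z/5" unfolding Vm[OF z] using 3 z by simp
      ultimately show ?thesis using Gamma_pos by (simp add: divide_simps)
    qed
    moreover have "(1/5) / Gamma (1 - \<alpha>) > 0" using Gamma_pos by simp
    ultimately show ?thesis by blast
  qed
qed

text \<open>The part of \<open>V\<close> over \<open>[5/8, 7/8]\<close>, bounded below by a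
  constant, already produces the full singularity at 0, since this singularity comes from the
  kernel.\<close>

lemma V_sub_near_zero:
  assumes "1 < m"
  shows "\<exists>\<epsilon>>0. \<forall>z. 0 < z \<longrightarrow> z < 1/2 \<longrightarrow> ennreal (\<epsilon> * V z powr m) \<le> NT V z"
proof -
  define p where "p = (2 - \<alpha>) / (m - 1)"
  have p0: "0 < p" unfolding p_def using assms \<alpha> by simp
  obtain c where c: "0 < c" "\<And>z. 0 < z \<Longrightarrow> z < 1/2 \<Longrightarrow> c * V z powr m \<le> Q (8 * z / 5)"
    using Q_ge_V by blast
  have "ennreal ((5/8 * c * (1/8) powr p / 4) * V z powr m) \<le> NT V z" if z: "0 < z" "z < 1/2" for z
  proof -
    have "ennreal ((5/8 * (c * V z powr m) * (1/8) powr p) * (7/8 - 5/8)) \<le> NT V z"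
    proof (rule NT_ge_const)
      fix \<rho> :: real assume r: "5/8 \<le> \<rho>" "\<rho> \<le> 7/8"
      have "z / \<rho> \<le> 8 * z / 5" using r z by (simp add: field_simps)
      then have "c * V z powr m \<le> Q (z / \<rho>)"
        using c(2)[OF z] Q_antimono[of "z/\<rho>" "8*z/5"] z r by auto
      then have "5/8 * (c * V z powr m) \<le> K z \<rho>"
        unfolding K_ker_def using r c by (intro mult_mono) auto
      moreover have "(1/8) powr p \<le> V \<rho>"
        unfolding V_fun_def using r p0 by (simp add: p_def[symmetric] powr_mono2)
      ultimately show "5/8 * (c * V z powr m) * (1/8) powr p \<le> K z \<rho> * V \<rho>"
        using c r by (intro mult_mono) (auto intro: K_nonneg)
    qed (use z c in auto)
    then show ?thesis by (simp add: mult_ac)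
  qed
  moreover have "0 < 5/8 * c * (1/8) powr p / 4" using c by simp
  ultimately show ?thesis by blast
qed

text \<open>By \<open>K_le\<close>, any integrable function supported in \<open>{0..1}\<close> is mapped below a multiple of \<open>W1\<close>.\<close>

definition W1 :: "real \<Rightarrow> real" where
  "W1 z = (if z \<le> 1 then z powr (- (real d - 1) / m) else 0)"

lemma W1_measurable [measurable]: "W1 \<in> borel_measurable borel"
  unfolding W1_def by measurable

lemma W1_nonneg: "0 \<le> W1 z"
  unfolding W1_def by simp

lemma V_le_W1:
  assumes "1 < m" "0 < z"
  shows "V z \<le> W1 z"
proof -
  have ge1: "1 \<le> z powr (- (real d - 1) / m)" if "z \<le> 1"
    using powr_mono'[of "- (real d - 1) / m" 0 z] that assms d m by (simp add: field_simps)
  consider "1 \<le> z" | "1/2 \<le> z" "z < 1" | "z < 1/2" by linarith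
  then show ?thesis
  proof cases
    case 1 then show ?thesis unfolding V_fun_def using W1_nonneg by simp
  next
    case 2
    have "(1 - z) powr ((2 - \<alpha>) / (m - 1)) \<le> 1"
      using 2 assms \<alpha> by (intro powr_le1) auto
    with 2 ge1 show ?thesis unfolding V_fun_def W1_def by simp
  next
    case 3
    define g where "g = (if d \<ge> 3 then z powr (- (real d - 2)) else if d = 2 then \<bar>ln z\<bar> else 1)"
    have "g \<le> z powr (- (real d - 1))"
    proof -
      consider "3 \<le> d" | "d = 2" | "d = 1" using d by linarith
      then show ?thesis
      proof cases
        case 1 then show ?thesis unfolding g_def using 3 assms by (simp add: powr_mono')
      next
        case 2
        have "ln (1/z) \<le> 1/z" using assms ln_le_minus_one[of "1/z"] by simp
        moreover have "ln z < 0" using 3 assms by simp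
        ultimately show ?thesis unfolding g_def using 2 assms 3
          by (simp add: ln_div powr_minus_divide)
      next
        case 3 then show ?thesis unfolding g_def using assms by simp
      qed
    qed
    then have "g powr (1/m) \<le> (z powr (- (real d - 1))) powr (1/m)"
      unfolding g_def using m by (intro powr_mono2) auto
    then show ?thesis unfolding V_fun_def W1_def g_def[symmetric] using 3 by (simp add: powr_powr)
  qed
qed

text \<open>As \<open>m > 1\<close>, the exponent \<open>(d - 1) / m\<close> is at most
  \<open>d - 1\<close>, so the integrand is bounded by 1 on the unit interval.\<close>

lemma mom_W1_le:
  assumes "1 < m" "real d - 1 \<le> s"
  shows "mom s W1 \<le> 1"
proof -
  have "mom s W1 \<le> (\<integral>\<^sup>+\<rho>. indicator {0..1::real} \<rho> \<partial>lborel)"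
    unfolding mom_def
  proof (intro nn_integral_mono)
    fix \<rho> :: real
    show "ennreal (\<rho> powr s * W1 \<rho>) * indicator {0<..} \<rho> \<le> indicator {0..1} \<rho>"
    proof (cases "0 < \<rho> \<and> \<rho> \<le> 1")
      case True
      have "(real d - 1) / m \<le> s"
        using assms d by (smt (verit) divide_le_eq_1 mult_less_cancel_left2 of_nat_1 of_nat_le_iff pos_divide_le_eq mult_left_le)
      then have "\<rho> powr (s - (real d - 1) / m) \<le> \<rho> powr 0"
        using True by (intro powr_mono') auto
      moreover have "s + - (real d - 1) / m = s - (real d - 1) / m" by (simp only: minus_divide_left[symmetric] diff_conv_add_uminus)
      ultimately have "\<rho> powr s * W1 \<rho> \<le> 1"
        unfolding W1_def using True by (simp only: powr_add[symmetric] if_True powr_zero_eq_one split: if_splits)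
      then show ?thesis using True by simp
    qed (auto simp: indicator_def W1_def)
  qed
  then show ?thesis by simp
qed

lemma NT_W1_le:
  assumes "1 < m" "0 < z"
  shows "NT W1 z \<le> ennreal (QC * W1 z powr m)"
proof (cases "z \<le> 1")
  case True
  have "NT W1 z \<le> ennreal (QC * z powr (1 - real d)) * mom (real d) W1"
    unfolding NT_def using assms W1_nonneg by (intro nn_integral_K_le_mom) auto
  also have "\<dots> \<le> ennreal (QC * z powr (1 - real d)) * 1"
    using assms by (intro mult_left_mono mom_W1_le) auto
  also have "z powr (1 - real d) = W1 z powr m"
    unfolding W1_def using True m by (simp add: powr_powr)
  finally show ?thesis by simp
next
  case False
  then have "NT W1 z = (\<integral>\<^sup>+\<rho>. 0 \<partial>(lborel :: real measure))"
    unfolding NT_def by (intro nn_integral_cong) (auto simp: indicator_def W1_def)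
  then show ?thesis by simp
qed

lemma V_const_prop:
  assumes "1 < m"
  shows "V_const d \<alpha> m > 0" "\<And>z. 0 < z \<Longrightarrow> V_const d \<alpha> m * V z \<le> T (\<lambda>r. V_const d \<alpha> m * V r) z"
proof -
  obtain e1 e2 where e: "0 < e1" "0 < e2"
    "\<And>z. 1/2 \<le> z \<Longrightarrow> z < 1 \<Longrightarrow> ennreal (e1 * V z powr m) \<le> NT V z"
    "\<And>z. 0 < z \<Longrightarrow> z < 1/2 \<Longrightarrow> ennreal (e2 * V z powr m) \<le> NT V z"
    using V_sub_near_one[OF assms] V_sub_near_zero[OF assms] by blast
  define e where "e = min e1 e2"
  have e0: "0 < e" unfolding e_def using e by simp
  have sub: "ennreal (e * V z powr m) \<le> NT V z" if z: "0 < z" for z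
  proof -
    consider "1 \<le> z" | "1/2 \<le> z" "z < 1" | "z < 1/2" by linarith
    then show ?thesis
    proof cases
      case 1 then show ?thesis by (simp add: V_fun_def)
    next
      case 2
      have "ennreal (e * V z powr m) \<le> ennreal (e1 * V z powr m)"
        unfolding e_def by (intro ennreal_leI mult_right_mono) auto
      then show ?thesis using e(3)[OF 2] by (rule order_trans)
    next
      case 3
      have "ennreal (e * V z powr m) \<le> ennreal (e2 * V z powr m)"
        unfolding e_def by (intro ennreal_leI mult_right_mono) auto
      then show ?thesis using e(4)[OF z 3] by (rule order_trans)
    qed
  qed
  \<comment> \<open>The solution of \<open>c powr m = c * e\<close>. It exists because the two sides
    of the equation scale differently, and it turns \<open>e * V powr m \<le> NT V\<close> into the
    subsolution inequality for \<open>c * V\<close>.\<close>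
  define c where "c = e powr (1 / (m - 1))"
  have c0: "0 < c" unfolding c_def using e0 by simp
  have cm: "c powr m = c * e"
  proof -
    have "c powr (m - 1) = e" unfolding c_def using e0 assms by (simp add: powr_powr)
    then show ?thesis using c0 powr_add[of c 1 "m - 1"] by simp
  qed
  have "c * V z \<le> T (\<lambda>r. c * V r) z" if z: "0 < z" for z
  proof (rule K_op_ge)
    have "NT V z \<le> NT W1 z" using z V_le_W1[OF assms] by (intro NT_mono) auto
    then have "NT V z < \<infinity>" using NT_W1_le[OF assms z] by (simp add: le_less_trans order_trans)
    then show "NT (\<lambda>r. c * V r) z < \<infinity>" using c0 z by (simp add: NT_cmult ennreal_mult_less_top)
    have "ennreal ((c * V z) powr m) = ennreal c * ennreal (e * V z powr m)"
      using c0 V_nonneg[of z] by (simp add: powr_mult cm ennreal_mult'[symmetric] mult_ac)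
    also have "\<dots> \<le> NT (\<lambda>r. c * V r) z"
      using c0 z sub[OF z] by (simp add: NT_cmult mult_left_mono)
    finally show "ennreal ((c * V z) powr m) \<le> NT (\<lambda>r. c * V r) z" .
  qed (use z c0 V_nonneg in auto)
  \<comment> \<open>\<open>V_const\<close> is a choice, so only its defining property may be used,
    and that needs one witness.\<close>
  then have "\<exists>c. c > 0 \<and> (\<forall>z>0. c * V z \<le> T (\<lambda>r. c * V r) z)" using c0 by blast
  from someI_ex[OF this] show "V_const d \<alpha> m > 0" "\<And>z. 0 < z \<Longrightarrow> V_const d \<alpha> m * V z \<le> T (\<lambda>r. V_const d \<alpha> m * V r) z"
    unfolding V_const_def[symmetric] by auto
qed

lemma admissible_profile_slow:
  assumes "1 < m"
  shows "admissible (profile_slow d \<alpha> m)"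
proof -
  define c where "c = V_const d \<alpha> m"
  \<comment> \<open>\<open>l * W1\<close> is a supersolution as soon as
    \<open>l * QC \<le> l powr m\<close>, which holds for large \<open>l\<close> because
    \<open>m > 1\<close>; \<open>l \<ge> c\<close> puts it above the start of the iteration.\<close>
  define l where "l = max c (QC powr (1 / (m - 1)))"
  note c = V_const_prop[OF assms, folded c_def]
  have l0: "0 < l" "c \<le> l" unfolding l_def using c by auto
  have "QC = (QC powr (1 / (m - 1))) powr (m - 1)" using QC_pos assms by (simp add: powr_powr)
  also have "\<dots> \<le> l powr (m - 1)" unfolding l_def using assms by (intro powr_mono2) auto
  finally have "l * QC \<le> l * l powr (m - 1)" using l0 by simp
  also have "\<dots> = l powr m" using l0 powr_add[of l 1 "m - 1"] by simp
  finally have lq: "l * QC \<le> l powr m" .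
  have it: "sol (\<lambda>z. lim (\<lambda>n. (T ^^ n) (\<lambda>r. c * V r) z)) \<and>
       (\<forall>z>0. c * V z \<le> lim (\<lambda>n. (T ^^ n) (\<lambda>r. c * V r) z) \<and> lim (\<lambda>n. (T ^^ n) (\<lambda>r. c * V r) z) \<le> l * W1 z)"
  proof (rule sol_iterate)
    fix z :: real assume z: "0 < z"
    show "c * V z \<le> l * W1 z" using z c l0 V_nonneg V_le_W1[OF assms] by (intro mult_mono) auto
    have "NT (\<lambda>z. l * W1 z) z \<le> ennreal l * ennreal (QC * W1 z powr m)"
      using l0 z NT_W1_le[OF assms z] by (simp add: NT_cmult mult_left_mono)
    also have "\<dots> = ennreal (l * QC * W1 z powr m)" using l0 by (simp add: ennreal_mult'[symmetric] mult_ac)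
    also have "\<dots> \<le> ennreal ((l * W1 z) powr m)"
      using l0 lq W1_nonneg by (intro ennreal_leI) (simp add: powr_mult mult_right_mono)
    finally show "NT (\<lambda>z. l * W1 z) z \<le> ennreal ((l * W1 z) powr m)" .
  qed (use c V_nonneg in auto)
  have e: "profile_slow d \<alpha> m = (\<lambda>z. lim (\<lambda>n. (T ^^ n) (\<lambda>r. c * V r) z))"
    unfolding profile_slow_def c_def by auto
  define U where "U = profile_slow d \<alpha> m"
  have it: "sol U" "\<And>z. 0 < z \<Longrightarrow> c * V z \<le> U z" "\<And>z. 0 < z \<Longrightarrow> U z \<le> l * W1 z"
    using it unfolding U_def e by blast+
  have [measurable]: "U \<in> borel_measurable borel" using it(1) by (rule sol_measurable)
  have fin: "mom s U < \<infinity>" if "real d - 1 \<le> s" for s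
  proof -
    have "mom s U \<le> (\<integral>\<^sup>+\<rho>. ennreal l * (ennreal (\<rho> powr s * W1 \<rho>) * indicator {0<..} \<rho>) \<partial>lborel)"
      unfolding mom_def
    proof (intro nn_integral_mono)
      fix \<rho> :: real
      show "ennreal (\<rho> powr s * U \<rho>) * indicator {0<..} \<rho> \<le> ennreal l * (ennreal (\<rho> powr s * W1 \<rho>) * indicator {0<..} \<rho>)"
        using it(3)[of \<rho>] l0 mult_left_mono[OF it(3)[of \<rho>], of "\<rho> powr s"]
        by (auto simp: indicator_def ennreal_mult'[symmetric] mult_ac intro!: ennreal_leI)
    qed
    also have "\<dots> = ennreal l * mom s W1" unfolding mom_def by (intro nn_integral_cmult) auto
    also have "\<dots> \<le> ennreal l * 1" using assms that by (intro mult_left_mono mom_W1_le) auto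
    finally show ?thesis by (simp add: le_less_trans)
  qed
  have "0 < mom (real d - 1) U"
  proof (rule mom_pos)
    fix z :: real assume "1/2 < z" "z < 1"
    then have "0 < c * V z" using c by (simp add: V_fun_def)
    then show "0 < U z" using it(2)[of z] \<open>1/2 < z\<close> by simp
  qed auto
  then show ?thesis unfolding admissible_def U_def[symmetric] using it fin by auto
qed

end

subsection \<open>The canonical profile for \<open>m < 1\<close>\<close>

text \<open>Concavity: the graph lies below its tangent at \<open>x = 0\<close>, here as a case of
  Young's inequality. For the subsolution the first-order expansion therefore suffices.\<close>

lemma powr_one_minus_le:
  fixes x m :: real
  assumes "0 \<le> x" "x \<le> 1" "0 < m" "m \<le> 1"
  shows "(1 - x) powr m \<le> 1 - m * x"
proof (cases "x = 1")
  case False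
  then have "(1 - x) powr m * 1 powr (1 - m) \<le> m * (1 - x) + (1 - m) * 1"
    using assms by (intro Youngs_inequality_0) auto
  then show ?thesis by (simp add: algebra_simps)
qed (use assms in auto)

text \<open>For \<open>x \<le> 1/2\<close> the number \<open>- ln (1 - x)\<close> exceeds
  \<open>x\<close> by at most \<open>2 * x\<^sup>2\<close>, and \<open>exp t \<ge> 1 + t\<close>.
  The explicit quadratic error is what the correction of the supersolution has to absorb.\<close>

lemma powr_one_minus_ge:
  fixes x m :: real
  assumes "0 \<le> x" "x \<le> 1/2" "0 < m"
  shows "1 - m * x - 2 * m * x\<^sup>2 \<le> (1 - x) powr m"
proof -
  have "1 + m * (- x - 2 * x\<^sup>2) \<le> 1 + m * ln (1 - x)"
    using ln_one_minus_pos_lower_bound[of x] assms by (simp add: mult_left_mono)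
  also have "\<dots> \<le> exp (m * ln (1 - x))" by (rule exp_ge_add_one_self)
  also have "\<dots> = (1 - x) powr m" using assms by (simp add: powr_def)
  finally show ?thesis by (simp add: algebra_simps)
qed

lemma mom_finite:
  assumes [measurable]: "u \<in> borel_measurable borel"
    and le1: "\<And>z. 0 < z \<Longrightarrow> z \<le> 1 \<Longrightarrow> u z \<le> C * z powr (-e)"
    and ge1: "\<And>z. 1 \<le> z \<Longrightarrow> u z \<le> C * z powr (-N)"
    and C: "0 \<le> C" and e: "e < s + 1" and N: "s + 1 < N"
  shows "mom s u < \<infinity>"
proof -
  have "mom s u \<le> (\<integral>\<^sup>+\<rho>. ennreal C * (ennreal (\<rho> powr ((s + 1 - e) - 1)) * indicator {0..1} \<rho>)
      + ennreal C * (ennreal (\<rho> powr (- (N - s - 1) - 1)) * indicator {1..} \<rho>) \<partial>lborel)"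
    unfolding mom_def
  proof (intro nn_integral_mono)
    fix \<rho> :: real
    consider "\<rho> \<le> 0" | "0 < \<rho>" "\<rho> \<le> 1" | "1 < \<rho>" by linarith
    then show "ennreal (\<rho> powr s * u \<rho>) * indicator {0<..} \<rho> \<le> ennreal C * (ennreal (\<rho> powr ((s + 1 - e) - 1)) * indicator {0..1} \<rho>)
      + ennreal C * (ennreal (\<rho> powr (- (N - s - 1) - 1)) * indicator {1..} \<rho>)"
    proof cases
      case 2
      have "\<rho> powr s * u \<rho> \<le> \<rho> powr s * (C * \<rho> powr (-e))" using 2 le1 by (intro mult_left_mono) auto
      also have "\<dots> = C * \<rho> powr ((s + 1 - e) - 1)" by (simp add: powr_add[symmetric] mult_ac)
      finally have "ennreal (\<rho> powr s * u \<rho>) \<le> ennreal C * ennreal (\<rho> powr ((s + 1 - e) - 1))"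
        using C by (simp add: ennreal_mult'[symmetric] ennreal_leI)
      then show ?thesis using 2 by (simp add: add_increasing2)
    next
      case 3
      have "\<rho> powr s * u \<rho> \<le> \<rho> powr s * (C * \<rho> powr (-N))" using 3 ge1 by (intro mult_left_mono) auto
      also have "\<dots> = C * \<rho> powr (- (N - s - 1) - 1)" by (simp add: powr_add[symmetric] mult_ac)
      finally have "ennreal (\<rho> powr s * u \<rho>) \<le> ennreal C * ennreal (\<rho> powr (- (N - s - 1) - 1))"
        using C by (simp add: ennreal_mult'[symmetric] ennreal_leI)
      then show ?thesis using 3 by (simp add: add_increasing)
    qed auto
  qed
  also have "\<dots> = ennreal C * ennreal (1 powr (s + 1 - e) / (s + 1 - e)) + ennreal C * ennreal (1 powr (-(N - s - 1)) / (N - s - 1))"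
    using e N nn_integral_powr_from_0[of "s+1-e" 1] nn_integral_powr_to_inf[of "N-s-1" 1]
    by (subst nn_integral_add) (simp_all add: nn_integral_cmult)
  also have "\<dots> < \<infinity>" by (simp add: ennreal_mult'[symmetric] C)
  finally show ?thesis .
qed

section \<open>The function \<open>QF\<close>: monotonicity, continuity and decay\<close>

context profile_params
begin

text \<open>The Gamma quotient is a normalised Beta value and nonincreasing, while
  \<open>b / (\<gamma> - 2)\<close> is strictly decreasing. Strictness makes
  \<open>gamma_star\<close> unique and gives \<open>r2 < m\<close>.\<close>

lemma QF_strict_antimono:
  assumes "2 < \<gamma>" "real d < \<gamma>" "\<gamma> < \<gamma>'"
  shows "QF \<gamma>' < QF \<gamma>"
proof -
  have G: "Gamma x / Gamma (1 - \<alpha> + x) = Beta x (1 - \<alpha>) / Gamma (1 - \<alpha>)" for x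
    unfolding Beta_def using Gamma_pos by (simp add: add.commute)
  have "Beta (b * (\<gamma>' - real d)) (1 - \<alpha>) \<le> Beta (b * (\<gamma> - real d)) (1 - \<alpha>)"
    using assms b_pos \<alpha> by (intro Beta_real_mono) (auto intro!: mult_left_mono)
  then have le: "Gamma (b * (\<gamma>' - real d)) / Gamma (1 - \<alpha> + b * (\<gamma>' - real d)) \<le> Gamma (b * (\<gamma> - real d)) / Gamma (1 - \<alpha> + b * (\<gamma> - real d))"
    unfolding G using Gamma_pos by (intro divide_right_mono) auto
  have pos: "0 < Gamma (b * (\<gamma> - real d)) / Gamma (1 - \<alpha> + b * (\<gamma> - real d))"
    using b_pos \<alpha> assms by (intro divide_pos_pos Gamma_real_pos) (auto intro: add_pos_pos)
  have lt: "b / (\<gamma>' - 2) < b / (\<gamma> - 2)" using assms b_pos by (intro divide_strict_left_mono) auto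
  have "QF \<gamma>' \<le> b / (\<gamma>' - 2) * (Gamma (b * (\<gamma> - real d)) / Gamma (1 - \<alpha> + b * (\<gamma> - real d)))"
    unfolding QF_def using le assms b_pos by (intro mult_left_mono) auto
  also have "\<dots> < QF \<gamma>" unfolding QF_def using lt pos by (rule mult_strict_right_mono)
  finally show ?thesis .
qed

lemma isCont_QF:
  assumes "2 < \<gamma>" "real d < \<gamma>"
  shows "isCont QF \<gamma>"
proof -
  have "0 < b * (\<gamma> - real d)" "0 < 1 - \<alpha> + b * (\<gamma> - real d)"
    using b_pos \<alpha> assms by (auto intro: add_pos_pos)
  then have "b * (\<gamma> - real d) \<notin> \<int>\<^sub>\<le>\<^sub>0" "1 - \<alpha> + b * (\<gamma> - real d) \<notin> \<int>\<^sub>\<le>\<^sub>0" "Gamma (1 - \<alpha> + b * (\<gamma> - real d)) \<noteq> 0"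
    by (auto elim!: nonpos_Ints_cases' simp: Gamma_eq_zero_iff)
  then show ?thesis unfolding QF_def using assms by (intro continuous_intros) auto
qed

text \<open>With the Gamma quotient bounded, \<open>QF\<close> decays at least like
  \<open>1 / \<gamma>\<close>; this gives the right end point for the intermediate value argument
  behind \<open>gamma_star\<close>.\<close>

lemma QF_small:
  assumes "2 < \<gamma>" "real d < \<gamma>" "0 < \<epsilon>"
  shows "\<exists>g>0. QF (\<gamma> + g) \<le> \<epsilon>"
proof -
  define c where "c = (\<gamma> - 2) * QF \<gamma>"
  have c0: "0 < c" unfolding c_def using assms QF_pos by simp
  have le: "QF (\<gamma> + g) \<le> c / (\<gamma> + g - 2)" if "0 < g" for g
  proof -
    have G: "Gamma x / Gamma (1 - \<alpha> + x) = Beta x (1 - \<alpha>) / Gamma (1 - \<alpha>)" for x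
      unfolding Beta_def using Gamma_pos by (simp add: add.commute)
    have "Beta (b * (\<gamma> + g - real d)) (1 - \<alpha>) \<le> Beta (b * (\<gamma> - real d)) (1 - \<alpha>)"
      using assms that b_pos \<alpha> by (intro Beta_real_mono) (auto intro!: mult_left_mono)
    then have "QF (\<gamma> + g) \<le> b / (\<gamma> + g - 2) * (Gamma (b * (\<gamma> - real d)) / Gamma (1 - \<alpha> + b * (\<gamma> - real d)))"
      unfolding QF_def G using Gamma_pos that assms b_pos by (intro mult_left_mono divide_right_mono) auto
    also have "\<dots> = c / (\<gamma> + g - 2)" unfolding c_def QF_def using assms by simp
    finally show ?thesis .
  qed
  have "QF (\<gamma> + (c/\<epsilon> + 2)) \<le> c / (\<gamma> + (c/\<epsilon> + 2) - 2)" using c0 assms by (intro le) (auto intro: add_pos_pos)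
  also have "\<dots> \<le> c / (c / \<epsilon>)"
  proof (intro divide_left_mono mult_pos_pos)
    show "0 < c / \<epsilon>" using c0 assms by simp
    then show "0 < \<gamma> + (c/\<epsilon> + 2) - 2" using assms by linarith
  qed (use c0 assms in auto)
  also have "\<dots> = \<epsilon>" using c0 by simp
  finally show ?thesis using c0 assms by (intro exI[of _ "c/\<epsilon> + 2"]) (auto intro: add_pos_pos)
qed

lemma K_powr_integrable:
  assumes "2 < \<gamma>" "real d < \<gamma>" "0 < z"
  shows "set_integrable lborel {z..} (\<lambda>\<rho>. K z \<rho> * \<rho> powr (-\<gamma>))"
    and "(LINT \<rho>:{z..}|lborel. K z \<rho> * \<rho> powr (-\<gamma>)) = z powr (2 - \<gamma>) * QF \<gamma>"
proof -
  have nn: "0 \<le> K z \<rho> * \<rho> powr (-\<gamma>)" if "\<rho> \<in> {z..}" for \<rho> using that K_nonneg[of \<rho> z] assms(3) by simp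
  show "set_integrable lborel {z..} (\<lambda>\<rho>. K z \<rho> * \<rho> powr (-\<gamma>))"
    using nn by (subst set_integrable_iff_nn_integral) (auto simp: nn_integral_K_powr[OF assms])
  show "(LINT \<rho>:{z..}|lborel. K z \<rho> * \<rho> powr (-\<gamma>)) = z powr (2 - \<gamma>) * QF \<gamma>"
    using nn QF_pos[OF assms(1,2)] by (subst set_lebesgue_integral_nonneg_eq) (auto simp: nn_integral_K_powr[OF assms])
qed

end

text \<open>Values of \<open>m\<close> close to 1 are what the limit sees: \<open>md\<close> says
  \<open>m > 1 - 1/(2 d)\<close>. Then \<open>N > 4 d\<close>, so the decay
  \<open>z powr (-N)\<close> is fast enough for the moment of order \<open>d + 1\<close>.\<close>

locale fast_params = profile_params +
  assumes m1: "m < 1" and md: "real d * (1 - m) < 1/2"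
begin

definition "N = 2 / (1 - m)"
definition "c = c_star d \<alpha> m"
definition "g = gamma_star d \<alpha> m"

lemma N_gt: "4 * real d < N"
proof -
  have "4 * real d * (1 - m) < 2" using md by linarith
  then show ?thesis unfolding N_def using m1 by (subst pos_less_divide_eq) auto
qed

lemma N_gt2: "2 < N" "real d < N" "real d + 2 < N"
  using N_gt d by linarith+

lemma mN: "m * N = N - 2"
  unfolding N_def using m1 by (simp add: field_simps)

lemma c_eq: "c = QF N powr (- (1 / (1 - m)))"
proof -
  have b1: "b = \<alpha> / (2 - real d * (1 - m))" unfolding b_exp_def by (simp add: algebra_simps)
  have "N - real d = (2 - real d * (1 - m)) / (1 - m)" unfolding N_def using m1 by (simp add: field_simps)
  then have "b * (N - real d) = \<alpha> / (1 - m)" unfolding b1 using md by simp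
  moreover have "b / (N - 2) = (1 - m) * b / (2 * m)" unfolding N_def using m1 m by (simp add: field_simps)
  ultimately show ?thesis unfolding c_def c_star_def QF_def by simp
qed

lemma c_pos: "0 < c"
  unfolding c_eq using QF_pos[OF N_gt2(1,2)] by simp

text \<open>Together with \<open>mN\<close> this says that \<open>U_star\<close> solves the
  equation.\<close>

lemma c_powr: "c powr m = c * QF N"
proof -
  have "c powr (m - 1) = QF N"
  proof -
    have "- (1 / (1 - m)) * (m - 1) = 1" using m1 by (simp add: field_simps)
    then show ?thesis unfolding c_eq powr_powr using QF_pos[OF N_gt2(1,2)] by simp
  qed
  moreover have "c powr m = c * c powr (m - 1)" using c_pos powr_add[of c 1 "m - 1"] by simp
  ultimately show ?thesis by simp
qed

text \<open>\<open>QF (N + x)\<close> decreases strictly and continuously from \<open>QF N\<close>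
  to 0, and \<open>0 < m < 1\<close>; so the value \<open>m * QF N\<close> is taken exactly once and
  the definite description is meaningful.\<close>

lemma gamma_star_props: "0 < g" "QF (N + g) = m * QF N"
proof -
  have q0: "0 < QF N" by (rule QF_pos[OF N_gt2(1,2)])
  obtain g1 where g1: "0 < g1" "QF (N + g1) \<le> m * QF N"
    using QF_small[OF N_gt2(1,2), of "m * QF N"] q0 m by auto
  have "\<exists>x. 0 \<le> x \<and> x \<le> g1 \<and> QF (N + x) = m * QF N"
  proof (rule IVT2)
    show "m * QF N \<le> QF (N + 0)" using q0 m1 by simp
    show "\<forall>x. 0 \<le> x \<and> x \<le> g1 \<longrightarrow> isCont (\<lambda>x. QF (N + x)) x"
      using N_gt2 by (auto intro!: isCont_o2[of _ _ QF] continuous_intros isCont_QF)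
  qed (use g1 in auto)
  then obtain x where x: "0 \<le> x" "QF (N + x) = m * QF N" by blast
  have "x \<noteq> 0" using x q0 m1 by auto
  with x have x0: "0 < x" by simp
  have e1: "2 / (1 - m) = N" unfolding N_def ..
  have Qm: "Q_moment d \<alpha> m (N + y) = QF (N + y)" if "0 \<le> y" for y
    using that N_gt2 by (intro Q_moment_eq) auto
  have "g = x"
    unfolding g_def gamma_star_def e1
  proof (rule the_equality)
    show "0 < x \<and> Q_moment d \<alpha> m (N + x) = m * Q_moment d \<alpha> m N"
      using x0 x Qm[of x] Qm[of 0] by simp
    fix y assume "0 < y \<and> Q_moment d \<alpha> m (N + y) = m * Q_moment d \<alpha> m N"
    then have y: "0 < y" "QF (N + y) = QF (N + x)" using Qm[of y] Qm[of 0] x by auto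
    show "y = x"
    proof (rule ccontr)
      assume "y \<noteq> x"
      then show False using y x0 N_gt2 QF_strict_antimono[of "N + x" "N + y"] QF_strict_antimono[of "N + y" "N + x"]
        by (cases "y < x") auto
    qed
  qed
  then show "0 < g" "QF (N + g) = m * QF N" using x0 x by auto
qed

text \<open>
  With \<open>y = z powr (-g)\<close>, the kernel multiplies \<open>z powr (-N) * y ^ j\<close> by \<open>QF (N + j g)\<close> and
  \<open>z\<^sup>2\<close>, and for \<open>j = 1\<close> this factor is \<open>m * QF N\<close>.  So \<open>1 - y + B y\<^sup>2\<close> matches \<open>m\<close>-th powers to
  first order, and \<open>B\<close> is chosen so that the gain \<open>B (m - r2) y\<^sup>2\<close> dominates the second-order error.  The
  correction is frozen at \<open>y0\<close>, where it stops growing.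
\<close>

definition "r2 = QF (N + 2 * g) / QF N"
definition "B = max 1 (2 * m / (m - r2))"
definition "y0 = 1 / (2 * B)"
definition "\<eta> y = y - B * y\<^sup>2"
definition "Y z = min (z powr (-g)) y0"
definition "z1 = y0 powr (- 1 / g)"

lemma r2: "r2 < m" "QF (N + 2 * g) = r2 * QF N"
proof -
  have q0: "0 < QF N" by (rule QF_pos[OF N_gt2(1,2)])
  have "QF (N + 2 * g) < QF (N + g)" using gamma_star_props(1) N_gt2 by (intro QF_strict_antimono) auto
  then show "r2 < m" "QF (N + 2 * g) = r2 * QF N" unfolding r2_def using gamma_star_props q0
    by (auto simp: pos_divide_less_eq)
qed

lemma B: "1 \<le> B" "2 * m \<le> B * (m - r2)"
proof -
  show "1 \<le> B" unfolding B_def by simp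
  have "2 * m / (m - r2) \<le> B" unfolding B_def by simp
  then show "2 * m \<le> B * (m - r2)" using r2 by (simp add: pos_divide_le_eq)
qed

lemma y0: "0 < y0" "y0 \<le> 1/2" "B * y0 = 1/2"
  unfolding y0_def using B(1) by (auto simp: field_simps)

text \<open>\<open>y0 = 1 / (2 * B)\<close> is the vertex of the parabola \<eta>, the last point up
  to which it increases.\<close>

lemma eta_mono:
  assumes "0 \<le> x" "x \<le> y" "y \<le> y0"
  shows "\<eta> x \<le> \<eta> y"
proof -
  have "B * (x + y) \<le> B * (y0 + y0)" using assms B(1) by (intro mult_left_mono) auto
  also have "\<dots> = 1" using y0(3) by (simp add: algebra_simps)
  finally have "0 \<le> (y - x) * (1 - B * (x + y))" using assms by (intro mult_nonneg_nonneg) auto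
  also have "\<dots> = \<eta> y - \<eta> x" unfolding \<eta>_def by (simp add: algebra_simps power2_eq_square)
  finally show ?thesis by simp
qed

text \<open>The value at the vertex is \<open>y0 / 2 \<le> 1/4\<close>, which keeps
  \<open>\<eta> y\<close> in the range of \<open>powr_one_minus_ge\<close>.\<close>

lemma eta_bounds:
  assumes "0 \<le> y" "y \<le> y0"
  shows "0 \<le> \<eta> y" "\<eta> y \<le> y" "\<eta> y \<le> 1/4"
proof -
  show "0 \<le> \<eta> y" using eta_mono[of 0 y] assms by (simp add: \<eta>_def)
  show "\<eta> y \<le> y" unfolding \<eta>_def using B(1) by simp
  have "\<eta> y \<le> \<eta> y0" using assms by (intro eta_mono) auto
  also have "\<eta> y0 = y0 / 2" using y0(3) unfolding \<eta>_def power2_eq_square by (simp add: mult.assoc[symmetric])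
  finally show "\<eta> y \<le> 1/4" using y0 by simp
qed

lemma Y_bounds: "0 \<le> Y z" "Y z \<le> y0" "Y z \<le> z powr (-g)"
  unfolding Y_def using y0 by auto

section \<open>The corrected power is a supersolution\<close>

definition "F1 z = c * z powr (-N) * (1 - \<eta> (Y z))"

lemma F1_measurable [measurable]: "F1 \<in> borel_measurable borel"
  unfolding F1_def \<eta>_def Y_def by measurable

lemma F1_nonneg: "0 \<le> F1 z"
  unfolding F1_def using c_pos eta_bounds(3)[OF Y_bounds(1,2)[of z]] by (intro mult_nonneg_nonneg) auto

lemma F1_le: "F1 z \<le> c * z powr (-N)"
  unfolding F1_def using c_pos eta_bounds(1)[OF Y_bounds(1,2)[of z]] by (intro mult_left_le) auto

text \<open>The coefficients \<open>p\<close> and \<open>q\<close> are left free because the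
  comparison at a point \<open>z\<close> uses a combination adapted to that
  \<open>z\<close>.\<close>

lemma combination_integral:
  assumes "0 < z"
  shows "set_integrable lborel {z..} (\<lambda>\<rho>. K z \<rho> * (c * \<rho> powr (-N) - p * \<rho> powr (-(N + g)) + q * \<rho> powr (- (N + 2 * g))))" (is ?A)
    and "(LINT \<rho>:{z..}|lborel. K z \<rho> * (c * \<rho> powr (-N) - p * \<rho> powr (-(N + g)) + q * \<rho> powr (- (N + 2 * g))))
      = QF N * z powr (2 - N) * (c - m * p * z powr (-g) + r2 * q * z powr (-(2*g)))" (is ?B)
proof -
  note i1 = K_powr_integrable[OF N_gt2(1,2) assms]
  have n: "2 < N + g" "real d < N + g" "2 < N + 2 * g" "real d < N + 2 * g" using N_gt2 gamma_star_props(1) by auto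
  note i2 = K_powr_integrable[OF n(1,2) assms]
  note i3 = K_powr_integrable[OF n(3,4) assms]
  have e: "K z \<rho> * (c * \<rho> powr (-N) - p * \<rho> powr (-(N + g)) + q * \<rho> powr (- (N + 2 * g)))
    = c * (K z \<rho> * \<rho> powr (-N)) - p * (K z \<rho> * \<rho> powr (-(N + g))) + q * (K z \<rho> * \<rho> powr (- (N + 2 * g)))" for \<rho>
    by (simp add: algebra_simps)
  show ?A unfolding e using i1(1) i2(1) i3(1) by (intro set_integral_add set_integral_diff) auto
  have "(LINT \<rho>:{z..}|lborel. K z \<rho> * (c * \<rho> powr (-N) - p * \<rho> powr (-(N + g)) + q * \<rho> powr (- (N + 2 * g))))
     = c * (z powr (2 - N) * QF N) - p * (z powr (2 - (N + g)) * QF (N + g)) + q * (z powr (2 - (N + 2 * g)) * QF (N + 2 * g))"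
    unfolding e using i1 i2 i3 by (simp add: set_integral_add set_integral_diff)
  also have "z powr (2 - (N + g)) = z powr (2 - N) * z powr (-g)" by (simp add: powr_add[symmetric] algebra_simps)
  also have "z powr (2 - (N + 2 * g)) = z powr (2 - N) * z powr (-(2 * g))" by (simp add: powr_add[symmetric] algebra_simps)
  finally show ?B unfolding gamma_star_props(2) r2(2) by (simp add: algebra_simps)
qed

lemma c_z_powr: "0 < z \<Longrightarrow> 0 \<le> w \<Longrightarrow> (c * z powr (-N) * w) powr m = c * QF N * z powr (2 - N) * w powr m"
proof -
  assume "0 < z" "0 \<le> w"
  then have "(c * z powr (-N) * w) powr m = c powr m * z powr (- (m * N)) * w powr m"
    using c_pos by (simp add: powr_mult powr_powr mult.commute)
  also have "- (m * N) = 2 - N" by (simp add: mN)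
  finally show ?thesis using c_powr by simp
qed

text \<open>The cap in \<open>Y\<close> prevents a direct evaluation. At fixed \<open>z\<close>,
  however, \<open>F1\<close> is bounded on \<open>[z, \<infinity>)\<close> by a three-term
  combination of powers that agrees with it at \<open>\<rho> = z\<close>, and this combination is
  integrated exactly.\<close>

lemma NT_F1:
  assumes z: "0 < z"
  shows "NT F1 z \<le> ennreal (F1 z powr m)"
proof -
  define y where "y = Y z"
  define p where "p = c * y * z powr g"
  define q where "q = c * B * y\<^sup>2 * z powr (2 * g)"
  define f where "f \<rho> = K z \<rho> * (c * \<rho> powr (-N) - p * \<rho> powr (-(N + g)) + q * \<rho> powr (- (N + 2 * g)))" for \<rho>
  have le: "K z \<rho> * F1 \<rho> \<le> f \<rho>" if r: "z \<le> \<rho>" for \<rho>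
  proof -
    have r0: "0 < \<rho>" using z r by simp
    \<comment> \<open>\<open>y * t\<close> decays like \<open>\<rho> powr (-g)\<close> but starts
      from \<open>Y z\<close>. It stays below both entries of the minimum \<open>Y \<rho>\<close>,
      so \<eta>, increasing up to \<open>y0\<close>, can be compared.\<close>
    define t where "t = (z / \<rho>) powr g"
    have t: "0 \<le> t" "t \<le> 1" unfolding t_def using z r r0 gamma_star_props(1) by (auto intro!: powr_le1)
    have "y * t \<le> z powr (-g) * t" unfolding y_def using t Y_bounds by (intro mult_right_mono) auto
    also have "\<dots> = \<rho> powr (-g)" unfolding t_def using z r0 by (simp add: powr_divide powr_minus_divide)
    finally have 1: "y * t \<le> \<rho> powr (-g)" .
    have 2: "y * t \<le> y0" using t Y_bounds[of z] mult_left_le[of t y] unfolding y_def by simp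
    have "\<eta> (y * t) \<le> \<eta> (Y \<rho>)"
      using 1 2 Y_bounds[of z] t Y_bounds[of \<rho>] by (intro eta_mono) (auto simp: Y_def y_def)
    then have "F1 \<rho> \<le> c * \<rho> powr (-N) * (1 - \<eta> (y * t))"
      unfolding F1_def using c_pos by (intro mult_left_mono) auto
    also have "\<dots> = c * \<rho> powr (-N) - c * y * (\<rho> powr (-N) * t) + c * B * y\<^sup>2 * (\<rho> powr (-N) * t\<^sup>2)"
      unfolding \<eta>_def by (simp add: algebra_simps power_mult_distrib)
    also have "\<rho> powr (-N) * t = z powr g * \<rho> powr (-(N + g))"
      unfolding t_def minus_add_distrib powr_add using z r0 by (simp add: powr_divide powr_minus_divide)
    also have "\<rho> powr (-N) * t\<^sup>2 = z powr (2 * g) * \<rho> powr (-(N + 2 * g))"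
    proof -
      have "t\<^sup>2 = (z / \<rho>) powr (2 * g)"
        unfolding t_def power2_eq_square powr_add[symmetric] by simp
      then show ?thesis unfolding minus_add_distrib powr_add using z r0 by (simp add: powr_divide powr_minus_divide)
    qed
    finally show ?thesis unfolding f_def p_def q_def using K_nonneg[of \<rho> z] r0
      by (intro mult_left_mono) (auto simp: mult.assoc)
  qed
  have "NT F1 z \<le> (\<integral>\<^sup>+\<rho>\<in>{z..}. ennreal (f \<rho>) \<partial>lborel)"
    unfolding NT_def using le by (intro nn_integral_mono) (auto simp: indicator_def intro: ennreal_leI)
  also have "\<dots> = ennreal (LINT \<rho>:{z..}|lborel. f \<rho>)"
  proof (rule set_nn_integral_eq_lebesgue)
    show "f \<in> borel_measurable borel" unfolding f_def by measurable
    show "0 \<le> f x" if "x \<in> {z..}" for x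
      using that le[of x] F1_nonneg[of x] K_nonneg[of x z] z by (smt (verit) atLeast_iff mult_nonneg_nonneg)
    show "set_integrable lborel {z..} f" unfolding f_def using combination_integral(1)[OF z] .
  qed auto
  also have "(LINT \<rho>:{z..}|lborel. f \<rho>) = QF N * z powr (2 - N) * (c - m * p * z powr (-g) + r2 * q * z powr (-(2*g)))"
    unfolding f_def using combination_integral(2)[OF z] .
  also have "c - m * p * z powr (-g) + r2 * q * z powr (-(2*g)) = c * (1 - m * y + B * r2 * y\<^sup>2)"
    unfolding p_def q_def using z by (simp add: powr_minus_divide algebra_simps)
  also have "ennreal (QF N * z powr (2 - N) * (c * (1 - m * y + B * r2 * y\<^sup>2))) \<le> ennreal (F1 z powr m)"
  proof (rule ennreal_leI)
    have y: "0 \<le> y" "y \<le> y0" unfolding y_def using Y_bounds by auto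
    note h = eta_bounds[OF y]
    \<comment> \<open>The first-order terms in \<open>y\<close> agree by the choice of
      \<open>g\<close>; in second order the surplus \<open>B * (m - r2)\<close> covers the error
      \<open>2 * m\<close> of the expansion.\<close>
    have "2 * m * (\<eta> y)\<^sup>2 \<le> 2 * m * y\<^sup>2" using h m by (intro mult_left_mono power_mono) auto
    also have "\<dots> \<le> B * (m - r2) * y\<^sup>2" using B(2) by (intro mult_right_mono) auto
    finally have "1 - m * y + B * r2 * y\<^sup>2 \<le> 1 - m * \<eta> y - 2 * m * (\<eta> y)\<^sup>2"
      unfolding \<eta>_def by (simp add: algebra_simps)
    also have "\<dots> \<le> (1 - \<eta> y) powr m" using h m by (intro powr_one_minus_ge) auto
    finally have "(c * QF N * z powr (2 - N)) * (1 - m * y + B * r2 * y\<^sup>2) \<le> (c * QF N * z powr (2 - N)) * (1 - \<eta> y) powr m"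
      using c_pos QF_pos[OF N_gt2(1,2)] by (intro mult_left_mono) auto
    also have "\<dots> = F1 z powr m" unfolding F1_def y_def[symmetric] using z h by (subst c_z_powr) auto
    finally show "QF N * z powr (2 - N) * (c * (1 - m * y + B * r2 * y\<^sup>2)) \<le> F1 z powr m" by (simp add: mult_ac)
  qed
  finally show ?thesis .
qed

lemma NT_powr:
  assumes "N - \<nu> > 2" "N - \<nu> > real d" "0 < z" "0 \<le> C"
  shows "NT (\<lambda>z. C * z powr (-(N - \<nu>))) z = ennreal (C * z powr (2 - N + \<nu>) * QF (N - \<nu>))"
proof -
  have "NT (\<lambda>z. C * z powr (-(N - \<nu>))) z = ennreal C * NT (\<lambda>z. z powr (-(N - \<nu>))) z"
    using assms by (intro NT_cmult) auto
  also have "NT (\<lambda>z. z powr (-(N - \<nu>))) z = ennreal (z powr (2 - (N - \<nu>)) * QF (N - \<nu>))"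
    unfolding NT_def using assms by (intro nn_integral_K_powr) auto
  finally show ?thesis using assms QF_pos[of "N - \<nu>"] by (simp add: ennreal_mult'[symmetric] algebra_simps)
qed

lemma z1: "1 \<le> z1" "0 < z1" "z1 powr (-g) = y0" "\<And>z. 0 < z \<Longrightarrow> z \<le> z1 \<Longrightarrow> y0 \<le> z powr (-g)"
proof -
  show "0 < z1" unfolding z1_def using y0 by simp
  show zg: "z1 powr (-g) = y0" unfolding z1_def using y0 gamma_star_props(1) by (simp add: powr_powr)
  show "1 \<le> z1" unfolding z1_def using y0 gamma_star_props(1) powr_mono'[of "-1/g" 0 y0] by simp
  show "y0 \<le> z powr (-g)" if "0 < z" "z \<le> z1" for z
    using that gamma_star_props(1) unfolding zg[symmetric] by (intro powr_mono2') auto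
qed

section \<open>The subsolution for \<open>m < 1\<close>\<close>

abbreviation "UL \<equiv> U_lower d \<alpha> m"

lemma UL_eq: "UL z = c * z powr (-N) * max 0 (1 - z powr (-g))"
  unfolding U_lower_def U_star_def c_def N_def g_def by simp

lemma UL_measurable [measurable]: "UL \<in> borel_measurable borel"
  unfolding UL_eq by measurable

lemma UL_nonneg: "0 \<le> UL z"
  unfolding UL_eq using c_pos by simp

lemma UL_le: "UL z \<le> c * z powr (-N)"
  unfolding UL_eq using c_pos by (intro mult_left_le) auto

lemma UL_le_F1:
  "UL z \<le> F1 z"
proof -
  have "max 0 (1 - z powr (-g)) \<le> 1 - \<eta> (Y z)"
    using eta_bounds[OF Y_bounds(1,2)[of z]] Y_bounds(3)[of z] by auto
  then show ?thesis unfolding UL_eq F1_def using c_pos by (intro mult_left_mono) auto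
qed

text \<open>For \<open>z > 1\<close> the truncation is inactive on \<open>[z, \<infinity>)\<close>,
  and with \<open>y = z powr (-g)\<close> the relation defining \<open>g\<close> turns
  \<open>1 - y\<close> into \<open>1 - m * y\<close>, the linearisation of the \<open>m\<close>-th
  power. Concavity then gives the sign.\<close>

lemma UL_sub:
  assumes z: "0 < z"
  shows "UL z \<le> T UL z"
proof (cases "z \<le> 1")
  case True
  then have "1 \<le> z powr (-g)" using z gamma_star_props(1) powr_mono'[of "-g" 0 z] by simp
  then have "UL z = 0" unfolding UL_eq by simp
  then show ?thesis using K_op_nonneg by simp
next
  case False
  define f where "f \<rho> = K z \<rho> * (c * \<rho> powr (-N) - c * \<rho> powr (-(N + g)) + 0 * \<rho> powr (- (N + 2 * g)))" for \<rho>
  have gl: "\<rho> powr (-g) \<le> 1" if "z \<le> \<rho>" for \<rho>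
    using that False gamma_star_props(1) powr_mono[of "-g" 0 \<rho>] by simp
  have fe: "f \<rho> = K z \<rho> * UL \<rho>" if "z \<le> \<rho>" for \<rho>
    unfolding f_def UL_eq using gl[OF that] by (simp add: powr_add[symmetric] algebra_simps)
  have "NT UL z = (\<integral>\<^sup>+\<rho>\<in>{z..}. ennreal (f \<rho>) \<partial>lborel)"
    unfolding NT_def by (intro nn_integral_cong) (auto simp: indicator_def fe)
  also have "\<dots> = ennreal (LINT \<rho>:{z..}|lborel. f \<rho>)"
  proof (rule set_nn_integral_eq_lebesgue)
    show "f \<in> borel_measurable borel" unfolding f_def by measurable
    show "0 \<le> f x" if "x \<in> {z..}" for x
      using that UL_nonneg[of x] K_nonneg[of x z] z by (simp add: fe)
    show "set_integrable lborel {z..} f" unfolding f_def using combination_integral(1)[OF z] .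
  qed auto
  also have "(LINT \<rho>:{z..}|lborel. f \<rho>) = QF N * z powr (2 - N) * (c - m * c * z powr (-g) + r2 * 0 * z powr (-(2*g)))"
    unfolding f_def using combination_integral(2)[OF z] .
  finally have NTe: "NT UL z = ennreal (c * QF N * z powr (2 - N) * (1 - m * z powr (-g)))"
    by (simp add: algebra_simps)
  show ?thesis
  proof (rule K_op_ge)
    have "UL z powr m = c * QF N * z powr (2 - N) * (1 - z powr (-g)) powr m"
      unfolding UL_eq using z gl[of z] by (subst c_z_powr) auto
    also have "\<dots> \<le> c * QF N * z powr (2 - N) * (1 - m * z powr (-g))"
      using c_pos QF_pos[OF N_gt2(1,2)] gl[of z] m m1 by (intro mult_left_mono powr_one_minus_le) auto
    finally show "ennreal (UL z powr m) \<le> NT UL z" unfolding NTe by (rule ennreal_leI)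
  qed (use z UL_nonneg NTe in auto)
qed

text \<open>Since \<open>m < 1\<close>, each application of the equation increases the gain \<open>\<nu>\<close> to \<open>\<nu> / m\<close>.\<close>

lemma bootstrap:
  assumes "sol u" "0 \<le> C" "\<And>z. 0 < z \<Longrightarrow> u z \<le> C * z powr (-(N - \<nu>))"
    and "N - \<nu> > 2" "N - \<nu> > real d"
  shows "\<exists>C'\<ge>0. \<forall>z>0. u z \<le> C' * z powr (-(N - \<nu> / m))"
proof -
  define C' where "C' = (C * QF (N - \<nu>)) powr (1/m)"
  have "u z \<le> C' * z powr (-(N - \<nu> / m))" if z: "0 < z" for z
  proof -
    have "NT u z \<le> NT (\<lambda>z. C * z powr (-(N - \<nu>))) z" using z assms(3) by (intro NT_mono) auto
    also have "\<dots> = ennreal (C * z powr (2 - N + \<nu>) * QF (N - \<nu>))" using assms z by (intro NT_powr) auto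
    finally have "u z powr m \<le> C * z powr (2 - N + \<nu>) * QF (N - \<nu>)"
      unfolding NT_def sol_eq[OF assms(1) z] using assms QF_pos[of "N - \<nu>"] by (subst (asm) ennreal_le_iff) auto
    then have "(u z powr m) powr (1/m) \<le> (C * z powr (2 - N + \<nu>) * QF (N - \<nu>)) powr (1/m)"
      using m by (intro powr_mono2) auto
    moreover have "(u z powr m) powr (1/m) = u z" using m sol_nonneg[OF assms(1) z] by (simp add: powr_powr)
    moreover have "(C * z powr (2 - N + \<nu>) * QF (N - \<nu>)) powr (1/m) = C' * z powr ((2 - N + \<nu>) / m)"
      unfolding C'_def using assms QF_pos[of "N - \<nu>"] z by (simp add: powr_mult powr_powr)
    moreover have "(2 - N + \<nu>) / m = -(N - \<nu> / m)"
    proof -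
      have "2 - N + \<nu> = \<nu> - m * N" using mN by simp
      then show ?thesis using m by (simp add: diff_divide_distrib)
    qed
    ultimately show ?thesis by simp
  qed
  then show ?thesis unfolding C'_def by (intro exI[of _ "(C * QF (N - \<nu>)) powr (1/m)"]) auto
qed

text \<open>An exponent for which \<open>QF (N - \<nu>T)\<close> still converges, while \<open>\<nu>T / m\<close> already gives finite mass.\<close>

definition "\<nu>T = N - (3 + real d + m * real d) / 2"

text \<open>\<open>N - \<nu>T\<close> is the midpoint of \<open>d + 1\<close> and
  \<open>m * d + 2\<close>. The former is at least 2 and exceeds \<open>d\<close>, and
  \<open>N - \<nu>T / m < d\<close> means \<open>N - \<nu>T < m * d + 2\<close>. By
  \<open>md\<close> the latter end point exceeds \<open>d + 3/2\<close>, so the interval is not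
  empty.\<close>

lemma nuT: "2 < N - \<nu>T" "real d < N - \<nu>T" "N - \<nu>T / m < real d" "0 < \<nu>T"
proof -
  have mdd: "real d - 1/2 < m * real d" using md by (simp add: algebra_simps)
  have "m * real d \<le> real d" using m1 mult_left_le_one_le[of "real d" m] m by simp
  have n: "N - \<nu>T = (3 + real d + m * real d) / 2" unfolding \<nu>T_def by simp
  have d1: "1 \<le> real d" using d by simp
  show "2 < N - \<nu>T" unfolding n using d1 mdd by simp
  show "real d < N - \<nu>T" unfolding n using d1 mdd by simp
  have *: "0 < n - (3 + r + x) / 2" if "x \<le> r" "1 \<le> r" "4 * r < n" for x r n :: real using that by (simp add: field_simps)
  show "0 < \<nu>T" unfolding \<nu>T_def using \<open>m * real d \<le> real d\<close> d1 N_gt by (rule *)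
  have **: "n - 2 - x < n - (3 + r + x) / 2" if "r - 1/2 < x" for x r n :: real using that by (simp add: field_simps)
  have "m * (N - real d) = N - 2 - m * real d" using mN by (simp add: right_diff_distrib)
  then have "m * (N - real d) < \<nu>T"
    unfolding \<nu>T_def using **[OF mdd] by simp
  then show "N - \<nu>T / m < real d" using m by (simp add: field_simps)
qed

text \<open>The second barrier gives up the exponent \<open>\<mu> = \<nu>T * m ^ j\<close> against
  \<open>z powr (-N)\<close>. A small \<mu> keeps \<open>QF (N - \<mu>)\<close> close to
  \<open>QF N\<close> and \<open>z1 powr (-\<mu>)\<close> close to 1. The form
  \<open>\<nu>T * m ^ j\<close> is taken because \<open>j\<close> rounds of \<open>bootstrap\<close>
  lead from it to \<open>\<nu>T\<close>.\<close>

lemma small_exponent: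
  "\<exists>j. QF (N - \<nu>T * m ^ j) \<le> QF N * (1 - \<eta> y0) powr (- (1 - m)) \<and> 1 - y0 \<le> z1 powr (- (\<nu>T * m ^ j))"
proof -
  have lim: "(\<lambda>j. \<nu>T * m ^ j) \<longlonglongrightarrow> \<nu>T * 0"
    using m m1 by (intro tendsto_intros LIMSEQ_realpow_zero) auto
  have q0: "0 < QF N" by (rule QF_pos[OF N_gt2(1,2)])
  have e0: "0 < \<eta> y0"
  proof -
    have "\<eta> y0 = y0 / 2" using y0(3) unfolding \<eta>_def power2_eq_square by (simp add: mult.assoc[symmetric])
    then show ?thesis using y0 by simp
  qed
  have e1: "\<eta> y0 \<le> 1/4" using eta_bounds(3)[of y0] y0 by simp
  have gt1: "1 < (1 - \<eta> y0) powr (- (1 - m))"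
    using e0 e1 m1 powr_less_mono2_neg[of "-(1-m)" "1 - \<eta> y0" 1] by simp
  have "(\<lambda>j. QF (N - \<nu>T * m ^ j)) \<longlonglongrightarrow> QF (N - 0)"
    using lim by (intro isCont_tendsto_compose[OF isCont_QF] tendsto_intros) (use N_gt2 in auto)
  then have "\<forall>\<^sub>F j in sequentially. QF (N - \<nu>T * m ^ j) < QF N * (1 - \<eta> y0) powr (- (1 - m))"
    by (rule order_tendstoD) (use gt1 q0 in auto)
  moreover have "(\<lambda>j. z1 powr (- (\<nu>T * m ^ j))) \<longlonglongrightarrow> z1 powr (- 0)"
    using lim z1(2) by (intro tendsto_intros) auto
  then have "\<forall>\<^sub>F j in sequentially. 1 - y0 < z1 powr (- (\<nu>T * m ^ j))"
    by (rule order_tendstoD) (use y0 z1(2) in auto)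
  ultimately have "\<forall>\<^sub>F j in sequentially. QF (N - \<nu>T * m ^ j) \<le> QF N * (1 - \<eta> y0) powr (- (1 - m)) \<and> 1 - y0 \<le> z1 powr (- (\<nu>T * m ^ j))"
    by eventually_elim auto
  then show ?thesis using eventually_happens'[OF sequentially_bot] by blast
qed

lemma admissible_profile_fast: "admissible (profile_fast d \<alpha> m)"
proof -
  obtain j where j: "QF (N - \<nu>T * m ^ j) \<le> QF N * (1 - \<eta> y0) powr (- (1 - m))" "1 - y0 \<le> z1 powr (- (\<nu>T * m ^ j))"
    using small_exponent by blast
  define \<mu> where "\<mu> = \<nu>T * m ^ j"
  have mj: "m ^ i \<le> 1" for i using m m1 by (simp add: power_le_one)
  have mu: "0 < \<mu>" "\<mu> \<le> \<nu>T" unfolding \<mu>_def using nuT m mj[of j] mult_left_le[of "m ^ j" \<nu>T] by auto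
  then have nmu: "2 < N - \<mu>" "real d < N - \<mu>" using nuT by auto
  \<comment> \<open>This constant makes \<open>F2\<close> meet \<open>c * z powr (-N)\<close>
    exactly at \<open>z1\<close>, the point below which the correction in \<open>F1\<close> is
    frozen.\<close>
  define C2 where "C2 = c * z1 powr (-\<mu>)"
  define F2 where "F2 z = C2 * z powr (-(N - \<mu>))" for z
  have C2: "0 < C2" unfolding C2_def using c_pos z1 by simp
  have F2e: "F2 z = c * z powr (-N) * (z / z1) powr \<mu>" if "0 < z" for z
    unfolding F2_def C2_def using that z1(2) by (simp add: powr_divide powr_minus_divide powr_diff)
  define W where "W z = min (F1 z) (F2 z)" for z
  have [measurable]: "W \<in> borel_measurable borel" unfolding W_def F2_def by measurable
  have fW: "UL z \<le> W z" if z: "0 < z" for z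
  proof -
    \<comment> \<open>Beyond \<open>z1\<close> the uncorrected power suffices; between 1 and
      \<open>z1\<close> at most the fraction \<open>1 - y0\<close> of it is left in
      \<open>UL\<close>, and up to 1 nothing.\<close>
    have "UL z \<le> F2 z"
    proof (cases "z1 \<le> z")
      case True
      then have "1 \<le> (z / z1) powr \<mu>" using z1 mu by (intro ge_one_powr_ge_zero) auto
      then have "c * z powr (-N) \<le> F2 z" unfolding F2e[OF z]
        using c_pos mult_left_mono[of 1 "(z / z1) powr \<mu>" "c * z powr (-N)"] by simp
      then show ?thesis using UL_le[of z] by simp
    next
      case False
      then have "y0 \<le> z powr (-g)" using z1(4)[of z] z by simp
      moreover have "0 < y0" "y0 \<le> 1/2" by (rule y0)+
      ultimately have "max 0 (1 - z powr (-g)) \<le> (if z \<le> 1 then 0 else 1 - y0)"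
        using z gamma_star_props(1) powr_mono'[of "-g" 0 z] by auto
      also have "\<dots> \<le> (z / z1) powr \<mu>"
      proof (cases "z \<le> 1")
        case F: False
        have "1 - y0 \<le> z1 powr (-\<mu>)" using j(2) unfolding \<mu>_def .
        also have "\<dots> = (1 / z1) powr \<mu>" using z1(2) by (simp add: powr_divide powr_minus_divide)
        also have "\<dots> \<le> (z / z1) powr \<mu>" using F z1(2) mu by (intro powr_mono2 divide_right_mono) auto
        finally show ?thesis using F by simp
      qed simp
      finally show ?thesis unfolding UL_eq F2e[OF z] using c_pos by (intro mult_left_mono) auto
    qed
    then show ?thesis unfolding W_def using UL_le_F1[of z] by simp
  qed
  \<comment> \<open>As \<open>NT\<close> is monotone, a minimum is a supersolution if each entry
    satisfies its inequality at the points where it is the smaller one. For \<open>F2\<close> these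
    points lie below \<open>z1\<close>.\<close>
  have super: "NT W z \<le> ennreal (W z powr m)" if z: "0 < z" for z
  proof (cases "F1 z \<le> F2 z")
    case True
    have "NT W z \<le> NT F1 z" using z by (intro NT_mono) (auto simp: W_def)
    also have "\<dots> \<le> ennreal (F1 z powr m)" by (rule NT_F1[OF z])
    finally show ?thesis unfolding W_def using True by simp
  next
    case False
    define t where "t = (z / z1) powr \<mu>"
    have t0: "0 < t" unfolding t_def using z z1 by simp
    have "F2 z < c * z powr (-N)" using False F1_le[of z] by simp
    then have "t < 1" unfolding F2e[OF z] t_def[symmetric] using c_pos z by simp
    then have zz: "z < z1" unfolding t_def using z z1 mu ge_one_powr_ge_zero[of "z/z1" \<mu>] by (cases "z1 \<le> z") auto
    then have "Y z = y0" unfolding Y_def using z1(4)[of z] z by simp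
    then have "c * z powr (-N) * t < c * z powr (-N) * (1 - \<eta> y0)"
      using False unfolding F1_def F2e[OF z] t_def by simp
    then have te: "t < 1 - \<eta> y0" using c_pos z by simp
    \<comment> \<open>In the equation for \<open>F2\<close> the factor \<open>QF (N - \<mu>)\<close>
      replaces \<open>QF N\<close>. Where \<open>F2\<close> is the smaller entry, \<open>t\<close>
      is below \<open>1 - \<eta> y0\<close>, and the power \<open>t powr (1 - m)\<close> pays for
      the difference.\<close>
    have "t powr (1 - m) * QF (N - \<mu>) \<le> (1 - \<eta> y0) powr (1 - m) * (QF N * (1 - \<eta> y0) powr (- (1 - m)))"
      using te t0 m1 j(1) nmu QF_pos[of "N - \<mu>"] unfolding \<mu>_def[symmetric] by (intro mult_mono powr_mono2) auto
    also have "\<dots> = QF N" using te t0 by (simp add: powr_add[symmetric])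
    finally have tq: "t powr (1 - m) * QF (N - \<mu>) \<le> QF N" .
    have "NT W z \<le> NT F2 z" using z by (intro NT_mono) (auto simp: W_def)
    also have "\<dots> = ennreal (C2 * z powr (2 - N + \<mu>) * QF (N - \<mu>))"
      unfolding F2_def using nmu z C2 by (intro NT_powr) auto
    also have "C2 * z powr (2 - N + \<mu>) = c * z powr (2 - N) * t"
      unfolding C2_def t_def using z z1 by (simp add: powr_add powr_divide powr_minus_divide)
    also have "c * z powr (2 - N) * t * QF (N - \<mu>) \<le> F2 z powr m"
    proof -
      have "t = t powr m * t powr (1 - m)" using t0 by (simp add: powr_add[symmetric])
      then have "c * z powr (2 - N) * t * QF (N - \<mu>) = c * z powr (2 - N) * t powr m * (t powr (1 - m) * QF (N - \<mu>))"
        by (metis mult.assoc)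
      also have "\<dots> \<le> c * z powr (2 - N) * t powr m * QF N"
        using tq c_pos by (intro mult_left_mono) auto
      also have "\<dots> = F2 z powr m" unfolding F2e[OF z] t_def[symmetric] using z t0 by (subst c_z_powr) auto
      finally show ?thesis .
    qed
    then have "ennreal (c * z powr (2 - N) * t * QF (N - \<mu>)) \<le> ennreal (F2 z powr m)" by (rule ennreal_leI)
    finally show ?thesis unfolding W_def using False by simp
  qed
  define U where "U = profile_fast d \<alpha> m"
  have "sol (\<lambda>z. lim (\<lambda>n. (T ^^ n) UL z)) \<and> (\<forall>z>0. UL z \<le> lim (\<lambda>n. (T ^^ n) UL z) \<and> lim (\<lambda>n. (T ^^ n) UL z) \<le> W z)"
    using UL_nonneg UL_sub fW super by (intro sol_iterate) auto
  moreover have "U = (\<lambda>z. lim (\<lambda>n. (T ^^ n) UL z))" unfolding U_def profile_fast_def by auto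
  ultimately have U: "sol U" "\<And>z. 0 < z \<Longrightarrow> UL z \<le> U z" "\<And>z. 0 < z \<Longrightarrow> U z \<le> W z" by auto
  have [measurable]: "U \<in> borel_measurable borel" using U(1) by (rule sol_measurable)
  \<comment> \<open>Each round divides the gain \<open>\<nu>T * m ^ (j - i)\<close> by
    \<open>m\<close>. After \<open>j\<close> rounds it is \<open>\<nu>T\<close>, and one further
    round makes the profile integrable at 0.\<close>
  have "\<exists>C\<ge>0. \<forall>z>0. U z \<le> C * z powr (-(N - \<nu>T * m ^ (j - i)))" if "i \<le> j" for i
    using that
  proof (induction i)
    case 0
    have "\<forall>z>0. U z \<le> C2 * z powr (-(N - \<nu>T * m ^ (j - 0)))"
      using U(3) unfolding W_def F2_def \<mu>_def by auto
    then show ?case using C2 by (intro exI[of _ C2]) auto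
  next
    case (Suc i)
    then obtain C where C: "0 \<le> C" "\<forall>z>0. U z \<le> C * z powr (-(N - \<nu>T * m ^ (j - i)))" by auto
    have ji: "j - i = Suc (j - Suc i)" using Suc.prems by simp
    have "\<nu>T * m ^ (j - i) \<le> \<nu>T" using nuT mj by (simp add: mult_left_le)
    then have "2 < N - \<nu>T * m ^ (j - i)" "real d < N - \<nu>T * m ^ (j - i)" using nuT by linarith+
    then have "\<exists>C'\<ge>0. \<forall>z>0. U z \<le> C' * z powr (-(N - \<nu>T * m ^ (j - i) / m))"
      using U(1) C by (intro bootstrap[of U C]) auto
    moreover have "\<nu>T * m ^ (j - i) / m = \<nu>T * m ^ (j - Suc i)" unfolding ji using m by simp
    ultimately show ?case by simp
  qed
  from this[of j] obtain C where "0 \<le> C" "\<forall>z>0. U z \<le> C * z powr (-(N - \<nu>T))" by auto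
  then have "\<exists>C'\<ge>0. \<forall>z>0. U z \<le> C' * z powr (-(N - \<nu>T / m))"
    using U(1) nuT by (intro bootstrap[of U C]) auto
  then obtain C' where C': "0 \<le> C'" "\<And>z. 0 < z \<Longrightarrow> U z \<le> C' * z powr (-(N - \<nu>T / m))" by auto
  have UN: "U z \<le> c * z powr (-N)" if "0 < z" for z
    using U(3)[OF that] F1_le[of z] unfolding W_def by simp
  define CC where "CC = max c C'"
  have fin: "mom s U < \<infinity>" if "real d - 1 \<le> s" "s \<le> real d + 1" for s
  proof (rule mom_finite)
    show "U z \<le> CC * z powr (-(N - \<nu>T / m))" if "0 < z" "z \<le> 1" for z
      using C'(2)[OF that(1)] unfolding CC_def by (smt (verit) max.cobounded2 mult_right_mono powr_ge_zero)
    show "U z \<le> CC * z powr (-N)" if "1 \<le> z" for z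
      using UN[of z] that unfolding CC_def by (smt (verit) max.cobounded1 mult_right_mono powr_ge_zero)
  qed (use that C' nuT N_gt2 in \<open>auto simp: CC_def\<close>)
  have "0 < mom (real d - 1) U"
  proof (rule mom_pos)
    fix z :: real assume z: "1 < z" "z < 2"
    then have "z powr (-g) < 1" using gamma_star_props(1) powr_less_mono[of "-g" 0 z] by simp
    then have "0 < UL z" unfolding UL_eq using c_pos z by simp
    then show "0 < U z" using U(2)[of z] z by simp
  qed auto
  then show ?thesis unfolding admissible_def U_def[symmetric] using U fin by auto
qed

end

subsection \<open>Scaling and the uniform moment bound\<close>

lemma mom_scale:
  assumes [measurable]: "u \<in> borel_measurable borel" and nn: "\<And>z. 0 < z \<Longrightarrow> 0 \<le> u z" and A: "0 < A" "0 < k"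
  shows "mom s (\<lambda>z. A * u (k * z)) = ennreal (A * k powr (- (s + 1))) * mom s u"
proof -
  have "mom s u = ennreal k * (\<integral>\<^sup>+\<rho>. ennreal ((k * \<rho>) powr s * u (k * \<rho>)) * indicator {0<..} (k * \<rho>) \<partial>lborel)"
    unfolding mom_def using A nn_integral_real_affine[of "\<lambda>\<rho>. ennreal (\<rho> powr s * u \<rho>) * indicator {0<..} \<rho>" k 0]
    by simp
  then have "ennreal (A * k powr (- (s + 1))) * mom s u
     = (\<integral>\<^sup>+\<rho>. ennreal (A * k powr (- (s + 1)) * k) * (ennreal ((k * \<rho>) powr s * u (k * \<rho>)) * indicator {0<..} (k * \<rho>)) \<partial>lborel)"
    using A by (subst nn_integral_cmult) (auto simp: ennreal_mult'' mult.assoc)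
  also have "\<dots> = mom s (\<lambda>z. A * u (k * z))"
    unfolding mom_def
  proof (intro nn_integral_cong)
    fix \<rho> :: real
    show "ennreal (A * k powr (- (s + 1)) * k) * (ennreal ((k * \<rho>) powr s * u (k * \<rho>)) * indicator {0<..} (k * \<rho>))
      = ennreal (\<rho> powr s * (A * u (k * \<rho>))) * indicator {0<..} \<rho>"
    proof (cases "0 < \<rho>")
      case True
      have "k powr (- (s + 1)) * k * k powr s = 1"
        using A powr_add[of k "- (s+1)" "1"] powr_add[of k "-s" s] by simp
      then have "A * k powr (- (s + 1)) * k * ((k * \<rho>) powr s * u (k * \<rho>)) = \<rho> powr s * (A * u (k * \<rho>))"
        using True A by (simp add: powr_mult mult_ac)
      then show ?thesis using True A nn[of "k * \<rho>"] by (simp add: ennreal_mult''[symmetric] zero_less_mult_iff)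
    qed (use A in \<open>simp add: zero_less_mult_iff\<close>)
  qed
  finally show ?thesis by simp
qed

context profile_params
begin

text \<open>The kernel and the line element contribute one power of \<open>k\<close> each, so the
  equation is invariant if \<open>A * k powr (-2) = A powr m\<close>; this determines
  \<open>k\<close>.\<close>

lemma sol_scale:
  assumes u: "sol u" and A: "0 < A" and k: "k = A powr (- (m - 1) / 2)"
  shows "sol (\<lambda>z. A * u (k * z))"
proof -
  have k0: "0 < k" using A k by simp
  have kA: "A * k powr (-2) = A powr m"
  proof -
    have "- (m - 1) / 2 * (-2) = m - 1" by (simp add: field_simps)
    then have "k powr (-2) = A powr (m - 1)" unfolding k powr_powr by (simp only:)
    then show ?thesis using A powr_add[of A 1 "m - 1"] by simp
  qed
  have [measurable]: "u \<in> borel_measurable borel" using u by (rule sol_measurable)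
  have "(\<integral>\<^sup>+\<rho>\<in>{z..}. ennreal (K z \<rho> * (A * u (k * \<rho>))) \<partial>lborel) = ennreal ((A * u (k * z)) powr m)" if z: "0 < z" for z
  proof -
    have kz: "0 < k * z" using k0 z by simp
    have "ennreal (u (k * z) powr m) = (\<integral>\<^sup>+\<rho>. ennreal (K (k * z) \<rho> * u \<rho>) * indicator {k * z..} \<rho> \<partial>lborel)"
      using sol_eq[OF u kz] by simp
    also have "\<dots> = ennreal k * (\<integral>\<^sup>+\<rho>. ennreal (K (k * z) (k * \<rho>) * u (k * \<rho>)) * indicator {k * z..} (k * \<rho>) \<partial>lborel)"
      using k0 nn_integral_real_affine[of "\<lambda>\<rho>. ennreal (K (k * z) \<rho> * u \<rho>) * indicator {k * z..} \<rho>" k 0] by simp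
    finally have "ennreal (A * k powr (-2)) * ennreal (u (k * z) powr m)
      = ennreal (A * k powr (-2) * k) * (\<integral>\<^sup>+\<rho>. ennreal (K (k * z) (k * \<rho>) * u (k * \<rho>)) * indicator {k * z..} (k * \<rho>) \<partial>lborel)"
      using k0 A by (simp add: ennreal_mult'' mult.assoc)
    also have "\<dots> = (\<integral>\<^sup>+\<rho>. ennreal (A * k powr (-2) * k) * (ennreal (K (k * z) (k * \<rho>) * u (k * \<rho>)) * indicator {k * z..} (k * \<rho>)) \<partial>lborel)"
      by (subst nn_integral_cmult) auto
    also have "\<dots> = (\<integral>\<^sup>+\<rho>\<in>{z..}. ennreal (K z \<rho> * (A * u (k * \<rho>))) \<partial>lborel)"
    proof (intro nn_integral_cong)
      fix \<rho> :: real
      have "k powr (-2) * k * k = 1" using k0 by (simp add: powr_minus_divide power2_eq_square)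
      then have e: "A * k powr (-2) * k * (K (k * z) (k * \<rho>) * u (k * \<rho>)) = K z \<rho> * (A * u (k * \<rho>))"
        unfolding K_ker_def using k0 by (simp add: mult_ac)
      have "ennreal (A * k powr (-2) * k) * ennreal (K (k * z) (k * \<rho>) * u (k * \<rho>)) = ennreal (K z \<rho> * (A * u (k * \<rho>)))"
        using A k0 by (subst ennreal_mult'[symmetric], simp, simp only: e)
      moreover have "indicator {k * z..} (k * \<rho>) = (indicator {z..} \<rho> :: ennreal)"
        using k0 by (auto simp: indicator_def)
      ultimately show "ennreal (A * k powr (-2) * k) * (ennreal (K (k * z) (k * \<rho>) * u (k * \<rho>)) * indicator {k * z..} (k * \<rho>))
         = ennreal (K z \<rho> * (A * u (k * \<rho>))) * indicator {z..} \<rho>"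
        by (simp only: mult.assoc[symmetric])
    qed
    also have "ennreal (A * k powr (-2)) * ennreal (u (k * z) powr m) = ennreal ((A * u (k * z)) powr m)"
      unfolding kA using A sol_nonneg[OF u kz] by (simp add: powr_mult ennreal_mult'[symmetric])
    finally show ?thesis by simp
  qed
  then show ?thesis unfolding sol_def using A k0 sol_nonneg[OF u] by auto
qed

end

text \<open>Above the threshold \<open>v powr (- 1 / (1 - \<theta>))\<close> the linear term
  dominates, below it the power is bounded by the constant.\<close>

lemma powr_interpolate:
  fixes u v \<theta> :: real
  assumes "0 \<le> u" "0 < v" "0 < \<theta>" "\<theta> < 1"
  shows "u powr \<theta> \<le> v * u + v powr (- \<theta> / (1 - \<theta>))"
proof (cases "v powr (- 1 / (1 - \<theta>)) \<le> u")
  case True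
  then have u0: "0 < u" using assms by (smt (verit) powr_gt_zero)
  have "u powr (- (1 - \<theta>)) \<le> (v powr (- 1 / (1 - \<theta>))) powr (- (1 - \<theta>))"
    using True assms by (intro powr_mono2') auto
  also have "\<dots> = v"
  proof -
    have "- 1 / (1 - \<theta>) * (- (1 - \<theta>)) = 1" using assms by (simp add: field_simps)
    then show ?thesis unfolding powr_powr using assms by simp
  qed
  finally have "u * u powr (- (1 - \<theta>)) \<le> u * v" using u0 by (intro mult_left_mono) auto
  moreover have "u * u powr (- (1 - \<theta>)) = u powr \<theta>" using u0 powr_add[of u 1 "- (1 - \<theta>)"] by simp
  ultimately have "u powr \<theta> \<le> v * u" by (simp add: mult.commute)
  then show ?thesis by (rule add_increasing2[OF powr_ge_zero])
next
  case False
  then have "u powr \<theta> \<le> (v powr (- 1 / (1 - \<theta>))) powr \<theta>" using assms by (intro powr_mono2) auto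
  also have "\<dots> = v powr (- \<theta> / (1 - \<theta>))" by (simp add: powr_powr)
  finally show ?thesis using assms by (simp add: add_increasing)
qed

section \<open>The uniform bound for the moment of order \<open>d + 1\<close>\<close>

context profile_params
begin

text \<open>\<open>S\<close> enters the right-hand side linearly, with coefficients
  \<open>C0 * \<delta>\<close> and \<open>B\<^sup>2 * \<epsilon>\<close> that can be made small
  independently of \<open>m\<close>. As \<open>S\<close> is finite beforehand, these terms can be
  absorbed on the left.\<close>

lemma sol_second_moment_le:
  fixes \<mu> S q C0 \<delta> \<epsilon> B :: real
  assumes u: "sol u" and \<mu>: "0 \<le> \<mu>" "mom (real d - 1) u = ennreal \<mu>" and S: "0 \<le> S" "mom (real d + 1) u = ennreal S"
    and mm: "(real d + 1) / (real d + 3) \<le> m" "m \<le> 2"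
    and C0: "QC \<le> C0" and \<delta>: "0 < \<delta>" and \<epsilon>: "0 < \<epsilon>" and B: "B = 1 + \<mu> * real d * \<delta> powr (- real d)"
  shows "QF (real d + 2) * S \<le> C0 * (\<mu> + S) * \<delta> + B\<^sup>2 * \<epsilon> * S + B\<^sup>2 * \<epsilon> powr (- (real d + 1) / 2) / \<delta>"
proof -
  have [measurable]: "u \<in> borel_measurable borel" using u by (rule sol_measurable)
  \<comment> \<open>Chosen such that \<open>\<theta> / (1 - \<theta>) = (d + 1) / 2\<close>: the
    remainder is then of order \<open>z powr (- d - 1)\<close>, and times
    \<open>z powr (d - 1)\<close> it is integrable at infinity.\<close>
  define \<theta> where "\<theta> = (real d + 1) / (real d + 3)"
  have th: "0 < \<theta>" "\<theta> < 1" "\<theta> \<le> m" unfolding \<theta>_def using mm by auto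
  have th2: "- \<theta> / (1 - \<theta>) = - (real d + 1) / 2"
  proof -
    have "1 - \<theta> = 2 / (real d + 3)" unfolding \<theta>_def by (simp add: field_simps)
    then show ?thesis unfolding \<theta>_def by simp
  qed
  have d0: "0 < real d" using d by simp
  have C0p: "0 < C0" using QC_pos C0 by simp
  define D where "D = B\<^sup>2 * \<epsilon> powr (- (real d + 1) / 2)"
  have D0: "0 \<le> D" unfolding D_def by simp
  \<comment> \<open>The summand 1 in \<open>B\<close> makes
    \<open>B powr (m - \<theta>) \<le> B\<^sup>2\<close> for all \<open>m\<close> in the range at
    once.\<close>
  have B1: "1 \<le> B" unfolding B using \<mu> by simp
  have F1: "mom (real d) u \<le> ennreal (\<mu> + S)"
    using mom_interpolate[of u "real d"] sol_nonneg[OF u] \<mu> S by simp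
  txt \<open>Near \<open>0\<close> the kernel bound suffices; away from \<open>0\<close>, where \<open>u \<le> B\<close>, the power \<open>u powr m\<close> is traded
    for \<open>\<epsilon> z\<^sup>2 u\<close> and an integrable remainder, in the same way for \<open>m\<close> above and below \<open>1\<close>.\<close>
  have pw: "z powr (real d - 1) * u z powr m \<le> C0 * (\<mu> + S) * indicator {0..\<delta>} z + B\<^sup>2 * \<epsilon> * (z powr (real d + 1) * u z) + D * (z powr (-1 - 1) * indicator {\<delta>..} z)"
    if z: "0 < z" for z
  proof (cases "z \<le> \<delta>")
    case True
    have "z powr (real d - 1) * u z powr m \<le> z powr (real d - 1) * (QC * z powr (1 - real d) * (\<mu> + S))"
      using sol_le_mom[OF u F1 _ z] \<mu> S by (intro mult_left_mono) auto
    also have "\<dots> = QC * (\<mu> + S) * (z powr (real d - 1) * z powr (1 - real d))" by simp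
    also have "z powr (real d - 1) * z powr (1 - real d) = 1" using z by (simp add: powr_add[symmetric])
    also have "QC * (\<mu> + S) * 1 \<le> C0 * (\<mu> + S)" using C0 \<mu> S by (simp add: mult_right_mono)
    finally show ?thesis using True z sol_nonneg[OF u z] \<epsilon> D0
      by (auto intro!: add_increasing2 mult_nonneg_nonneg)
  next
    case False
    have "u z \<le> \<mu> * (real d - 1 + 1) * z powr (- (real d - 1 + 1))"
      using sol_nonneg[OF u] sol_antimono[OF u] z d0 \<mu> by (intro antimono_le_mom) auto
    also have "\<dots> \<le> \<mu> * real d * \<delta> powr (- real d)"
      using \<mu> \<delta> False d0 by (auto intro!: mult_left_mono powr_mono2')
    finally have uB: "u z \<le> B" unfolding B by simp
    have "u z powr m = u z powr \<theta> * u z powr (m - \<theta>)" by (simp add: powr_add[symmetric])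
    also have "u z powr (m - \<theta>) \<le> B powr (m - \<theta>)" using uB th sol_nonneg[OF u z] by (intro powr_mono2) auto
    also have "B powr (m - \<theta>) \<le> B powr 2" using B1 th mm by (intro powr_mono) auto
    also have "B powr 2 = B\<^sup>2" using B1 by simp
    finally have 1: "u z powr m \<le> u z powr \<theta> * B\<^sup>2" by (simp add: mult_left_mono)
    have "u z powr \<theta> \<le> (\<epsilon> * z\<^sup>2) * u z + (\<epsilon> * z\<^sup>2) powr (- (real d + 1) / 2)"
      using powr_interpolate[of "u z" "\<epsilon> * z\<^sup>2" \<theta>] sol_nonneg[OF u z] z \<epsilon> th unfolding th2 by simp
    then have "u z powr \<theta> * B\<^sup>2 \<le> B\<^sup>2 * ((\<epsilon> * z\<^sup>2) * u z + (\<epsilon> * z\<^sup>2) powr (- (real d + 1) / 2))"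
      by (subst mult.commute, intro mult_left_mono) auto
    with 1 have "z powr (real d - 1) * u z powr m \<le> z powr (real d - 1) * (B\<^sup>2 * ((\<epsilon> * z\<^sup>2) * u z + (\<epsilon> * z\<^sup>2) powr (- (real d + 1) / 2)))"
      by (intro mult_left_mono) auto
    also have "(\<epsilon> * z\<^sup>2) powr (- (real d + 1) / 2) = \<epsilon> powr (- (real d + 1) / 2) * z powr (- (real d + 1))"
    proof -
      have "(z\<^sup>2) powr (- (real d + 1) / 2) = (z powr 2) powr (- (real d + 1) / 2)" using z by simp
      also have "\<dots> = z powr (2 * (- (real d + 1) / 2))" by (rule powr_powr)
      also have "2 * (- (real d + 1) / 2) = - (real d + 1)" by simp
      finally show ?thesis using \<epsilon> by (simp only: powr_mult)
    qed
    also have "z powr (real d - 1) * (B\<^sup>2 * ((\<epsilon> * z\<^sup>2) * u z + \<epsilon> powr (- (real d + 1) / 2) * z powr (- (real d + 1))))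
       = B\<^sup>2 * \<epsilon> * ((z powr (real d - 1) * z\<^sup>2) * u z) + D * (z powr (real d - 1) * z powr (- (real d + 1)))"
      unfolding D_def by (simp add: algebra_simps)
    also have "z powr (real d - 1) * z\<^sup>2 = z powr (real d + 1)"
      using z powr_add[of z "real d - 1" 2] by (simp add: add.commute)
    also have "z powr (real d - 1) * z powr (- (real d + 1)) = z powr (-1 - 1)" by (simp add: powr_add[symmetric])
    finally show ?thesis using False z by simp
  qed
  have "ennreal (QF (real d + 2) * S) = (\<integral>\<^sup>+z\<in>{0<..}. ennreal (z powr (real d - 1) * u z powr m) \<partial>lborel)"
    using sol_mellin[OF u d0] S QF_pos[of "real d + 2"] d0 by (simp add: ennreal_mult'')
  also have "\<dots> \<le> (\<integral>\<^sup>+z. ennreal (C0 * (\<mu> + S)) * indicator {0..\<delta>} z + ennreal (B\<^sup>2 * \<epsilon>) * (ennreal (z powr (real d + 1) * u z) * indicator {0<..} z) + ennreal D * (ennreal (z powr (-1 - 1)) * indicator {\<delta>..} z) \<partial>lborel)"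
  proof (intro nn_integral_mono)
    fix z :: real
    show "ennreal (z powr (real d - 1) * u z powr m) * indicator {0<..} z \<le> ennreal (C0 * (\<mu> + S)) * indicator {0..\<delta>} z + ennreal (B\<^sup>2 * \<epsilon>) * (ennreal (z powr (real d + 1) * u z) * indicator {0<..} z) + ennreal D * (ennreal (z powr (-1 - 1)) * indicator {\<delta>..} z)"
    proof (cases "0 < z")
      case True
      have "ennreal (z powr (real d - 1) * u z powr m) \<le> ennreal (C0 * (\<mu> + S) * indicator {0..\<delta>} z + B\<^sup>2 * \<epsilon> * (z powr (real d + 1) * u z) + D * (z powr (-1 - 1) * indicator {\<delta>..} z))"
        using pw[OF True] by (rule ennreal_leI)
      also have "\<dots> = ennreal (C0 * (\<mu> + S)) * indicator {0..\<delta>} z + ennreal (B\<^sup>2 * \<epsilon>) * (ennreal (z powr (real d + 1) * u z)) + ennreal D * (ennreal (z powr (-1 - 1)) * indicator {\<delta>..} z)"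
        using C0p \<mu> S D0 \<epsilon> sol_nonneg[OF u True] by (auto simp: ennreal_plus ennreal_mult' ennreal_mult indicator_def)
      finally show ?thesis using True by simp
    qed simp
  qed
  also have "\<dots> = ennreal (C0 * (\<mu> + S)) * ennreal \<delta> + ennreal (B\<^sup>2 * \<epsilon>) * ennreal S + ennreal D * ennreal (\<delta> powr (-1) / 1)"
  proof -
    have "(\<integral>\<^sup>+z. ennreal (z powr (real d + 1) * u z) * indicator {0<..} z \<partial>lborel) = ennreal S"
      using S unfolding mom_def by simp
    moreover have "(\<integral>\<^sup>+z. ennreal (z powr (-1 - 1)) * indicator {\<delta>..} z \<partial>lborel) = ennreal (\<delta> powr (-1) / 1)"
      using nn_integral_powr_to_inf[of 1 \<delta>] \<delta> by simp
    ultimately show ?thesis using \<delta>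
      by (subst nn_integral_add, simp, simp, subst nn_integral_add, simp, simp) (simp add: nn_integral_cmult nn_integral_cmult_indicator)
  qed
  also have "\<dots> = ennreal (C0 * (\<mu> + S) * \<delta> + B\<^sup>2 * \<epsilon> * S + D / \<delta>)"
    using C0p \<mu> S D0 \<epsilon> \<delta> by (simp add: ennreal_plus ennreal_mult[symmetric] powr_minus_divide del: ennreal_plus) (simp add: ennreal_plus[symmetric] del: ennreal_plus)
  finally show ?thesis unfolding D_def using C0p \<mu> S \<epsilon> \<delta> by (subst (asm) ennreal_le_iff) auto
qed

end

text \<open>Stated outside the locale, since one \<open>S\<close> must serve all \<open>m\<close>.
  The kernel enters only through the bounds \<open>q\<close> and \<open>C0\<close> on its two
  constants.\<close>

lemma uniform_second_moment:
  fixes \<mu> q C0 \<alpha> :: real and d :: nat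
  assumes \<mu>: "0 \<le> \<mu>" and q: "0 < q" and C0: "0 < C0"
  shows "\<exists>S\<ge>0. \<forall>m u. profile_params d \<alpha> m \<longrightarrow> (real d + 1) / (real d + 3) \<le> m \<longrightarrow> m \<le> 2 \<longrightarrow>
     q \<le> profile_params.QF d \<alpha> m (real d + 2) \<longrightarrow> profile_params.QC d \<alpha> m \<le> C0 \<longrightarrow>
     profile_params.sol d \<alpha> m u \<longrightarrow> mom (real d - 1) u = ennreal \<mu> \<longrightarrow> mom (real d + 1) u < \<infinity> \<longrightarrow> mom (real d + 1) u \<le> ennreal S"
proof -
  \<comment> \<open>\<delta> and \<epsilon> make each of the two absorbed coefficients equal to
    \<open>q / 4\<close>, so that half of \<open>q * S\<close> remains on the left.\<close>
  define \<delta> where "\<delta> = q / (4 * C0)"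
  define B where "B = 1 + \<mu> * real d * \<delta> powr (- real d)"
  define \<epsilon> where "\<epsilon> = q / (4 * B\<^sup>2)"
  define G where "G = B\<^sup>2 * \<epsilon> powr (- (real d + 1) / 2) / \<delta>"
  have B1: "1 \<le> B" unfolding B_def using \<mu> by simp
  have pos: "0 < \<delta>" "0 < \<epsilon>" unfolding \<delta>_def \<epsilon>_def using q C0 B1 by auto
  have G0: "0 \<le> G" unfolding G_def using pos by simp
  define S where "S = \<mu> / 2 + 2 * G / q"
  have S0: "0 \<le> S" unfolding S_def using \<mu> G0 q by simp
  have "mom (real d + 1) u \<le> ennreal S"
    if P: "profile_params d \<alpha> m" and mm: "(real d + 1) / (real d + 3) \<le> m" "m \<le> 2"
      and q': "q \<le> profile_params.QF d \<alpha> m (real d + 2)" and C: "profile_params.QC d \<alpha> m \<le> C0"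
      and u: "profile_params.sol d \<alpha> m u" "mom (real d - 1) u = ennreal \<mu>" "mom (real d + 1) u < \<infinity>" for m u
  proof -
    interpret profile_params d \<alpha> m by (rule P)
    obtain s where s: "0 \<le> s" "mom (real d + 1) u = ennreal s" using u(3) by (cases "mom (real d + 1) u") auto
    have "q * s \<le> QF (real d + 2) * s" using q' s by (intro mult_right_mono) auto
    also have "\<dots> \<le> C0 * (\<mu> + s) * \<delta> + B\<^sup>2 * \<epsilon> * s + B\<^sup>2 * \<epsilon> powr (- (real d + 1) / 2) / \<delta>"
      by (rule sol_second_moment_le[OF u(1) \<mu> u(2) s mm C pos]) (simp add: B_def)
    also have "C0 * (\<mu> + s) * \<delta> = q / 4 * (\<mu> + s)" unfolding \<delta>_def using C0 by simp
    also have "B\<^sup>2 * \<epsilon> = q / 4" unfolding \<epsilon>_def using B1 by simp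
    finally have "q * s \<le> q / 4 * (\<mu> + s) + q / 4 * s + G" unfolding G_def .
    moreover have "q / 4 * (\<mu> + s) = q * \<mu> / 4 + q * s / 4" "q / 4 * s = q * s / 4" by (simp_all add: distrib_left)
    ultimately have "q * s \<le> q * \<mu> / 2 + 2 * G" by linarith
    also have "\<dots> = q * S" unfolding S_def using q by (simp add: distrib_left)
    finally have "s \<le> S" using q by simp
    then show ?thesis using s by (simp add: ennreal_leI)
  qed
  then show ?thesis using S0 by blast
qed

subsection \<open>Compactness as \<open>m \<longrightarrow> 1\<close>\<close>

lemma b_exp_tendsto:
  assumes "X \<longlonglongrightarrow> 1"
  shows "(\<lambda>n. b_exp d \<alpha> (X n)) \<longlonglongrightarrow> \<alpha> / 2"
proof -
  have "(\<lambda>n. \<alpha> / (2 + real d * (X n - 1))) \<longlonglongrightarrow> \<alpha> / (2 + real d * (1 - 1))"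
    using assms by (intro tendsto_intros) auto
  then show ?thesis unfolding b_exp_def by simp
qed

lemma QF_tendsto:
  assumes P: "\<And>n. profile_params d \<alpha> (X n)" "profile_params d \<alpha> 1" and X: "X \<longlonglongrightarrow> 1" and g: "2 < \<gamma>" "real d < \<gamma>"
  shows "(\<lambda>n. profile_params.QF d \<alpha> (X n) \<gamma>) \<longlonglongrightarrow> profile_params.QF d \<alpha> 1 \<gamma>"
proof -
  have \<alpha>: "0 < \<alpha>" "\<alpha> < 1" using profile_params.\<alpha>[OF P(2)] by auto
  have b1: "b_exp d \<alpha> 1 = \<alpha> / 2" by (simp add: b_exp_def)
  have "0 < \<alpha> / 2 * (\<gamma> - real d)" "0 < 1 - \<alpha> + \<alpha> / 2 * (\<gamma> - real d)"
    using \<alpha> g by (auto intro: add_pos_pos)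
  then have nn: "\<alpha> / 2 * (\<gamma> - real d) \<notin> \<int>\<^sub>\<le>\<^sub>0" "1 - \<alpha> + \<alpha> / 2 * (\<gamma> - real d) \<notin> \<int>\<^sub>\<le>\<^sub>0" "Gamma (1 - \<alpha> + \<alpha> / 2 * (\<gamma> - real d)) \<noteq> 0"
    by (auto elim!: nonpos_Ints_cases' simp: Gamma_eq_zero_iff)
  show ?thesis
    unfolding profile_params.QF_def[OF P(1)] profile_params.QF_def[OF P(2)] b1
    by (intro tendsto_intros b_exp_tendsto X nn) (use g in auto)
qed

lemma QC_tendsto:
  assumes P: "\<And>n. profile_params d \<alpha> (X n)" "profile_params d \<alpha> 1" and X: "X \<longlonglongrightarrow> 1"
  shows "(\<lambda>n. profile_params.QC d \<alpha> (X n)) \<longlonglongrightarrow> profile_params.QC d \<alpha> 1"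
proof -
  have \<alpha>: "0 < \<alpha>" "\<alpha> < 1" using profile_params.\<alpha>[OF P(2)] by auto
  have b1: "b_exp d \<alpha> 1 = \<alpha> / 2" by (simp add: b_exp_def)
  have "0 < \<alpha> / 2" "0 < \<alpha> / 2 + (1 - \<alpha>)" "0 < 1 - \<alpha>" using \<alpha> by auto
  then have nn: "\<alpha> / 2 \<notin> \<int>\<^sub>\<le>\<^sub>0" "\<alpha> / 2 + (1 - \<alpha>) \<notin> \<int>\<^sub>\<le>\<^sub>0" "Gamma (\<alpha> / 2 + (1 - \<alpha>)) \<noteq> 0" "Gamma (1 - \<alpha>) \<noteq> 0"
    by (auto elim!: nonpos_Ints_cases' simp: Gamma_eq_zero_iff)
  show ?thesis
    unfolding profile_params.QC_def[OF P(1)] profile_params.QC_def[OF P(2)] b1 Beta_def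
    by (intro tendsto_intros b_exp_tendsto X nn)
qed

text \<open>\<open>b_exp\<close> decreases in \<open>m\<close>, so on the whole range the weight is
  dominated by the one for the smallest value \<open>m0 = 1 - 1 / (2 d)\<close>, which is still
  integrable on \<open>[\<eta>, 1]\<close>.\<close>

lemma Q_fun_tendsto:
  assumes P: "\<And>n. profile_params d \<alpha> (X n)" "profile_params d \<alpha> 1" and X: "X \<longlonglongrightarrow> 1"
    and ge: "\<And>n. 1 - 1 / (2 * real d) \<le> X n" and \<eta>: "0 < \<eta>"
  shows "(\<lambda>n. Q_fun d \<alpha> (X n) \<eta>) \<longlonglongrightarrow> Q_fun d \<alpha> 1 \<eta>"
proof -
  interpret P1: profile_params d \<alpha> 1 by (rule P(2))
  have d1: "1 \<le> real d" using P1.d by simp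
  define m0 where "m0 = 1 - 1 / (2 * real d)"
  have m0: "0 < m0" "0 < 2 + real d * (m0 - 1)" unfolding m0_def using d1 by (auto simp: field_simps)
  interpret P0: profile_params d \<alpha> m0 using P1.d P1.\<alpha> m0 by unfold_locales auto
  have b0: "b_exp d \<alpha> (X n) \<le> b_exp d \<alpha> m0" for n
    unfolding b_exp_def using P1.\<alpha> m0 ge[of n, folded m0_def] profile_params.m(2)[OF P(1)[of n]]
    by (intro divide_left_mono) (auto intro!: mult_left_mono)
  have bp: "0 < b_exp d \<alpha> (X n)" for n using profile_params.b_pos[OF P(1)] .
  have "(\<lambda>n. LINT \<sigma>:{\<eta>..1}|lborel. (1 - \<sigma> powr (1 / b_exp d \<alpha> (X n))) powr (-\<alpha>) * \<sigma> powr (1 - real d))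
     \<longlonglongrightarrow> (LINT \<sigma>:{\<eta>..1}|lborel. (1 - \<sigma> powr (1 / b_exp d \<alpha> 1)) powr (-\<alpha>) * \<sigma> powr (1 - real d))"
    unfolding set_lebesgue_integral_def
  proof (rule integral_dominated_convergence)
    show "integrable lborel (\<lambda>\<sigma>. indicator {\<eta>..1} \<sigma> *\<^sub>R P0.wt \<sigma>)"
      using P0.set_integrable_wt[OF \<eta>] unfolding set_integrable_def .
    have "AE \<sigma> in lborel. \<sigma> \<noteq> (1::real)" by (rule AE_lborel_singleton)
    then show "AE \<sigma> in lborel. (\<lambda>n. indicator {\<eta>..1} \<sigma> *\<^sub>R ((1 - \<sigma> powr (1 / b_exp d \<alpha> (X n))) powr (-\<alpha>) * \<sigma> powr (1 - real d)))
       \<longlonglongrightarrow> indicator {\<eta>..1} \<sigma> *\<^sub>R ((1 - \<sigma> powr (1 / b_exp d \<alpha> 1)) powr (-\<alpha>) * \<sigma> powr (1 - real d))"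
    proof eventually_elim
      case (elim \<sigma>)
      show ?case
      proof (cases "\<sigma> \<in> {\<eta>..1}")
        case True
        then have s: "0 < \<sigma>" "\<sigma> < 1" using elim \<eta> by auto
        have b1: "b_exp d \<alpha> 1 = \<alpha> / 2" by (simp add: b_exp_def)
        have "1 - \<sigma> powr (1 / (\<alpha>/2)) \<noteq> 0" using powr_less_one'[OF s, of "1/(\<alpha>/2)"] P1.\<alpha> by simp
        then show ?thesis unfolding b1 using s P1.\<alpha>
          by (intro tendsto_intros b_exp_tendsto X) auto
      qed simp
    qed
    fix n
    have "AE \<sigma> in lborel. \<sigma> \<noteq> (1::real)" by (rule AE_lborel_singleton)
    then show "AE \<sigma> in lborel. norm (indicator {\<eta>..1} \<sigma> *\<^sub>R ((1 - \<sigma> powr (1 / b_exp d \<alpha> (X n))) powr (-\<alpha>) * \<sigma> powr (1 - real d)))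
       \<le> indicator {\<eta>..1} \<sigma> *\<^sub>R P0.wt \<sigma>"
    proof eventually_elim
      case (elim \<sigma>)
      show ?case
      proof (cases "\<sigma> \<in> {\<eta>..1}")
        case True
        then have s: "0 < \<sigma>" "\<sigma> < 1" using elim \<eta> by auto
        have "1 / b_exp d \<alpha> m0 \<le> 1 / b_exp d \<alpha> (X n)" using b0[of n] bp[of n] by (intro divide_left_mono) auto
        then have "\<sigma> powr (1 / b_exp d \<alpha> (X n)) \<le> \<sigma> powr (1 / b_exp d \<alpha> m0)" using s by (intro powr_mono') auto
        moreover have "\<sigma> powr (1 / b_exp d \<alpha> m0) < 1" using powr_less_one'[OF s] P0.b_pos by simp
        ultimately have "(1 - \<sigma> powr (1 / b_exp d \<alpha> (X n))) powr (-\<alpha>) \<le> (1 - \<sigma> powr (1 / b_exp d \<alpha> m0)) powr (-\<alpha>)"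
          using P1.\<alpha> by (intro powr_mono2') auto
        then show ?thesis unfolding P0.wt_def using True by (simp add: mult_right_mono)
      qed simp
    qed
  qed auto
  then show ?thesis unfolding Q_fun_def by (intro tendsto_intros)
qed

lemma second_moment_bound:
  assumes P: "\<And>n. profile_params d \<alpha> (X n)" "profile_params d \<alpha> 1" and X: "X \<longlonglongrightarrow> 1" and \<mu>: "0 \<le> \<mu>"
    and u: "\<And>n. profile_params.sol d \<alpha> (X n) (u n)" "\<And>n. mom (real d - 1) (u n) = ennreal \<mu>" "\<And>n. mom (real d + 1) (u n) < \<infinity>"
  shows "\<exists>S C0 n0. 0 \<le> S \<and> 0 < C0 \<and> (\<forall>n\<ge>n0. mom (real d + 1) (u n) \<le> ennreal S \<and> profile_params.QC d \<alpha> (X n) \<le> C0 \<and> 1 - 1 / (2 * real d + 1) \<le> X n \<and> X n \<le> 2)"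
proof -
  interpret P1: profile_params d \<alpha> 1 by (rule P(2))
  have d1: "1 \<le> real d" using P1.d by simp
  define q where "q = P1.QF (real d + 2) / 2"
  define C0 where "C0 = P1.QC + 1"
  have qp: "0 < P1.QF (real d + 2)" using d1 by (intro P1.QF_pos) auto
  have q: "0 < q" "q < P1.QF (real d + 2)" unfolding q_def using qp by auto
  have C0: "0 < C0" "P1.QC < C0" unfolding C0_def using P1.QC_pos by auto
  obtain S where S: "0 \<le> S" "\<And>m u. profile_params d \<alpha> m \<Longrightarrow> (real d + 1) / (real d + 3) \<le> m \<Longrightarrow> m \<le> 2 \<Longrightarrow>
     q \<le> profile_params.QF d \<alpha> m (real d + 2) \<Longrightarrow> profile_params.QC d \<alpha> m \<le> C0 \<Longrightarrow>
     profile_params.sol d \<alpha> m u \<Longrightarrow> mom (real d - 1) u = ennreal \<mu> \<Longrightarrow> mom (real d + 1) u < \<infinity> \<Longrightarrow> mom (real d + 1) u \<le> ennreal S"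
    using uniform_second_moment[OF \<mu> q(1) C0(1), of d \<alpha>] by blast
  have "(\<lambda>n. profile_params.QF d \<alpha> (X n) (real d + 2)) \<longlonglongrightarrow> P1.QF (real d + 2)"
    using d1 by (intro QF_tendsto P X) auto
  then have e1: "\<forall>\<^sub>F n in sequentially. q < profile_params.QF d \<alpha> (X n) (real d + 2)"
    using q(2) by (rule order_tendstoD)
  have e2: "\<forall>\<^sub>F n in sequentially. profile_params.QC d \<alpha> (X n) < C0"
    using QC_tendsto[OF P X] C0(2) by (rule order_tendstoD)
  have e3: "\<forall>\<^sub>F n in sequentially. X n < 2" using X by (rule order_tendstoD) simp
  have e4: "\<forall>\<^sub>F n in sequentially. (real d + 1) / (real d + 3) < X n" using X by (rule order_tendstoD) simp
  have e5: "\<forall>\<^sub>F n in sequentially. 1 - 1 / (2 * real d + 1) < X n" using X by (rule order_tendstoD) simp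
  have "\<forall>\<^sub>F n in sequentially. mom (real d + 1) (u n) \<le> ennreal S \<and> profile_params.QC d \<alpha> (X n) \<le> C0 \<and> 1 - 1 / (2 * real d + 1) \<le> X n \<and> X n \<le> 2"
    using e1 e2 e3 e4 e5
  proof eventually_elim
    case (elim n)
    then show ?case using S(2)[OF P(1), of n "u n"] u by simp
  qed
  then show ?thesis unfolding eventually_sequentially using S(1) C0(1) by blast
qed

text \<open>The bound near \<open>0\<close> comes from the kernel and the first moment, the one at infinity from
  monotonicity and the moment of order \<open>d + 1\<close>.\<close>

definition envelope :: "nat \<Rightarrow> real \<Rightarrow> real \<Rightarrow> real" where
  "envelope d C \<rho> = (if \<rho> \<le> 1 then C * \<rho> powr (- ((real d - 1) * (1 + 1 / (2 * real d)))) else C * \<rho> powr (- (real d + 2)))"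

lemma envelope_measurable [measurable]: "envelope d C \<in> borel_measurable borel"
  unfolding envelope_def by measurable

text \<open>The excess \<open>(d - 1) / (2 d)\<close> over \<open>d - 1\<close>, the price for the
  exponent \<open>1/m\<close>, is less than 1; hence the envelope stays integrable against
  \<open>\<rho> powr (d - 1)\<close> at 0.\<close>

lemma envelope_exponent: "1 \<le> d \<Longrightarrow> (real d - 1) * (1 + 1 / (2 * real d)) < real d"
  by (simp add: field_simps)

lemma mom_envelope:
  assumes d: "1 \<le> d" and "0 \<le> C" "real d - 1 \<le> s" "s < real d + 1"
  shows "mom s (envelope d C) < \<infinity>"
proof (rule mom_finite)
  show "envelope d C z \<le> C * z powr (- ((real d - 1) * (1 + 1 / (2 * real d))))" if "0 < z" "z \<le> 1" for z
    using that by (simp add: envelope_def)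
  show "envelope d C z \<le> C * z powr (- (real d + 2))" if "1 \<le> z" for z
    using that assms by (cases "z = 1") (auto simp: envelope_def)
  show "(real d - 1) * (1 + 1 / (2 * real d)) < s + 1" using envelope_exponent[OF d] assms by linarith
qed (use assms in auto)

lemma sol_le_envelope:
  assumes P: "profile_params d \<alpha> m" and u: "profile_params.sol d \<alpha> m u" and \<mu>: "0 \<le> \<mu>" "mom (real d - 1) u = ennreal \<mu>"
    and S: "0 \<le> S" "mom (real d + 1) u \<le> ennreal S" and C0: "profile_params.QC d \<alpha> m \<le> C0" "0 < C0"
    and mm: "1 - 1 / (2 * real d + 1) \<le> m" and z: "0 < z"
    and C: "C = (S * (real d + 2)) + (1 + C0 * (\<mu> + S)) powr (1 + 1 / (2 * real d))"
  shows "u z \<le> envelope d C z"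
proof -
  interpret profile_params d \<alpha> m by (rule P)
  have d1: "1 \<le> real d" using d by simp
  show ?thesis
  proof (cases "z \<le> 1")
    case True
    \<comment> \<open>The summand 1 keeps the base at least 1, so that the exponent
      \<open>1/m\<close> may be raised to one that does not depend on \<open>m\<close>.\<close>
    define D where "D = 1 + C0 * (\<mu> + S)"
    have D1: "1 \<le> D" unfolding D_def using C0 \<mu> S by simp
    have F1: "mom (real d) u \<le> ennreal (\<mu> + S)"
    proof -
      have "mom (real d) u \<le> mom (real d - 1) u + mom (real d + 1) u"
        using mom_interpolate[of u "real d"] sol_nonneg[OF u] sol_measurable[OF u] by simp
      also have "\<dots> \<le> ennreal \<mu> + ennreal S" using \<mu> S by (intro add_mono) auto
      finally show ?thesis using \<mu> S by simp
    qed
    have "u z powr m \<le> QC * z powr (1 - real d) * (\<mu> + S)"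
      using sol_le_mom[OF u F1 _ z] \<mu> S by simp
    also have "\<dots> \<le> D * z powr (1 - real d)"
    proof -
      have "QC * (\<mu> + S) \<le> C0 * (\<mu> + S)" using C0 \<mu> S by (intro mult_right_mono) auto
      then have "QC * (\<mu> + S) \<le> D" unfolding D_def by simp
      then have "QC * (\<mu> + S) * z powr (1 - real d) \<le> D * z powr (1 - real d)" by (intro mult_right_mono) auto
      then show ?thesis by (simp add: mult_ac)
    qed
    finally have "(u z powr m) powr (1/m) \<le> (D * z powr (1 - real d)) powr (1/m)"
      using m by (intro powr_mono2) auto
    then have "u z \<le> (D * z powr (1 - real d)) powr (1/m)"
      using m sol_nonneg[OF u z] by (simp add: powr_powr)
    also have "\<dots> \<le> (D * z powr (1 - real d)) powr (1 + 1 / (2 * real d))"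
    proof (rule powr_mono)
      have "1 \<le> z powr (1 - real d)" using powr_mono'[of "1 - real d" 0 z] True z d1 by simp
      then show "1 \<le> D * z powr (1 - real d)" using D1 mult_mono[of 1 D 1 "z powr (1 - real d)"] by simp
      \<comment> \<open>\<open>1 + 1 / (2 d)\<close> is the reciprocal of
        \<open>1 - 1 / (2 d + 1)\<close>, the lower bound for \<open>m\<close>.\<close>
      have "1 / m \<le> 1 / (1 - 1 / (2 * real d + 1))"
        using mm m d1 by (intro divide_left_mono mult_pos_pos) (auto simp: field_simps)
      also have "\<dots> = 1 + 1 / (2 * real d)" using d1 by (simp add: field_simps)
      finally show "1 / m \<le> 1 + 1 / (2 * real d)" .
    qed
    also have "\<dots> = D powr (1 + 1 / (2 * real d)) * z powr (- ((real d - 1) * (1 + 1 / (2 * real d))))"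
    proof -
      have "(1 - real d) * (1 + 1 / (2 * real d)) = - ((real d - 1) * (1 + 1 / (2 * real d)))" by (simp add: left_diff_distrib)
      then show ?thesis using D1 by (simp only: powr_mult powr_powr)
    qed
    also have "\<dots> \<le> C * z powr (- ((real d - 1) * (1 + 1 / (2 * real d))))"
      unfolding C D_def using S by (intro mult_right_mono) auto
    finally show ?thesis unfolding envelope_def using True by simp
  next
    case False
    have "u z \<le> S * (real d + 1 + 1) * z powr (- (real d + 1 + 1))"
      using sol_nonneg[OF u] sol_antimono[OF u] z d1 S by (intro antimono_le_mom) auto
    also have "\<dots> = S * (real d + 2) * z powr (- (real d + 2))"
    proof -
      have "real d + 1 + 1 = real d + 2" by simp
      then show ?thesis by (simp only:)
    qed
    also have "\<dots> \<le> C * z powr (- (real d + 2))" unfolding C by (intro mult_right_mono) auto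
    finally show ?thesis unfolding envelope_def using False by simp
  qed
qed

text \<open>Helly's selection principle, applied to the bounded monotone functions
  \<open>x \<mapsto> 1 / (1 + u (exp x))\<close>.\<close>

lemma antimono_subseq_convergent:
  fixes u :: "nat \<Rightarrow> real \<Rightarrow> real"
  assumes nn: "\<And>n z. 0 < z \<Longrightarrow> 0 \<le> u n z" and anti: "\<And>n z z'. 0 < z \<Longrightarrow> z \<le> z' \<Longrightarrow> u n z' \<le> u n z"
    and cont: "\<And>n. continuous_on {0<..} (u n)" and bd: "\<And>n z. 0 < z \<Longrightarrow> u n z \<le> w z"
  shows "\<exists>s. strict_mono (s :: nat \<Rightarrow> nat) \<and> (AE z in lborel. 0 < z \<longrightarrow> convergent (\<lambda>n. u (s n) z))"
proof -
  define G where "G n x = 1 / (1 + u n (exp x))" for n x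
  have c: "isCont (G n) x" for n x
    unfolding G_def
  proof (intro continuous_intros)
    have "isCont (u n) (exp x)" using cont[of n] by (simp add: continuous_on_eq_continuous_at)
    then show "isCont (\<lambda>x. u n (exp x)) x" by (intro isCont_o2[OF isCont_exp]) 
    show "1 + u n (exp x) \<noteq> 0" using nn[of "exp x" n] by simp
  qed
  have "\<exists>s. strict_mono (s::nat \<Rightarrow> nat) \<and> (\<exists>F. (\<forall>x. continuous (at_right x) F) \<and> mono F \<and> (\<forall>x. \<bar>F x\<bar> \<le> 1) \<and>
    (\<forall>x. continuous (at x) F \<longrightarrow> (\<lambda>n. G (s n) x) \<longlonglongrightarrow> F x))"
  proof (rule Helly_selection)
    show "continuous (at_right x) (G n)" for n x
      using c[of x n] by (rule continuous_at_imp_continuous_at_within)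
    show "mono (G n)" for n
    proof (rule monoI)
      fix x y :: real assume "x \<le> y"
      then have "u n (exp y) \<le> u n (exp x)" using anti by simp
      then show "G n x \<le> G n y" unfolding G_def using nn[of "exp y" n] by (intro divide_left_mono) (auto intro: add_pos_nonneg nn mult_pos_pos)
    qed
    show "\<bar>G n x\<bar> \<le> 1" for n x unfolding G_def using nn[of "exp x" n] by simp
  qed
  then obtain s F where s: "strict_mono (s::nat \<Rightarrow> nat)" and F: "mono F" "\<And>x. continuous (at x) F \<Longrightarrow> (\<lambda>n. G (s n) x) \<longlonglongrightarrow> F x"
    by blast
  have cd: "countable {x. \<not> isCont F x}" using F(1) by (rule mono_ctble_discont)
  have conv: "convergent (\<lambda>n. u (s n) z)" if z: "0 < z" "isCont F (ln z)" for z
  proof -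
    have lim: "(\<lambda>n. G (s n) (ln z)) \<longlonglongrightarrow> F (ln z)" using F(2) z by simp
    have "0 \<le> w z" using nn[OF z(1), of 0] bd[OF z(1), of 0] by simp
    \<comment> \<open>The majorant \<open>w\<close> keeps the limit away from 0, the value that
      would correspond to \<open>u\<close> tending to infinity.\<close>
    have "1 / (1 + w z) \<le> G (s n) (ln z)" for n
      unfolding G_def using z nn[OF z(1), of "s n"] bd[OF z(1), of "s n"] by (intro divide_left_mono) (auto intro!: mult_pos_pos)
    then have "1 / (1 + w z) \<le> F (ln z)" using LIMSEQ_le_const[OF lim] by blast
    then have "F (ln z) \<noteq> 0" using \<open>0 \<le> w z\<close> by (smt (verit) divide_pos_pos)
    then have "(\<lambda>n. 1 / G (s n) (ln z) - 1) \<longlonglongrightarrow> 1 / F (ln z) - 1" using lim by (intro tendsto_intros) auto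
    moreover have "1 / G (s n) (ln z) - 1 = u (s n) z" for n unfolding G_def using z by simp
    ultimately show ?thesis by (auto simp: convergent_def)
  qed
  \<comment> \<open>A monotone function has countably many discontinuities, so only a null set of
    points is lost.\<close>
  have "exp ` {x. \<not> isCont F x} \<in> null_sets lborel"
    using cd by (intro countable_imp_null_set_lborel countable_image)
  then have "AE z in lborel. z \<notin> exp ` {x. \<not> isCont F x}" by (rule AE_not_in)
  then have "AE z in lborel. 0 < z \<longrightarrow> convergent (\<lambda>n. u (s n) z)"
  proof eventually_elim
    case (elim z)
    show ?case
    proof
      assume z: "0 < z"
      then have "isCont F (ln z)" using elim by (metis (mono_tags) exp_ln image_eqI mem_Collect_eq)
      then show "convergent (\<lambda>n. u (s n) z)" using conv z by blast
    qed
  qed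
  then show ?thesis using s by blast
qed

text \<open>For \<open>m = 1\<close> the left side of the Mellin identity at \<open>s = d\<close> is
  the mass itself.\<close>

lemma sol_one_moment_finite:
  assumes P: "profile_params d \<alpha> 1" and u: "profile_params.sol d \<alpha> 1 u" and fin: "mom (real d - 1) u < \<infinity>"
  shows "mom (real d + 1) u < \<infinity>"
proof -
  interpret profile_params d \<alpha> 1 by (rule P)
  have "mom (real d - 1) u = (\<integral>\<^sup>+z\<in>{0<..}. ennreal (z powr (real d - 1) * u z powr 1) \<partial>lborel)"
    unfolding mom_def using sol_nonneg[OF u] by (intro nn_integral_cong) (auto simp: indicator_def)
  also have "\<dots> = ennreal (QF (real d + 2)) * mom (real d + 1) u"
    using d by (intro sol_mellin u) auto
  finally show ?thesis using fin QF_pos[of "real d + 2"] d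
    by (auto simp: ennreal_mult_less_top ennreal_eq_0_iff less_top[symmetric])
qed

text \<open>Convergence almost everywhere is enough under the integral, and the equation then
  returns convergence at every \<open>z > 0\<close>. The envelope is integrable against
  \<open>\<rho> powr d\<close> and \<open>\<rho> powr (d - 1)\<close>, so the equation and the mass
  both pass to the limit.\<close>

theorem sol_compactness:
  fixes X :: "nat \<Rightarrow> real"
  assumes P: "\<And>n. profile_params d \<alpha> (X n)" "profile_params d \<alpha> 1" and X: "X \<longlonglongrightarrow> 1" and \<mu>: "0 \<le> \<mu>"
    and u: "\<And>n. profile_params.sol d \<alpha> (X n) (u n)" "\<And>n. mom (real d - 1) (u n) = ennreal \<mu>" "\<And>n. mom (real d + 1) (u n) < \<infinity>"
  shows "\<exists>s f. strict_mono (s :: nat \<Rightarrow> nat) \<and> (\<forall>z>0. (\<lambda>n. u (s n) z) \<longlonglongrightarrow> f z) \<and>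
    profile_params.sol d \<alpha> 1 f \<and> mom (real d - 1) f = ennreal \<mu> \<and> mom (real d + 1) f < \<infinity>"
proof -
  interpret P1: profile_params d \<alpha> 1 by (rule P(2))
  obtain S C0 n0 where S: "0 \<le> S" "0 < C0"
    and n0: "\<And>n. n0 \<le> n \<Longrightarrow> mom (real d + 1) (u n) \<le> ennreal S \<and> profile_params.QC d \<alpha> (X n) \<le> C0 \<and> 1 - 1 / (2 * real d + 1) \<le> X n \<and> X n \<le> 2"
    using second_moment_bound[OF P X \<mu> u] by blast
  have d1: "1 \<le> real d" using P1.d by simp
  define C where "C = (S * (real d + 2)) + (1 + C0 * (\<mu> + S)) powr (1 + 1 / (2 * real d))"
  have C: "0 \<le> C" unfolding C_def using S d1 by simp
  define w where "w = envelope d C"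
  have [measurable]: "w \<in> borel_measurable borel" unfolding w_def by simp
  define Y v where "Y n = X (n + n0)" and "v n = u (n + n0)" for n
  have PY: "profile_params d \<alpha> (Y n)" for n unfolding Y_def by (rule P)
  have Y: "Y \<longlonglongrightarrow> 1" unfolding Y_def using X by (rule LIMSEQ_ignore_initial_segment)
  have v: "profile_params.sol d \<alpha> (Y n) (v n)" "mom (real d - 1) (v n) = ennreal \<mu>" "mom (real d + 1) (v n) \<le> ennreal S" "profile_params.QC d \<alpha> (Y n) \<le> C0"
     "1 - 1 / (2 * real d + 1) \<le> Y n" "Y n \<le> 2" for n
    unfolding Y_def v_def using u n0[of "n + n0"] by auto
  have vm [measurable]: "v n \<in> borel_measurable borel" for n using profile_params.sol_measurable[OF PY v(1)] .
  have vnn: "0 \<le> v n z" if "0 < z" for n z using profile_params.sol_nonneg[OF PY v(1) that] .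
  have vw: "v n z \<le> w z" if "0 < z" for n z
    unfolding w_def using PY v(1) \<mu> v(2) S(1) v(3,4) S(2) v(5) that C_def by (rule sol_le_envelope)
  have "\<exists>s. strict_mono (s :: nat \<Rightarrow> nat) \<and> (AE z in lborel. 0 < z \<longrightarrow> convergent (\<lambda>n. v (s n) z))"
  proof (rule antimono_subseq_convergent)
    show "v n z' \<le> v n z" if "0 < z" "z \<le> z'" for n z z'
      using profile_params.sol_antimono[OF PY v(1) that] .
    show "continuous_on {0<..} (v n)" for n
    proof (rule profile_params.sol_continuous_on[OF PY v(1)])
      have "mom (real d) (v n) \<le> mom (real d - 1) (v n) + mom (real d + 1) (v n)"
        by (intro mom_interpolate vm vnn)
      also have "\<dots> < \<infinity>" using v(2,3)[of n] by (simp add: le_less_trans)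
      finally show "mom (real d) (v n) < \<infinity>" .
    qed
  qed (use vnn vw in auto)
  then obtain s where s: "strict_mono (s :: nat \<Rightarrow> nat)" and ae: "AE z in lborel. 0 < z \<longrightarrow> convergent (\<lambda>n. v (s n) z)"
    by blast
  define f where "f z = lim (\<lambda>n. v (s n) z)" for z
  have [measurable]: "f \<in> borel_measurable borel" unfolding f_def by measurable
  have ae_lim: "AE z in lborel. 0 < z \<longrightarrow> (\<lambda>n. v (s n) z) \<longlonglongrightarrow> f z"
    using ae by eventually_elim (auto simp: f_def convergent_LIMSEQ_iff)
  have Ys: "(\<lambda>n. Y (s n)) \<longlonglongrightarrow> 1" using LIMSEQ_subseq_LIMSEQ[OF Y s] by (simp add: o_def)
  have wi: "integrable lborel (\<lambda>\<rho>. indicator {0<..} \<rho> *\<^sub>R (\<rho> powr t * w \<rho>))" if "t = real d \<or> t = real d - 1" for t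
  proof -
    have "mom t w < \<infinity>" unfolding w_def using P1.d C that by (intro mom_envelope) auto
    then show ?thesis
      unfolding mom_def set_integrable_def[symmetric]
      by (subst set_integrable_iff_nn_integral) (auto simp: w_def envelope_def C)
  qed
  define I where "I z = (LINT \<rho>:{0<..}|lborel. K_ker d \<alpha> 1 z \<rho> * f \<rho>)" for z
  \<comment> \<open>Kernel and solution both vary with \<open>n\<close>; the common bound
    \<open>C0\<close> on \<open>QC\<close> provides one majorant for all of them.\<close>
  have Klim: "(\<lambda>n. v (s n) z powr Y (s n)) \<longlonglongrightarrow> I z" if z: "0 < z" for z
  proof -
    have e: "v (s n) z powr Y (s n) = (LINT \<rho>:{0<..}|lborel. K_ker d \<alpha> (Y (s n)) z \<rho> * v (s n) \<rho>)" for n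
    proof -
      interpret Pn: profile_params d \<alpha> "Y (s n)" by (rule PY)
      have "(\<integral>\<^sup>+\<rho>\<in>{0<..}. ennreal (Pn.K z \<rho> * v (s n) \<rho>) \<partial>lborel) = ennreal (v (s n) z powr Y (s n))"
        using Pn.sol_eq[OF v(1) z] unfolding Pn.nn_integral_K_extend[OF z] .
      then show ?thesis using vnn Pn.K_nonneg by (subst set_lebesgue_integral_nonneg_eq) auto
    qed
    show ?thesis
      unfolding e I_def set_lebesgue_integral_def
    proof (rule integral_dominated_convergence)
      show "integrable lborel (\<lambda>\<rho>. C0 * z powr (1 - real d) * (indicator {0<..} \<rho> *\<^sub>R (\<rho> powr real d * w \<rho>)))"
        by (rule integrable_mult_right[OF wi]) simp
      show "(\<lambda>x. indicator {0<..} x *\<^sub>R (K_ker d \<alpha> 1 z x * f x)) \<in> borel_measurable lborel" by simp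
      show "(\<lambda>x. indicator {0<..} x *\<^sub>R (K_ker d \<alpha> (Y (s n)) z x * v (s n) x)) \<in> borel_measurable lborel" for n
        using profile_params.K_measurable2[OF PY, of "s n" z] by simp
      show "AE \<rho> in lborel. (\<lambda>n. indicator {0<..} \<rho> *\<^sub>R (K_ker d \<alpha> (Y (s n)) z \<rho> * v (s n) \<rho>)) \<longlonglongrightarrow> indicator {0<..} \<rho> *\<^sub>R (K_ker d \<alpha> 1 z \<rho> * f \<rho>)"
        using ae_lim
      proof eventually_elim
        case (elim \<rho>)
        show ?case
        proof (cases "0 < \<rho>")
          case True
          have "(\<lambda>n. Q_fun d \<alpha> (Y (s n)) (z / \<rho>)) \<longlonglongrightarrow> Q_fun d \<alpha> 1 (z / \<rho>)"
          proof (rule Q_fun_tendsto[OF PY P(2) Ys])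
            fix n
            have "1 / (2 * real d + 1) \<le> 1 / (2 * real d)" using d1 by (intro divide_left_mono) auto
            then show "1 - 1 / (2 * real d) \<le> Y (s n)" using v(5)[of "s n"] by linarith
          qed (use z True in simp)
          then show ?thesis unfolding K_ker_def using elim True by (intro tendsto_intros) auto
        qed simp
      qed
      fix n
      show "AE \<rho> in lborel. norm (indicator {0<..} \<rho> *\<^sub>R (K_ker d \<alpha> (Y (s n)) z \<rho> * v (s n) \<rho>)) \<le> C0 * z powr (1 - real d) * (indicator {0<..} \<rho> *\<^sub>R (\<rho> powr real d * w \<rho>))"
      proof (rule AE_I2)
        fix \<rho> :: real
        interpret Pn: profile_params d \<alpha> "Y (s n)" by (rule PY)
        show "norm (indicator {0<..} \<rho> *\<^sub>R (Pn.K z \<rho> * v (s n) \<rho>)) \<le> C0 * z powr (1 - real d) * (indicator {0<..} \<rho> *\<^sub>R (\<rho> powr real d * w \<rho>))"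
        proof (cases "0 < \<rho>")
          case True
          have "Pn.K z \<rho> \<le> Pn.QC * z powr (1 - real d) * \<rho> powr real d" using z True by (rule Pn.K_le)
          also have "\<dots> \<le> C0 * z powr (1 - real d) * \<rho> powr real d" using v(4)[of "s n"] by (intro mult_right_mono) auto
          finally have "Pn.K z \<rho> * v (s n) \<rho> \<le> C0 * z powr (1 - real d) * \<rho> powr real d * w \<rho>"
            using vw[OF True] vnn[OF True] S(2) by (intro mult_mono) auto
          then show ?thesis using True vnn[OF True, of "s n"] Pn.K_nonneg[of \<rho> z] by (simp add: mult.assoc abs_mult)
        qed simp
      qed
    qed
  qed
  have Inn: "0 \<le> I z" if "0 < z" for z
    using LIMSEQ_le_const[OF Klim[OF that], of 0] by simp
  have lim: "(\<lambda>n. v (s n) z) \<longlonglongrightarrow> I z" if z: "0 < z" for z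
  proof -
    have "(\<lambda>n. (v (s n) z powr Y (s n)) powr (1 / Y (s n))) \<longlonglongrightarrow> I z powr (1 / 1)"
      using Klim[OF z] Ys by (intro tendsto_powr' tendsto_intros) (auto intro: always_eventually)
    moreover have "(v (s n) z powr Y (s n)) powr (1 / Y (s n)) = v (s n) z" for n
      using profile_params.m(1)[OF PY, of "s n"] vnn[OF z] by (simp add: powr_powr)
    ultimately show ?thesis using Inn[OF z] by simp
  qed
  \<comment> \<open>\<open>f\<close> was introduced through \<open>lim\<close>, where convergence
    was known almost everywhere only; from here on it is the limit at every positive point.\<close>
  have fI: "f z = I z" if "0 < z" for z unfolding f_def using lim[OF that] by (rule limI)
  have fnn: "0 \<le> f z" if "0 < z" for z using fI Inn that by simp
  have fw: "f z \<le> w z" if "0 < z" for z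
    using LIMSEQ_le_const2[OF lim[OF that]] vw[OF that] fI[OF that] by auto
  have solf: "P1.sol f"
    unfolding P1.sol_def
  proof (intro conjI allI impI)
    fix z :: real assume z: "0 < z"
    have "set_integrable lborel {0<..} (\<lambda>\<rho>. P1.K z \<rho> * f \<rho>)"
      unfolding set_integrable_def
    proof (rule Bochner_Integration.integrable_bound)
      show "integrable lborel (\<lambda>\<rho>. P1.QC * z powr (1 - real d) * (indicator {0<..} \<rho> *\<^sub>R (\<rho> powr real d * w \<rho>)))"
        by (rule integrable_mult_right[OF wi]) simp
      show "AE \<rho> in lborel. norm (indicator {0<..} \<rho> *\<^sub>R (P1.K z \<rho> * f \<rho>)) \<le> norm (P1.QC * z powr (1 - real d) * (indicator {0<..} \<rho> *\<^sub>R (\<rho> powr real d * w \<rho>)))"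
      proof (rule AE_I2)
        fix \<rho> :: real
        show "norm (indicator {0<..} \<rho> *\<^sub>R (P1.K z \<rho> * f \<rho>)) \<le> norm (P1.QC * z powr (1 - real d) * (indicator {0<..} \<rho> *\<^sub>R (\<rho> powr real d * w \<rho>)))"
        proof (cases "0 < \<rho>")
          case True
          have "P1.K z \<rho> * f \<rho> \<le> P1.QC * z powr (1 - real d) * \<rho> powr real d * w \<rho>"
            using fw[OF True] fnn[OF True] P1.QC_pos P1.K_le[OF z True] by (intro mult_mono) auto
          moreover have "0 \<le> w \<rho>" using fw[OF True] fnn[OF True] by simp
          ultimately show ?thesis using True fnn[OF True] P1.K_nonneg[of \<rho> z] P1.QC_pos by (simp add: mult.assoc abs_mult)
        qed simp
      qed
    qed simp
    then have "(\<integral>\<^sup>+\<rho>\<in>{0<..}. ennreal (P1.K z \<rho> * f \<rho>) \<partial>lborel) = ennreal (I z)"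
      unfolding I_def using fnn P1.K_nonneg by (intro set_nn_integral_eq_lebesgue) auto
    then show "(\<integral>\<^sup>+\<rho>\<in>{z..}. ennreal (P1.K z \<rho> * f \<rho>) \<partial>lborel) = ennreal (f z powr 1)"
      unfolding P1.nn_integral_K_extend[OF z] fI[OF z] using Inn[OF z] by simp
  qed (use fnn in auto)
  have mass: "mom (real d - 1) f = ennreal \<mu>"
  proof -
    have vint: "(LINT \<rho>|lborel. indicator {0<..} \<rho> *\<^sub>R (\<rho> powr (real d - 1) * v (s n) \<rho>)) = \<mu>" for n
    proof -
      have "(LINT \<rho>:{0<..}|lborel. \<rho> powr (real d - 1) * v (s n) \<rho>) = enn2real (mom (real d - 1) (v (s n)))"
        unfolding mom_def using vnn by (intro set_lebesgue_integral_nonneg_eq) auto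
      then show ?thesis unfolding set_lebesgue_integral_def v(2) using \<mu> by simp
    qed
    have "(\<lambda>n. LINT \<rho>|lborel. indicator {0<..} \<rho> *\<^sub>R (\<rho> powr (real d - 1) * v (s n) \<rho>)) \<longlonglongrightarrow> (LINT \<rho>|lborel. indicator {0<..} \<rho> *\<^sub>R (\<rho> powr (real d - 1) * f \<rho>))"
    proof (rule integral_dominated_convergence)
      show "integrable lborel (\<lambda>\<rho>. indicator {0<..} \<rho> *\<^sub>R (\<rho> powr (real d - 1) * w \<rho>))" by (rule wi) simp
      show "AE \<rho> in lborel. (\<lambda>n. indicator {0<..} \<rho> *\<^sub>R (\<rho> powr (real d - 1) * v (s n) \<rho>)) \<longlonglongrightarrow> indicator {0<..} \<rho> *\<^sub>R (\<rho> powr (real d - 1) * f \<rho>)"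
        using ae_lim
      proof eventually_elim
        case (elim \<rho>)
        then show ?case by (cases "0 < \<rho>") (auto intro!: tendsto_intros)
      qed
      show "AE \<rho> in lborel. norm (indicator {0<..} \<rho> *\<^sub>R (\<rho> powr (real d - 1) * v (s n) \<rho>)) \<le> indicator {0<..} \<rho> *\<^sub>R (\<rho> powr (real d - 1) * w \<rho>)" for n
        using vw[of _ "s n"] vnn[of _ "s n"] by (intro AE_I2) (auto simp: indicator_def abs_mult intro!: mult_left_mono)
    qed auto
    then have L: "(LINT \<rho>:{0<..}|lborel. \<rho> powr (real d - 1) * f \<rho>) = \<mu>"
      unfolding vint set_lebesgue_integral_def by (simp add: LIMSEQ_const_iff)
    have "set_integrable lborel {0<..} (\<lambda>\<rho>. \<rho> powr (real d - 1) * f \<rho>)"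
      unfolding set_integrable_def
    proof (rule Bochner_Integration.integrable_bound[OF wi[of "real d - 1"]])
      show "AE \<rho> in lborel. norm (indicator {0<..} \<rho> *\<^sub>R (\<rho> powr (real d - 1) * f \<rho>)) \<le> norm (indicator {0<..} \<rho> *\<^sub>R (\<rho> powr (real d - 1) * w \<rho>))"
      proof (rule AE_I2)
        fix \<rho> :: real
        show "norm (indicator {0<..} \<rho> *\<^sub>R (\<rho> powr (real d - 1) * f \<rho>)) \<le> norm (indicator {0<..} \<rho> *\<^sub>R (\<rho> powr (real d - 1) * w \<rho>))"
          using fw[of \<rho>] fnn[of \<rho>] by (cases "0 < \<rho>") (auto simp: abs_mult intro!: mult_left_mono)
      qed
    qed auto
    then show ?thesis unfolding mom_def using fnn L by (subst set_nn_integral_eq_lebesgue) auto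
  qed
  have "mom (real d + 1) f < \<infinity>" using sol_one_moment_finite[OF P(2) solf] mass by simp
  moreover have "\<forall>z>0. (\<lambda>n. u (s n + n0) z) \<longlonglongrightarrow> f z" using lim fI unfolding v_def by simp
  moreover have "strict_mono (\<lambda>n. s n + n0)" using s by (simp add: strict_mono_def)
  ultimately show ?thesis using solf mass by (intro exI[of _ "\<lambda>n. s n + n0"] exI[of _ f]) auto
qed

subsection \<open>Radial functions and Gaussians\<close>

text \<open>Only \<open>t \<ge> 0\<close> is at hand because \<open>t\<close> will be a square.
  Dividing by the leading power and letting \<open>t\<close> tend to 0 from the right gives the
  coefficients one after another.\<close>

lemma powser_zero_nonneg:
  fixes a :: "nat \<Rightarrow> real"
  assumes "\<And>t. 0 \<le> t \<Longrightarrow> (\<lambda>k. a k * t ^ k) sums 0"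
  shows "a k = 0"
proof (induction k rule: less_induct)
  case (less k)
  define c where "c j = a (j + k)" for j
  have s: "(\<lambda>j. c j * t ^ j) sums 0" if "0 < t" for t
  proof -
    have "(\<lambda>j. a (j + k) * t ^ (j + k)) sums (0 - (\<Sum>j<k. a j * t ^ j))"
      using assms[of t] that by (intro sums_split_initial_segment) auto
    also have "(\<Sum>j<k. a j * t ^ j) = 0" using less by (intro sum.neutral) auto
    finally have "(\<lambda>j. t ^ k * (c j * t ^ j)) sums 0" unfolding c_def by (simp add: power_add mult_ac)
    then have "(\<lambda>j. inverse (t ^ k) * (t ^ k * (c j * t ^ j))) sums (inverse (t ^ k) * 0)" by (rule sums_mult)
    moreover have "inverse (t ^ k) * (t ^ k * (c j * t ^ j)) = c j * t ^ j" for j using that by simp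
    ultimately show ?thesis by simp
  qed
  have sm: "(\<lambda>j. c j * x ^ j) sums (\<Sum>j. c j * x ^ j)" if "norm x < 1" for x
    using s[of 1] that by (intro summable_sums powser_inside[of c 1 x]) (auto simp: sums_iff)
  have "((\<lambda>x. \<Sum>j. c j * x ^ j) \<longlongrightarrow> c 0) (at 0)"
    by (rule powser_limit_0[of 1]) (use sm in auto)
  then have "((\<lambda>x. \<Sum>j. c j * x ^ j) \<longlongrightarrow> c 0) (at_right 0)"
    by (rule filterlim_mono) (auto simp: at_within_le_at)
  moreover have "\<forall>\<^sub>F x in at_right (0::real). (\<Sum>j. c j * x ^ j) = 0"
    using s by (auto simp: eventually_at_filter sums_iff)
  ultimately have "((\<lambda>x::real. 0) \<longlongrightarrow> c 0) (at_right 0)"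
    by (rule Lim_transform_eventually)
  then have "c 0 = 0" by (metis tendsto_const_iff trivial_limit_at_right_real)
  then show ?case unfolding c_def by simp
qed

section \<open>Integration in polar coordinates\<close>

lemma nn_integral_lborel_affine:
  fixes f :: "'a::euclidean_space \<Rightarrow> ennreal"
  assumes [measurable]: "f \<in> borel_measurable borel" and c: "c \<noteq> 0"
  shows "(\<integral>\<^sup>+x. f x \<partial>lborel) = ennreal (\<bar>c\<bar> ^ DIM('a)) * (\<integral>\<^sup>+x. f (t + c *\<^sub>R x) \<partial>lborel)"
proof -
  have "(\<integral>\<^sup>+x. f x \<partial>lborel) = (\<integral>\<^sup>+x. f x \<partial>density (distr lborel borel (\<lambda>x::'a. t + c *\<^sub>R x)) (\<lambda>_. ennreal (\<bar>c\<bar> ^ DIM('a))))"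
    by (rule arg_cong[OF lborel_affine[OF c]])
  also have "\<dots> = (\<integral>\<^sup>+x. ennreal (\<bar>c\<bar> ^ DIM('a)) * f x \<partial>distr lborel borel (\<lambda>x::'a. t + c *\<^sub>R x))"
    by (rule nn_integral_density) auto
  also have "\<dots> = (\<integral>\<^sup>+x. ennreal (\<bar>c\<bar> ^ DIM('a)) * f (t + c *\<^sub>R x) \<partial>lborel)"
    by (rule nn_integral_distr) auto
  also have "\<dots> = ennreal (\<bar>c\<bar> ^ DIM('a)) * (\<integral>\<^sup>+x. f (t + c *\<^sub>R x) \<partial>lborel)"
    by (rule nn_integral_cmult) auto
  finally show ?thesis .
qed

lemma integral_lborel_uminus:
  fixes f :: "'a::euclidean_space \<Rightarrow> real"
  assumes [measurable]: "f \<in> borel_measurable borel"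
  shows "(LINT x|lborel. f x) = (LINT x|lborel. f (- x))"
proof -
  have "lborel = density (distr lborel borel (\<lambda>x::'a. 0 + (-1) *\<^sub>R x)) (\<lambda>_. ennreal (\<bar>-1\<bar> ^ DIM('a)))"
    by (rule lborel_affine) simp
  then have "(lborel :: 'a measure) = distr lborel borel (\<lambda>x. - x)" by (simp add: density_1)
  then have "(LINT x|lborel. f x) = (LINT x|distr lborel borel (\<lambda>x. - x). f x)" by (rule arg_cong)
  also have "\<dots> = (LINT x|lborel. f (- x))" by (subst integral_distr) auto
  finally show ?thesis .
qed

lemma homogeneous_cball:
  fixes h :: "'a::euclidean_space \<Rightarrow> real"
  assumes [measurable]: "h \<in> borel_measurable borel" and nn: "\<And>x. 0 \<le> h x"
    and hom: "\<And>c x. 0 < c \<Longrightarrow> h (c *\<^sub>R x) = c ^ p * h x" and r: "0 < r"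
  shows "(\<integral>\<^sup>+x\<in>cball 0 r. ennreal (h x) \<partial>lborel) = ennreal (r ^ (DIM('a) + p)) * (\<integral>\<^sup>+x\<in>cball 0 1. ennreal (h x) \<partial>lborel)"
proof -
  have [measurable]: "cball (0::'a) t \<in> sets borel" for t by simp
  have "(\<integral>\<^sup>+x\<in>cball 0 r. ennreal (h x) \<partial>lborel) = ennreal (\<bar>r\<bar> ^ DIM('a)) * (\<integral>\<^sup>+x. ennreal (h (r *\<^sub>R x)) * indicator (cball 0 r) (r *\<^sub>R x) \<partial>lborel)"
    using r by (subst nn_integral_lborel_affine[of _ r 0]) measurable
  also have "(\<integral>\<^sup>+x. ennreal (h (r *\<^sub>R x)) * indicator (cball 0 r) (r *\<^sub>R x) \<partial>lborel)
      = (\<integral>\<^sup>+x. ennreal (r ^ p) * (ennreal (h x) * indicator (cball 0 1) x) \<partial>lborel)"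
    using r nn by (intro nn_integral_cong) (auto simp: hom indicator_def ennreal_mult')
  also have "\<dots> = ennreal (r ^ p) * (\<integral>\<^sup>+x\<in>cball 0 1. ennreal (h x) \<partial>lborel)"
    by (rule nn_integral_cmult) measurable
  finally show ?thesis using r by (simp add: power_add ennreal_mult' mult.assoc)
qed

text \<open>Polar coordinates without a measure on the sphere: the image of \<open>h dx\<close>
  under the norm is determined by its values on balls, and homogeneity reduces these to the constant
  \<open>C\<close> of the unit ball. The factor \<open>h\<close> admits moments in a fixed
  direction.\<close>

lemma nn_integral_homogeneous_radial:
  fixes h :: "'a::euclidean_space \<Rightarrow> real" and G :: "real \<Rightarrow> ennreal"
  assumes [measurable]: "h \<in> borel_measurable borel" "G \<in> borel_measurable borel" and nn: "\<And>x. 0 \<le> h x"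
    and hom: "\<And>c x. 0 < c \<Longrightarrow> h (c *\<^sub>R x) = c ^ p * h x"
    and C: "(\<integral>\<^sup>+x\<in>cball 0 1. ennreal (h x) \<partial>lborel) = ennreal C" "0 \<le> C"
  shows "(\<integral>\<^sup>+x. ennreal (h x) * G (norm x) \<partial>lborel)
    = (\<integral>\<^sup>+r\<in>{0<..}. ennreal (C * real (DIM('a) + p) * r powr (real (DIM('a) + p) - 1)) * G r \<partial>lborel)"
proof -
  define N where "N = DIM('a) + p"
  have N: "0 < real N" unfolding N_def by (simp add: add_pos_nonneg)
  define M1 where "M1 = distr (density lborel (\<lambda>x. ennreal (h x))) borel (norm :: 'a \<Rightarrow> real)"
  define M2 where "M2 = density lborel (\<lambda>r. ennreal (C * real N * r powr (real N - 1)) * indicator {0<..} r)"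
  have e1: "emeasure M1 {..r} = (\<integral>\<^sup>+x\<in>cball 0 r. ennreal (h x) \<partial>lborel)" for r
  proof -
    have "norm -` {..r} \<inter> space (density lborel (\<lambda>x. ennreal (h x))) = cball (0::'a) r" by auto
    then have "emeasure M1 {..r} = emeasure (density lborel (\<lambda>x. ennreal (h x))) (cball 0 r)"
      unfolding M1_def by (subst emeasure_distr) auto
    then show ?thesis by (simp add: emeasure_density)
  qed
  have e2: "emeasure M2 {..r} = ennreal (C * r ^ N)" if "0 \<le> r" for r
  proof -
    have "emeasure M2 {..r} = (\<integral>\<^sup>+x. ennreal (C * real N) * (ennreal (x powr (real N - 1)) * indicator {0..r} x) \<partial>lborel)"
      unfolding M2_def
    proof (subst emeasure_density, simp, simp, intro nn_integral_cong_AE)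
      have "AE x in lborel. x \<noteq> (0::real)" by (rule AE_lborel_singleton)
      then show "AE x in lborel. ennreal (C * real N * x powr (real N - 1)) * indicator {0<..} x * indicator {..r} x = ennreal (C * real N) * (ennreal (x powr (real N - 1)) * indicator {0..r} x)"
        by eventually_elim (use C in \<open>auto simp: indicator_def ennreal_mult'\<close>)
    qed
    also have "\<dots> = ennreal (C * real N) * ennreal (r powr real N / real N)"
      using N that nn_integral_powr_from_0[of "real N" r] by (subst nn_integral_cmult) auto
    also have "\<dots> = ennreal (C * r ^ N)"
      using N C that by (cases "r = 0") (auto simp: ennreal_mult'[symmetric] powr_realpow)
    finally show ?thesis .
  qed
  have eq: "emeasure M1 {..r} = emeasure M2 {..r}" for r
  proof -
    consider "r < 0" | "r = 0" | "0 < r" by linarith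
    then show ?thesis
    proof cases
      case 1
      have "emeasure M2 {..r} = (\<integral>\<^sup>+x. 0 \<partial>(lborel :: real measure))"
        unfolding M2_def using 1 by (subst emeasure_density, simp, simp, intro nn_integral_cong) (auto simp: indicator_def)
      then show ?thesis unfolding e1 using 1 by simp
    next
      case 2
      have "(\<integral>\<^sup>+x\<in>{0::'a}. ennreal (h x) \<partial>lborel) = (\<integral>\<^sup>+x. 0 \<partial>(lborel :: 'a measure))"
        by (intro nn_integral_cong_AE eventually_mono[OF AE_lborel_singleton[of "0::'a"]]) (auto simp: indicator_def)
      then show ?thesis using e1[of r] e2[of r] 2 N by (simp add: zero_power)
    next
      case 3
      then show ?thesis unfolding e1 using C e2[of r] homogeneous_cball[of h p r] nn hom
        by (simp add: N_def ennreal_mult'[symmetric] mult.commute)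
    qed
  qed
  have "M1 = M2"
  proof (rule measure_eqI_generator_eq[where E = "range (\<lambda>a. {..a})" and \<Omega> = UNIV and A = "\<lambda>i. {..real i}"])
    show "Int_stable (range (\<lambda>a::real. {..a}))"
      by (auto simp: Int_stable_def)
    show "sets M1 = sigma_sets UNIV (range (\<lambda>a::real. {..a}))" "sets M2 = sigma_sets UNIV (range (\<lambda>a::real. {..a}))"
      unfolding M1_def M2_def by (simp_all add: borel_eq_atMost)
    show "(\<Union>i. {..real i}) = UNIV" by (auto intro: real_arch_simple)
    show "emeasure M1 {..real i} \<noteq> \<infinity>" for i using eq[of "real i"] e2[of "real i"] by simp
  qed (use eq in auto)
  then have "(\<integral>\<^sup>+r. G r \<partial>M1) = (\<integral>\<^sup>+r. G r \<partial>M2)" by simp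
  also have "(\<integral>\<^sup>+r. G r \<partial>M1) = (\<integral>\<^sup>+x. ennreal (h x) * G (norm x) \<partial>lborel)"
    unfolding M1_def by (subst nn_integral_distr) (auto simp: nn_integral_density)
  also have "(\<integral>\<^sup>+r. G r \<partial>M2) = (\<integral>\<^sup>+r. ennreal (C * real N * r powr (real N - 1)) * G r * indicator {0<..} r \<partial>lborel)"
    unfolding M2_def by (subst nn_integral_density) (auto intro!: nn_integral_cong simp: mult_ac)
  finally show ?thesis unfolding N_def .
qed

section \<open>Gaussian integrals and moments\<close>

lemma nn_integral_gaussian_radial:
  fixes s :: real
  assumes s: "0 < s"
  shows "(\<integral>\<^sup>+r\<in>{0<..}. ennreal (r powr (2 * s - 1) * exp (- r\<^sup>2)) \<partial>lborel) = ennreal (Gamma s / 2)"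
proof -
  define f where "f t = t powr (s - 1) / exp t" for t :: real
  have hf: "(f has_integral Gamma s) {0<..}"
  proof -
    have "(f has_integral Gamma s) {0..}" unfolding f_def by (rule Gamma_integral_real[OF s])
    moreover have "{x \<in> {0..} - {0<..}. f x \<noteq> 0} = {}" "{x \<in> {0<..} - {0..}. f x \<noteq> 0} = {}"
      by (auto simp: f_def)
    ultimately show ?thesis using has_integral_spike_set_eq[of "{0..}" "{0<..}" f] by (simp only: negligible_empty simp_thms)
  qed
  have fa: "f absolutely_integrable_on {0<..}"
    using hf by (intro nonnegative_absolutely_integrable_1) (auto intro: has_integral_integrable simp: f_def)
  have img: "(\<lambda>r::real. r\<^sup>2) ` {0<..} = {0<..}"
  proof (intro equalityI subsetI)
    fix x :: real assume "x \<in> {0<..}"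
    then have "x = (sqrt x)\<^sup>2" "sqrt x \<in> {0<..}" by auto
    then show "x \<in> (\<lambda>r. r\<^sup>2) ` {0<..}" by blast
  qed auto
  have inj: "inj_on (\<lambda>r::real. r\<^sup>2) {0<..}" by (intro inj_onI) (auto simp: power2_eq_iff_nonneg)
  have "(\<lambda>x. \<bar>2 * x\<bar> * f (x\<^sup>2)) absolutely_integrable_on {0<..} \<and> integral {0<..} (\<lambda>x. \<bar>2 * x\<bar> * f (x\<^sup>2)) = Gamma s"
  proof -
    have "((\<lambda>r. r\<^sup>2) has_field_derivative 2 * x) (at x within {0<..})" for x :: real
      by (auto intro!: derivative_eq_intros)
    then show ?thesis
      using has_absolute_integral_change_of_variables_1'[of "{0<..}" "\<lambda>r. r\<^sup>2" "\<lambda>x. 2 * x" f "Gamma s"] inj img fa hf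
      by (auto simp: integral_unique)
  qed
  then have hi: "((\<lambda>x. \<bar>2 * x\<bar> * f (x\<^sup>2)) has_integral Gamma s) {0<..}"
    by (metis absolutely_integrable_on_def has_integral_integral)
  have "(\<integral>\<^sup>+x. ennreal (indicator {0<..} x * (\<bar>2 * x\<bar> * f (x\<^sup>2))) \<partial>lborel) = ennreal (Gamma s)"
    by (rule nn_integral_has_integral_lebesgue[OF _ hi]) (auto simp: f_def)
  also have "(\<integral>\<^sup>+x. ennreal (indicator {0<..} x * (\<bar>2 * x\<bar> * f (x\<^sup>2))) \<partial>lborel)
     = (\<integral>\<^sup>+x. ennreal 2 * (ennreal (x powr (2 * s - 1) * exp (- x\<^sup>2)) * indicator {0<..} x) \<partial>lborel)"
  proof (intro nn_integral_cong)
    fix x :: real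
    show "ennreal (indicator {0<..} x * (\<bar>2 * x\<bar> * f (x\<^sup>2))) = ennreal 2 * (ennreal (x powr (2 * s - 1) * exp (- x\<^sup>2)) * indicator {0<..} x)"
    proof (cases "0 < x")
      case True
      have "(x\<^sup>2) powr (s - 1) = (x powr 2) powr (s - 1)" using True by simp
      also have "\<dots> = x powr (2 * s - 2)" unfolding powr_powr by (simp add: algebra_simps)
      finally have "x * (x\<^sup>2) powr (s - 1) = x powr (2 * s - 1)" using True powr_add[of x 1 "2 * s - 2"] by simp
      then have "\<bar>2 * x\<bar> * f (x\<^sup>2) = 2 * (x powr (2 * s - 1) * exp (- x\<^sup>2))"
        unfolding f_def using True by (simp add: exp_minus divide_inverse mult.assoc[symmetric])
      then have e: "ennreal (\<bar>2 * x\<bar> * f (x\<^sup>2)) = ennreal 2 * ennreal (x powr (2 * s - 1) * exp (- x\<^sup>2))"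
        by (subst ennreal_mult'[symmetric]) simp_all
      have i: "indicator {0<..} x = (1 :: real)" "indicator {0<..} x = (1 :: ennreal)" using True by auto
      show ?thesis by (simp only: i mult_1 mult_1_right e)
    qed simp
  qed
  also have "\<dots> = ennreal 2 * (\<integral>\<^sup>+r\<in>{0<..}. ennreal (r powr (2 * s - 1) * exp (- r\<^sup>2)) \<partial>lborel)"
    by (rule nn_integral_cmult) auto
  finally have *: "ennreal 2 * (\<integral>\<^sup>+r\<in>{0<..}. ennreal (r powr (2 * s - 1) * exp (- r\<^sup>2)) \<partial>lborel) = ennreal (Gamma s)" .
  then obtain y where y: "0 \<le> y" "(\<integral>\<^sup>+r\<in>{0<..}. ennreal (r powr (2 * s - 1) * exp (- r\<^sup>2)) \<partial>lborel) = ennreal y"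
    by (cases "(\<integral>\<^sup>+r\<in>{0<..}. ennreal (r powr (2 * s - 1) * exp (- r\<^sup>2)) \<partial>lborel)") (auto simp: ennreal_mult_top)
  have "ennreal (2 * y) = ennreal (Gamma s)" using * unfolding y(2) by (simp only: ennreal_mult'[of 2] zero_le_numeral)
  then have "2 * y = Gamma s" using y Gamma_real_pos[OF s] by simp
  then show ?thesis using y by simp
qed

text \<open>This is \<open>pi powr (d/2)\<close>, kept in the form that polar coordinates produce,
  so that it cancels in \<open>radial_even_moment\<close>.\<close>

definition gauss_const :: "'a::euclidean_space itself \<Rightarrow> real" where
  "gauss_const _ = sphere_area DIM('a) * Gamma (real DIM('a) / 2) / 2"

lemma sphere_area_pos: "0 < n \<Longrightarrow> 0 < sphere_area n"
  unfolding sphere_area_def by (simp add: unit_ball_vol_def Gamma_real_pos)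

lemma gauss_const_pos: "0 < gauss_const TYPE('a::euclidean_space)"
  unfolding gauss_const_def by (simp add: sphere_area_pos Gamma_real_pos)

lemma nn_integral_radial:
  fixes G :: "real \<Rightarrow> ennreal"
  assumes [measurable]: "G \<in> borel_measurable borel"
  shows "(\<integral>\<^sup>+x. G (norm (x::'a::euclidean_space)) \<partial>lborel)
    = (\<integral>\<^sup>+r\<in>{0<..}. ennreal (sphere_area DIM('a) * r powr (real DIM('a) - 1)) * G r \<partial>lborel)"
proof -
  have "(\<integral>\<^sup>+x\<in>cball 0 1. ennreal 1 \<partial>(lborel :: 'a measure)) = ennreal (unit_ball_vol (real DIM('a)))"
    by (simp add: emeasure_cball)
  from nn_integral_homogeneous_radial[of "\<lambda>x::'a. 1" G 0, OF _ _ _ _ this]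
  show ?thesis by (simp add: sphere_area_def mult.commute)
qed

lemma nn_integral_gaussian:
  "(\<integral>\<^sup>+x. ennreal (exp (- (norm (x::'a::euclidean_space))\<^sup>2)) \<partial>lborel) = ennreal (gauss_const TYPE('a))"
proof -
  have "(\<integral>\<^sup>+x. ennreal (exp (- (norm (x::'a::euclidean_space))\<^sup>2)) \<partial>lborel)
    = (\<integral>\<^sup>+r. ennreal (sphere_area DIM('a)) * (ennreal (r powr (2 * (real DIM('a) / 2) - 1) * exp (- r\<^sup>2)) * indicator {0<..} r) \<partial>lborel)"
    by (subst nn_integral_radial, simp, intro nn_integral_cong) (auto simp: indicator_def ennreal_mult' sphere_area_pos less_imp_le mult.assoc)
  also have "\<dots> = ennreal (sphere_area DIM('a)) * ennreal (Gamma (real DIM('a) / 2) / 2)"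
    using nn_integral_gaussian_radial[of "real DIM('a) / 2"] by (subst nn_integral_cmult) auto
  finally show ?thesis unfolding gauss_const_def by (simp add: ennreal_mult'[symmetric] sphere_area_pos less_imp_le)
qed

text \<open>Completing the square: translation by \<open>s *\<^sub>R \<xi>\<close> splits off the
  factor.\<close>

lemma nn_integral_gaussian_exp:
  fixes \<xi> :: "'a::euclidean_space"
  shows "(\<integral>\<^sup>+x. ennreal (exp (2 * s * (x \<bullet> \<xi>)) * exp (- (norm x)\<^sup>2)) \<partial>lborel) = ennreal (exp (s\<^sup>2 * (norm \<xi>)\<^sup>2) * gauss_const TYPE('a))"
proof -
  have "(\<integral>\<^sup>+x. ennreal (exp (2 * s * (x \<bullet> \<xi>)) * exp (- (norm x)\<^sup>2)) \<partial>lborel)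
     = (\<integral>\<^sup>+x. ennreal (exp (2 * s * ((s *\<^sub>R \<xi> + 1 *\<^sub>R x) \<bullet> \<xi>)) * exp (- (norm (s *\<^sub>R \<xi> + 1 *\<^sub>R x))\<^sup>2)) \<partial>lborel)"
    by (subst nn_integral_lborel_affine[of _ 1 "s *\<^sub>R \<xi>"]) auto
  also have "\<dots> = (\<integral>\<^sup>+x. ennreal (exp (s\<^sup>2 * (norm \<xi>)\<^sup>2)) * ennreal (exp (- (norm (x::'a))\<^sup>2)) \<partial>lborel)"
  proof (intro nn_integral_cong)
    fix x :: 'a
    have "2 * s * ((s *\<^sub>R \<xi> + 1 *\<^sub>R x) \<bullet> \<xi>) - (norm (s *\<^sub>R \<xi> + 1 *\<^sub>R x))\<^sup>2 = s\<^sup>2 * (norm \<xi>)\<^sup>2 - (norm x)\<^sup>2"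
      unfolding power2_norm_eq_inner by (simp add: inner_add_left inner_add_right inner_commute algebra_simps power2_eq_square)
    then show "ennreal (exp (2 * s * ((s *\<^sub>R \<xi> + 1 *\<^sub>R x) \<bullet> \<xi>)) * exp (- (norm (s *\<^sub>R \<xi> + 1 *\<^sub>R x))\<^sup>2)) = ennreal (exp (s\<^sup>2 * (norm \<xi>)\<^sup>2)) * ennreal (exp (- (norm x)\<^sup>2))"
      by (simp add: ennreal_mult'[symmetric] exp_add[symmetric])
  qed
  also have "\<dots> = ennreal (exp (s\<^sup>2 * (norm \<xi>)\<^sup>2)) * ennreal (gauss_const TYPE('a))"
    by (subst nn_integral_cmult) (auto simp: nn_integral_gaussian)
  finally show ?thesis by (simp add: ennreal_mult')
qed

lemma cosh_paired: "(\<lambda>k. x ^ (2 * k) / fact (2 * k)) sums cosh (x :: real)"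
proof -
  have "(\<lambda>k. if even (2 * k) then x ^ (2 * k) /\<^sub>R fact (2 * k) else 0) sums cosh x"
  proof (subst sums_mono_reindex[of "\<lambda>k. 2 * k"])
    show "strict_mono (\<lambda>k::nat. 2 * k)" by (simp add: strict_mono_def)
    show "(if even n then x ^ n /\<^sub>R fact n else 0) = 0" if "n \<notin> range (\<lambda>k. 2 * k)" for n
      using that by (auto elim!: evenE)
  qed (rule cosh_converges)
  then show ?thesis by (simp add: divide_inverse mult.commute)
qed

lemma sums_of_suminf_ennreal:
  fixes f :: "nat \<Rightarrow> real"
  assumes "(\<Sum>k. ennreal (f k)) = ennreal L" "\<And>k. 0 \<le> f k" "0 \<le> L"
  shows "f sums L"
proof -
  have sm: "summable f" by (rule summable_suminf_not_top) (use assms in auto)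
  have "ennreal (\<Sum>k. f k) = ennreal L" using suminf_ennreal2[OF assms(2) sm] assms(1) by simp
  then have "(\<Sum>k. f k) = L" by (subst (asm) ennreal_inj) (use assms(2,3) suminf_nonneg[OF sm] in auto)
  then show ?thesis using sm by (simp add: sums_iff)
qed

text \<open>The moments are read off from a generating function: the series of
  \<open>cosh (2 * s * (x \<bullet> \<xi>))\<close>, integrated term by term since its terms are
  nonnegative, must reproduce the exponential series in \<open>t = s\<^sup>2\<close>.\<close>

lemma gaussian_even_moment:
  fixes \<xi> :: "'a::euclidean_space"
  shows "(\<integral>\<^sup>+x. ennreal ((x \<bullet> \<xi>) ^ (2 * k) * exp (- (norm x)\<^sup>2)) \<partial>lborel)
    = ennreal (gauss_const TYPE('a) * (norm \<xi>) ^ (2 * k) * fact (2 * k) / (4 ^ k * fact k))"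
proof -
  define I where "I = gauss_const TYPE('a)"
  have I: "0 < I" unfolding I_def by (rule gauss_const_pos)
  define m where "m k = (\<integral>\<^sup>+x. ennreal ((x \<bullet> \<xi>) ^ (2 * k) * exp (- (norm x)\<^sup>2)) \<partial>lborel)" for k
  have ser: "(\<Sum>k. ennreal (4 ^ k * t ^ k / fact (2 * k)) * m k) = ennreal (exp (t * (norm \<xi>)\<^sup>2) * I)" if t: "0 \<le> t" for t
  proof -
    define s where "s = sqrt t"
    have s: "s\<^sup>2 = t" unfolding s_def using t by simp
    have "(\<Sum>k. ennreal (4 ^ k * t ^ k / fact (2 * k)) * m k)
      = (\<integral>\<^sup>+x. (\<Sum>k. ennreal ((2 * s * (x \<bullet> \<xi>)) ^ (2 * k) / fact (2 * k)) * ennreal (exp (- (norm x)\<^sup>2))) \<partial>lborel)"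
    proof (subst nn_integral_suminf)
      show "(\<Sum>k. ennreal (4 ^ k * t ^ k / fact (2 * k)) * m k) = (\<Sum>k. (\<integral>\<^sup>+x. ennreal ((2 * s * (x \<bullet> \<xi>)) ^ (2 * k) / fact (2 * k)) * ennreal (exp (- (norm x)\<^sup>2)) \<partial>lborel))"
      proof (rule suminf_cong)
        fix k
        have "(\<integral>\<^sup>+x. ennreal ((2 * s * (x \<bullet> \<xi>)) ^ (2 * k) / fact (2 * k)) * ennreal (exp (- (norm x)\<^sup>2)) \<partial>lborel)
          = (\<integral>\<^sup>+x. ennreal (4 ^ k * t ^ k / fact (2 * k)) * ennreal ((x \<bullet> \<xi>) ^ (2 * k) * exp (- (norm x)\<^sup>2)) \<partial>lborel)"
        proof (intro nn_integral_cong)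
          fix x :: 'a
          have "(2 * s * (x \<bullet> \<xi>)) ^ (2 * k) = 4 ^ k * t ^ k * (x \<bullet> \<xi>) ^ (2 * k)"
            by (simp add: power_mult_distrib power_mult s)
          then show "ennreal ((2 * s * (x \<bullet> \<xi>)) ^ (2 * k) / fact (2 * k)) * ennreal (exp (- (norm x)\<^sup>2)) = ennreal (4 ^ k * t ^ k / fact (2 * k)) * ennreal ((x \<bullet> \<xi>) ^ (2 * k) * exp (- (norm x)\<^sup>2))"
            using t by (simp add: ennreal_mult'[symmetric] ennreal_mult''[symmetric] mult_ac)
        qed
        also have "\<dots> = ennreal (4 ^ k * t ^ k / fact (2 * k)) * m k" unfolding m_def by (rule nn_integral_cmult) auto
        finally show "ennreal (4 ^ k * t ^ k / fact (2 * k)) * m k = (\<integral>\<^sup>+x. ennreal ((2 * s * (x \<bullet> \<xi>)) ^ (2 * k) / fact (2 * k)) * ennreal (exp (- (norm x)\<^sup>2)) \<partial>lborel)" by simp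
      qed
    qed auto
    also have "\<dots> = (\<integral>\<^sup>+x. ennreal (1/2) * (ennreal (exp (2 * s * (x \<bullet> \<xi>)) * exp (- (norm x)\<^sup>2)) + ennreal (exp (2 * (-s) * (x \<bullet> \<xi>)) * exp (- (norm x)\<^sup>2))) \<partial>lborel)"
    proof (intro nn_integral_cong)
      fix x :: 'a
      have "(\<Sum>k. ennreal ((2 * s * (x \<bullet> \<xi>)) ^ (2 * k) / fact (2 * k))) = ennreal (cosh (2 * s * (x \<bullet> \<xi>)))"
        using cosh_paired[of "2 * s * (x \<bullet> \<xi>)"] by (intro suminf_ennreal_eq) auto
      then have "(\<Sum>k. ennreal ((2 * s * (x \<bullet> \<xi>)) ^ (2 * k) / fact (2 * k)) * ennreal (exp (- (norm x)\<^sup>2))) = ennreal (cosh (2 * s * (x \<bullet> \<xi>)) * exp (- (norm x)\<^sup>2))"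
        by (simp add: ennreal_mult'')
      also have "\<dots> = ennreal (1/2) * (ennreal (exp (2 * s * (x \<bullet> \<xi>)) * exp (- (norm x)\<^sup>2)) + ennreal (exp (2 * (-s) * (x \<bullet> \<xi>)) * exp (- (norm x)\<^sup>2)))"
      proof -
        define A B where "A = exp (2 * s * (x \<bullet> \<xi>)) * exp (- (norm x)\<^sup>2)" and "B = exp (2 * (-s) * (x \<bullet> \<xi>)) * exp (- (norm x)\<^sup>2)"
        have AB: "0 \<le> A" "0 \<le> B" unfolding A_def B_def by auto
        have "cosh (2 * s * (x \<bullet> \<xi>)) * exp (- (norm x)\<^sup>2) = 1/2 * (A + B)"
          unfolding A_def B_def cosh_def by (simp add: algebra_simps)
        then show ?thesis unfolding A_def[symmetric] B_def[symmetric] using AB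
          by (simp only: ennreal_mult add_nonneg_nonneg ennreal_plus)
      qed
      finally show "(\<Sum>k. ennreal ((2 * s * (x \<bullet> \<xi>)) ^ (2 * k) / fact (2 * k)) * ennreal (exp (- (norm x)\<^sup>2))) = ennreal (1/2) * (ennreal (exp (2 * s * (x \<bullet> \<xi>)) * exp (- (norm x)\<^sup>2)) + ennreal (exp (2 * (-s) * (x \<bullet> \<xi>)) * exp (- (norm x)\<^sup>2)))" .
    qed
    also have "\<dots> = ennreal (1/2) * (ennreal (exp (s\<^sup>2 * (norm \<xi>)\<^sup>2) * I) + ennreal (exp ((-s)\<^sup>2 * (norm \<xi>)\<^sup>2) * I))"
      unfolding I_def
      by (subst nn_integral_cmult, simp, subst nn_integral_add, simp, simp) (simp only: nn_integral_gaussian_exp)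
    also have "\<dots> = ennreal (exp (t * (norm \<xi>)\<^sup>2) * I)"
    proof -
      define A where "A = exp (t * (norm \<xi>)\<^sup>2) * I"
      have "0 \<le> A" unfolding A_def using I by simp
      then have "ennreal (1/2) * (ennreal A + ennreal A) = ennreal (1/2 * (A + A))"
        by (simp only: ennreal_mult add_nonneg_nonneg ennreal_plus)
      then show ?thesis unfolding A_def by (simp add: s mult.commute)
    qed
    finally show ?thesis .
  qed
  have fin: "m k < \<infinity>" for k
  proof -
    have "ennreal (4 ^ k * 1 ^ k / fact (2 * k)) * m k \<le> (\<Sum>k. ennreal (4 ^ k * 1 ^ k / fact (2 * k)) * m k)"
      using sum_le_suminf[of "\<lambda>k. ennreal (4 ^ k * 1 ^ k / fact (2 * k)) * m k" "{k}"] by simp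
    also have "\<dots> < \<infinity>" unfolding ser[OF zero_le_one] by simp
    finally have "ennreal (4 ^ k * 1 ^ k / fact (2 * k)) * m k < \<infinity>" .
    moreover have "0 < (4 ^ k * 1 ^ k / fact (2 * k) :: real)" by simp
    ultimately show ?thesis using ennreal_eq_0_iff[of "4 ^ k * 1 ^ k / fact (2 * k)"] by (auto simp only: ennreal_mult_less_top infinity_ennreal_def ennreal_zero_less_top)
  qed
  define a where "a k = enn2real (m k)" for k
  have a: "m k = ennreal (a k)" "0 \<le> a k" for k unfolding a_def using fin[of k] by auto
  have "a k * (4 ^ k / fact (2 * k)) - I * (norm \<xi>) ^ (2 * k) / fact k = 0" for k
  proof (rule powser_zero_nonneg[where a = "\<lambda>k. a k * (4 ^ k / fact (2 * k)) - I * (norm \<xi>) ^ (2 * k) / fact k"])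
    fix t :: real assume t: "0 \<le> t"
    have "(\<Sum>k. ennreal (a k * (4 ^ k / fact (2 * k)) * t ^ k)) = ennreal (exp (t * (norm \<xi>)\<^sup>2) * I)"
      unfolding ser[OF t, symmetric] a using t a(2) by (intro suminf_cong) (simp add: ennreal_mult'[symmetric] mult_ac)
    then have s1: "(\<lambda>k. a k * (4 ^ k / fact (2 * k)) * t ^ k) sums (exp (t * (norm \<xi>)\<^sup>2) * I)"
      using t a(2) I by (intro sums_of_suminf_ennreal) auto
    have "(\<lambda>k. I * ((t * (norm \<xi>)\<^sup>2) ^ k /\<^sub>R fact k)) sums (I * exp (t * (norm \<xi>)\<^sup>2))"
      by (intro sums_mult exp_converges)
    moreover have "I * ((t * (norm \<xi>)\<^sup>2) ^ k /\<^sub>R fact k) = I * (norm \<xi>) ^ (2 * k) / fact k * t ^ k" for k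
      by (simp only: power_mult power_mult_distrib real_scaleR_def) (simp add: field_simps)
    ultimately have s2: "(\<lambda>k. I * (norm \<xi>) ^ (2 * k) / fact k * t ^ k) sums (I * exp (t * (norm \<xi>)\<^sup>2))"
      by (simp only:)
    show "(\<lambda>k. (a k * (4 ^ k / fact (2 * k)) - I * norm \<xi> ^ (2 * k) / fact k) * t ^ k) sums 0"
      using sums_diff[OF s1 s2] unfolding mult.commute[of _ I] diff_self left_diff_distrib[symmetric] .
  qed
  then have "a k * (4 ^ k / fact (2 * k)) = I * (norm \<xi>) ^ (2 * k) / fact k" by simp
  then have "a k * 4 ^ k = I * (norm \<xi>) ^ (2 * k) / fact k * fact (2 * k)" by (simp add: divide_eq_eq)
  then have "a k = I * (norm \<xi>) ^ (2 * k) * fact (2 * k) / (4 ^ k * fact k)" by (simp add: eq_divide_eq)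
  then show ?thesis using a(1)[of k] unfolding m_def I_def by simp
qed

text \<open>The cosine series may be integrated term by term because the moments divided by
  \<open>fact (2 * k)\<close> are summable. Nonnegativity is asked off the origin, since profiles
  are controlled for positive radius only.\<close>

lemma cos_transform:
  fixes \<phi> :: "'a::euclidean_space \<Rightarrow> real"
  assumes [measurable]: "\<phi> \<in> borel_measurable borel" and nn: "\<And>x. x \<noteq> 0 \<Longrightarrow> 0 \<le> \<phi> x"
    and mm: "\<And>k. (\<integral>\<^sup>+x. ennreal ((x \<bullet> \<xi>) ^ (2 * k) * \<phi> x) \<partial>lborel) = ennreal (M k)" "\<And>k. 0 \<le> M k"
    and sm: "summable (\<lambda>k. M k / fact (2 * k))"
  shows "(\<lambda>k. (-1) ^ k * M k / fact (2 * k)) sums (LINT x|lborel. cos (x \<bullet> \<xi>) * \<phi> x)"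
proof -
  have ae: "AE x in lborel. 0 \<le> (x \<bullet> \<xi>) ^ (2 * k) * \<phi> x" for k
    using AE_lborel_singleton[of "0::'a"] by eventually_elim (use nn in auto)
  have i: "integrable lborel (\<lambda>x. (x \<bullet> \<xi>) ^ (2 * k) * \<phi> x)" "(LINT x|lborel. (x \<bullet> \<xi>) ^ (2 * k) * \<phi> x) = M k" for k
  proof -
    have "(\<integral>\<^sup>+x. ennreal (norm ((x \<bullet> \<xi>) ^ (2 * k) * \<phi> x)) \<partial>lborel) = (\<integral>\<^sup>+x. ennreal ((x \<bullet> \<xi>) ^ (2 * k) * \<phi> x) \<partial>lborel)"
      using ae[of k] by (intro nn_integral_cong_AE) (auto simp del: norm_mult)
    then show "integrable lborel (\<lambda>x. (x \<bullet> \<xi>) ^ (2 * k) * \<phi> x)"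
      using mm by (intro integrableI_bounded) auto
    show "(LINT x|lborel. (x \<bullet> \<xi>) ^ (2 * k) * \<phi> x) = M k"
      using mm ae[of k] by (subst integral_eq_nn_integral) auto
  qed
  define F where "F k x = (-1) ^ k / fact (2 * k) * (x \<bullet> \<xi>) ^ (2 * k) * \<phi> x" for k x
  have F: "F k x = ((-1) ^ k / fact (2 * k)) * ((x \<bullet> \<xi>) ^ (2 * k) * \<phi> x)" for k x unfolding F_def by simp
  have Fn: "norm (F k x) = (x \<bullet> \<xi>) ^ (2 * k) / fact (2 * k) * \<bar>\<phi> x\<bar>" for k x
    unfolding F_def by (simp add: abs_mult power_abs power_even_abs)
  have Fi: "integrable lborel (F k)" for k unfolding F using i(1) by simp
  have sF: "(\<lambda>k. F k x) sums (cos (x \<bullet> \<xi>) * \<phi> x)" for x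
    unfolding F_def by (intro sums_mult2 cos_paired)
  have "(\<lambda>k. integral\<^sup>L lborel (F k)) sums (LINT x|lborel. (\<Sum>k. F k x))"
  proof (rule sums_integral)
    show "AE x in lborel. summable (\<lambda>k. norm (F k x))"
      unfolding Fn using cosh_paired by (intro AE_I2 summable_mult2) (auto simp: sums_iff)
    have "(LINT x|lborel. norm (F k x)) = M k / fact (2 * k)" for k
    proof -
      have "(LINT x|lborel. norm (F k x)) = (LINT x|lborel. (1 / fact (2 * k)) * ((x \<bullet> \<xi>) ^ (2 * k) * \<phi> x))"
        unfolding Fn using AE_lborel_singleton[of "0::'a"]
        by (intro integral_cong_AE) (auto elim!: eventually_mono simp: nn)
      then show ?thesis using i(2) by simp
    qed
    then show "summable (\<lambda>k. LINT x|lborel. norm (F k x))" using sm by simp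
  qed (rule Fi)
  moreover have "(\<Sum>k. F k x) = cos (x \<bullet> \<xi>) * \<phi> x" for x using sF by (simp add: sums_iff)
  moreover have "integral\<^sup>L lborel (F k) = (-1) ^ k * M k / fact (2 * k)" for k
    unfolding F using i(2) by simp
  ultimately show ?thesis by simp
qed

lemma gaussian_cos_transform:
  fixes \<xi> :: "'a::euclidean_space"
  shows "(LINT x|lborel. cos (x \<bullet> \<xi>) * exp (- (norm x)\<^sup>2)) = gauss_const TYPE('a) * exp (- (norm \<xi>)\<^sup>2 / 4)"
proof -
  define I where "I = gauss_const TYPE('a)"
  have I: "0 < I" unfolding I_def by (rule gauss_const_pos)
  define M where "M k = I * (norm \<xi>) ^ (2 * k) * fact (2 * k) / (4 ^ k * fact k)" for k
  have Me: "c ^ k * M k / fact (2 * k) = I * ((c * (norm \<xi>)\<^sup>2 / 4) ^ k /\<^sub>R fact k)" for c :: real and k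
  proof -
    have "(c * (norm \<xi>)\<^sup>2 / 4) ^ k = c ^ k * norm \<xi> ^ (2 * k) / 4 ^ k"
      by (simp only: power_divide power_mult_distrib power_mult)
    then show ?thesis unfolding M_def real_scaleR_def by (simp only:) (simp add: field_simps)
  qed
  \<comment> \<open>\<open>c = 1\<close> yields the summability, \<open>c = -1\<close> the
    value.\<close>
  have s: "(\<lambda>k. c ^ k * M k / fact (2 * k)) sums (I * exp (c * (norm \<xi>)\<^sup>2 / 4))" for c :: real
    unfolding Me by (intro sums_mult exp_converges)
  have "(\<lambda>k. (-1) ^ k * M k / fact (2 * k)) sums (LINT x|lborel. cos (x \<bullet> \<xi>) * exp (- (norm x)\<^sup>2))"
  proof (rule cos_transform)
    show "summable (\<lambda>k. M k / fact (2 * k))" using s[of 1] by (simp add: sums_iff)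
    show "0 \<le> M k" for k unfolding M_def using I by simp
    show "(\<integral>\<^sup>+x. ennreal ((x \<bullet> \<xi>) ^ (2 * k) * exp (- (norm x)\<^sup>2)) \<partial>lborel) = ennreal (M k)" for k
      unfolding M_def I_def by (rule gaussian_even_moment)
  qed auto
  from sums_unique2[OF this s[of "-1"]] show ?thesis unfolding I_def by simp
qed

subsection \<open>Uniqueness for the linear equation and the limit\<close>

lemma fourier_eq:
  fixes f :: "'a::euclidean_space \<Rightarrow> real"
  assumes f: "integrable lborel f"
  shows "fourier (\<lambda>x. complex_of_real (f x)) \<xi>
    = Complex (LINT x|lborel. f x * cos (x \<bullet> \<xi>)) (- (LINT x|lborel. f x * sin (x \<bullet> \<xi>)))"
proof -
  have [measurable]: "f \<in> borel_measurable borel" using f by (auto dest: borel_measurable_integrable)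
  define F where "F x = complex_of_real (f x) * exp (- \<i> * complex_of_real (x \<bullet> \<xi>))" for x
  have "- \<i> * complex_of_real t = \<i> * complex_of_real (- t)" for t by simp
  then have Fc: "F x = complex_of_real (f x) * cis (- (x \<bullet> \<xi>))" for x unfolding F_def cis_conv_exp by metis
  have Fi: "integrable lborel F"
  proof (rule Bochner_Integration.integrable_bound[OF f])
    show "F \<in> borel_measurable lborel" unfolding F_def by measurable
    show "AE x in lborel. norm (F x) \<le> norm (f x)" unfolding Fc by (simp add: norm_mult)
  qed
  have "fourier (\<lambda>x. complex_of_real (f x)) \<xi> = integral\<^sup>L lborel F"
    unfolding fourier_def F_def ..
  moreover have "Re (integral\<^sup>L lborel F) = (LINT x|lborel. f x * cos (x \<bullet> \<xi>))"
    using integral_Re[OF Fi] unfolding Fc by simp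
  moreover have "Im (integral\<^sup>L lborel F) = (LINT x|lborel. - (f x * sin (x \<bullet> \<xi>)))"
    using integral_Im[OF Fi] unfolding Fc by simp
  ultimately show ?thesis by (simp add: complex_eq_iff)
qed

lemma integrable_mult_bounded:
  fixes f h :: "'a::euclidean_space \<Rightarrow> real"
  assumes f: "integrable lborel f" and [measurable]: "h \<in> borel_measurable borel" and h: "\<And>x. \<bar>h x\<bar> \<le> B"
  shows "integrable lborel (\<lambda>x. f x * h x)"
proof (rule Bochner_Integration.integrable_bound)
  show "integrable lborel (\<lambda>x. B * f x)" using f by simp
  have [measurable]: "f \<in> borel_measurable borel" using f by (auto dest: borel_measurable_integrable)
  show "(\<lambda>x. f x * h x) \<in> borel_measurable lborel" by simp
  show "AE x in lborel. norm (f x * h x) \<le> norm (B * f x)"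
  proof (rule AE_I2)
    fix x
    have "0 \<le> B" using h[of x] by (meson abs_ge_zero order_trans)
    then show "norm (f x * h x) \<le> norm (B * f x)"
      using mult_right_mono[OF h[of x], of "\<bar>f x\<bar>"] by (simp add: abs_mult mult.commute)
  qed
qed

lemma fourier_zero_cos:
  fixes g :: "'a::euclidean_space \<Rightarrow> real"
  assumes g: "integrable lborel g" and z: "\<And>\<xi>. fourier (\<lambda>x. complex_of_real (g x)) \<xi> = 0"
  shows "(LINT y|lborel. g y * cos (y \<bullet> w + a)) = 0"
proof -
  have c: "(LINT x|lborel. g x * cos (x \<bullet> w)) = 0" and s: "(LINT x|lborel. g x * sin (x \<bullet> w)) = 0"
    using z[of w] unfolding fourier_eq[OF g] by (auto simp: complex_eq_iff)
  have ic: "integrable lborel (\<lambda>y. g y * cos (y \<bullet> w))" by (rule integrable_mult_bounded[OF g, of _ 1]) auto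
  have isn: "integrable lborel (\<lambda>y. g y * sin (y \<bullet> w))" by (rule integrable_mult_bounded[OF g, of _ 1]) auto
  have "(LINT y|lborel. g y * cos (y \<bullet> w + a)) = (LINT y|lborel. cos a * (g y * cos (y \<bullet> w)) - sin a * (g y * sin (y \<bullet> w)))"
    by (intro Bochner_Integration.integral_cong) (auto simp: cos_add algebra_simps)
  also have "\<dots> = cos a * (LINT y|lborel. g y * cos (y \<bullet> w)) - sin a * (LINT y|lborel. g y * sin (y \<bullet> w))"
    using ic isn by simp
  finally show ?thesis using c s by simp
qed

lemma integrable_gaussian: "integrable lborel (\<lambda>x::'a::euclidean_space. exp (- (norm x)\<^sup>2))"
  using nn_integral_gaussian[where 'a = 'a] by (intro integrableI_bounded) auto

text \<open>The Gaussian is its own Fourier transform up to scaling, so by Fubini a function with vanishing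
  transform is orthogonal to all Gaussians.\<close>

lemma fourier_zero_gaussian:
  fixes g :: "'a::euclidean_space \<Rightarrow> real"
  assumes g: "integrable lborel g" and z: "\<And>\<xi>. fourier (\<lambda>x. complex_of_real (g x)) \<xi> = 0" and t: "0 \<le> t"
  shows "(LINT y|lborel. g y * exp (- t * (norm (x - y))\<^sup>2)) = 0"
proof -
  have [measurable]: "g \<in> borel_measurable borel" using g by (auto dest: borel_measurable_integrable)
  define I where "I = gauss_const TYPE('a)"
  have I: "0 < I" unfolding I_def by (rule gauss_const_pos)
  \<comment> \<open>With this factor the Gaussian \<open>exp (- t * (norm (x - y))\<^sup>2)\<close>
    is the transform evaluated at \<open>r *\<^sub>R (x - y)\<close>.\<close>
  define r where "r = 2 * sqrt t"
  have e: "I * exp (- t * (norm (x - y))\<^sup>2) = (LINT w|lborel. cos (w \<bullet> (r *\<^sub>R (x - y))) * exp (- (norm w)\<^sup>2))" for y :: 'a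
  proof -
    have "(norm (r *\<^sub>R (x - y)))\<^sup>2 / 4 = t * (norm (x - y))\<^sup>2"
      unfolding r_def using t by (simp add: power_mult_distrib)
    then show ?thesis unfolding gaussian_cos_transform I_def by simp
  qed
  define f where "f w y = g y * (cos (w \<bullet> (r *\<^sub>R (x - y))) * exp (- (norm w)\<^sup>2))" for w y :: 'a
  have fi: "integrable (lborel \<Otimes>\<^sub>M lborel) (case_prod f)"
  proof (rule Bochner_Integration.integrable_bound)
    show "integrable (lborel \<Otimes>\<^sub>M lborel) (\<lambda>(w, y). exp (- (norm (w::'a))\<^sup>2) * g y)"
    proof (rule lborel_pair.Fubini_integrable)
      have "integrable lborel (\<lambda>w::'a. exp (- (norm w)\<^sup>2) * (LINT y|lborel. \<bar>g y\<bar>))"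
        using integrable_gaussian by (rule integrable_mult_left)
      then show "integrable lborel (\<lambda>w::'a. LINT y|lborel. norm (case (w, y) of (w, y) \<Rightarrow> exp (- (norm w)\<^sup>2) * g y))"
        by (simp add: abs_mult)
      show "AE w in lborel. integrable lborel (\<lambda>y. case (w::'a, y) of (w, y) \<Rightarrow> exp (- (norm w)\<^sup>2) * g y)"
        using g by (intro AE_I2) simp
    qed measurable
    show "case_prod f \<in> borel_measurable (lborel \<Otimes>\<^sub>M lborel)" unfolding f_def by measurable
    show "AE p in lborel \<Otimes>\<^sub>M lborel. norm (case p of (w, y) \<Rightarrow> f w y) \<le> norm (case p of (w, y) \<Rightarrow> exp (- (norm w)\<^sup>2) * g y)"
    proof (rule AE_I2)
      fix p :: "'a \<times> 'a"
      obtain w y where p: "p = (w, y)" by (cases p)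
      have "\<bar>g y\<bar> * (\<bar>cos (w \<bullet> (r *\<^sub>R (x - y)))\<bar> * exp (- (norm w)\<^sup>2)) \<le> \<bar>g y\<bar> * (1 * exp (- (norm w)\<^sup>2))"
        by (intro mult_left_mono mult_right_mono abs_cos_le_one) auto
      then show "norm (case p of (w, y) \<Rightarrow> f w y) \<le> norm (case p of (w, y) \<Rightarrow> exp (- (norm w)\<^sup>2) * g y)"
        unfolding p f_def by (simp add: abs_mult mult.commute)
    qed
  qed
  have "I * (LINT y|lborel. g y * exp (- t * (norm (x - y))\<^sup>2)) = (LINT y|lborel. g y * (I * exp (- t * (norm (x - y))\<^sup>2)))"
    by (subst integral_mult_right_zero[symmetric]) (simp add: mult_ac)
  also have "\<dots> = (LINT y|lborel. (LINT w|lborel. f w y))"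
    unfolding e f_def by simp
  also have "\<dots> = (LINT w|lborel. (LINT y|lborel. f w y))"
    using fi by (rule lborel_pair.Fubini_integral)
  also have "\<dots> = 0"
  proof -
    have "f w y = exp (- (norm w)\<^sup>2) * (g y * cos (y \<bullet> ((- r) *\<^sub>R w) + r * (w \<bullet> x)))" for w y
      unfolding f_def by (simp add: inner_diff_right inner_commute algebra_simps)
    then have "(LINT y|lborel. f w y) = 0" for w
      by (simp only: integral_mult_right_zero fourier_zero_cos[OF g z] mult_zero_right)
    then show ?thesis by simp
  qed
  finally show ?thesis using I by simp
qed

text \<open>Let \<open>E\<close> be the Gaussian centred at \<open>x\<close>. Its powers
  \<open>E y ^ i\<close> are Gaussians with parameter \<open>t = i\<close>, including the constant
  for \<open>i = 0\<close>, so every polynomial in \<open>E\<close> is orthogonal to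
  \<open>g\<close>. By the Weierstrass theorem this extends to a bump \<open>\<phi> (E y)\<close>
  supported near \<open>x\<close>, where a positive value \<open>g x\<close> would give a positive
  integral.\<close>

lemma fourier_zero_continuous:
  fixes g :: "'a::euclidean_space \<Rightarrow> real"
  assumes g: "integrable lborel g" and z: "\<And>\<xi>. fourier (\<lambda>x. complex_of_real (g x)) \<xi> = 0" and c: "isCont g x"
  shows "g x \<le> 0"
proof (rule ccontr)
  assume "\<not> g x \<le> 0"
  then have gx: "0 < g x" by simp
  have [measurable]: "g \<in> borel_measurable borel" using g by (auto dest: borel_measurable_integrable)
  obtain r where r: "0 < r" "\<And>y. dist y x < r \<Longrightarrow> g x / 2 < g y"
  proof -
    have "\<forall>\<^sub>F y in at x. g x / 2 < g y" using c gx unfolding isCont_def by (intro order_tendstoD(1)) auto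
    then obtain r where "0 < r" "\<And>y. y \<noteq> x \<Longrightarrow> dist y x < r \<Longrightarrow> g x / 2 < g y" unfolding eventually_at by blast
    then have "g x / 2 < g y" if "dist y x < r" for y using that gx by (cases "y = x") auto
    with \<open>0 < r\<close> show ?thesis using that by blast
  qed
  define E where "E y = exp (- (norm (x - y))\<^sup>2)" for y
  have E: "0 \<le> E y" "E y \<le> 1" for y unfolding E_def by auto
  have [measurable]: "E \<in> borel_measurable borel" unfolding E_def by measurable
  \<comment> \<open>\<open>E y > exp (- r\<^sup>2)\<close> means that \<open>y\<close> is closer
    than \<open>r\<close> to \<open>x\<close>; so \<open>\<phi> (E y)\<close> is a nonnegative bump
    living on the ball where \<open>g\<close> exceeds \<open>g x / 2\<close>.\<close>
  define \<phi> where "\<phi> s = max 0 (s - exp (- r\<^sup>2))" for s :: real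
  define J where "J = (LINT y|lborel. g y * \<phi> (E y))"
  have \<phi>b: "\<bar>\<phi> (E y)\<bar> \<le> 1" for y
  proof -
    have "0 \<le> \<phi> (E y)" unfolding \<phi>_def by simp
    moreover have "\<phi> (E y) \<le> 1" unfolding \<phi>_def using E[of y] exp_ge_zero[of "- r\<^sup>2"] by (intro max.boundedI) linarith+
    ultimately show ?thesis by simp
  qed
  have \<phi>i: "integrable lborel (\<lambda>y. g y * \<phi> (E y))"
    by (rule integrable_mult_bounded[OF g _ \<phi>b]) (simp add: \<phi>_def)
  have "0 < J"
  proof -
    define \<kappa> where "\<kappa> = g x / 2 * (exp (- (r/2)\<^sup>2) - exp (- r\<^sup>2))"
    have "(r/2)\<^sup>2 < r\<^sup>2" using r by (intro power_strict_mono) auto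
    then have k: "0 < \<kappa>" unfolding \<kappa>_def using gx by simp
    have "0 < \<kappa> * measure lborel (ball x (r/2))" using k r by simp
    also have "\<dots> = (LINT y|lborel. \<kappa> * indicator (ball x (r/2)) y)" by simp
    also have "\<dots> \<le> J"
      unfolding J_def
    proof (rule integral_mono[OF _ \<phi>i])
      have "integrable lborel (indicator (ball x (r/2)) :: 'a \<Rightarrow> real)"
        by (rule integrable_real_indicator) (use r in \<open>auto simp: emeasure_ball\<close>)
      then show "integrable lborel (\<lambda>y. \<kappa> * indicator (ball x (r/2)) y)" by simp
      fix y
      show "\<kappa> * indicator (ball x (r/2)) y \<le> g y * \<phi> (E y)"
      proof (cases "dist y x < r")
        case True
        have 1: "0 \<le> g y * \<phi> (E y)" using r(2)[OF True] gx unfolding \<phi>_def by simp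
        show ?thesis
        proof (cases "dist x y < r / 2")
          case T: True
          have "(norm (x - y))\<^sup>2 \<le> (r/2)\<^sup>2" using T by (intro power_mono) (auto simp: dist_norm)
          then have "exp (- (r/2)\<^sup>2) \<le> exp (- (norm (x - y))\<^sup>2)" by (subst exp_le_cancel_iff) simp
          then have "exp (- (r/2)\<^sup>2) - exp (- r\<^sup>2) \<le> \<phi> (E y)" unfolding \<phi>_def E_def by (intro max.coboundedI2) simp
          moreover have "g x / 2 \<le> g y" "0 \<le> g y" using r(2)[OF True] gx by linarith+
          moreover have "0 \<le> exp (- (r/2)\<^sup>2) - exp (- r\<^sup>2)" using \<open>(r/2)\<^sup>2 < r\<^sup>2\<close> by simp
          ultimately have "\<kappa> \<le> g y * \<phi> (E y)" unfolding \<kappa>_def by (intro mult_mono)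
          then show ?thesis using T by simp
        qed (use 1 in simp)
      next
        case False
        then have "r \<le> norm (x - y)" by (simp add: dist_norm norm_minus_commute)
        then have "r\<^sup>2 \<le> (norm (x - y))\<^sup>2" using r by (intro power_mono) auto
        then have "\<phi> (E y) = 0" unfolding \<phi>_def E_def by simp
        then show ?thesis using False r by (simp add: indicator_def dist_commute)
      qed
    qed
    finally show ?thesis .
  qed
  define L where "L = (LINT y|lborel. \<bar>g y\<bar>)"
  have L0: "0 \<le> L" unfolding L_def by simp
  \<comment> \<open>Small enough that the approximation error, at most
    \<open>\<epsilon> * L\<close>, is below \<open>J / 2\<close>; \<open>L + 1\<close> keeps the
    denominator positive.\<close>
  define \<epsilon> where "\<epsilon> = J / (2 * (L + 1))"
  have e0: "0 < \<epsilon>" unfolding \<epsilon>_def using \<open>0 < J\<close> L0 by simp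
  obtain p where p: "real_polynomial_function p" "\<And>s. s \<in> {0..1} \<Longrightarrow> \<bar>\<phi> s - p s\<bar> < \<epsilon>"
  proof (rule Stone_Weierstrass_real_polynomial_function[of "{0..1::real}" \<phi> \<epsilon>])
    show "continuous_on {0..1} \<phi>" unfolding \<phi>_def by (intro continuous_intros)
  qed (use e0 in auto)
  obtain a n where pe: "p = (\<lambda>s. \<Sum>i\<le>n. a i * s ^ i)"
    using p(1) unfolding real_polynomial_function_iff_sum by blast
  have Ei: "g y * E y ^ i = g y * exp (- real i * (norm (x - y))\<^sup>2)" for y i
    unfolding E_def by (simp add: exp_of_nat_mult[symmetric])
  have ii: "integrable lborel (\<lambda>y. g y * E y ^ i)" for i
  proof (rule integrable_mult_bounded[OF g])
    show "\<bar>E y ^ i\<bar> \<le> 1" for y using E[of y] by (simp add: power_le_one)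
  qed simp
  have gp: "g y * p (E y) = (\<Sum>i\<le>n. a i * (g y * E y ^ i))" for y
    unfolding pe by (simp add: sum_distrib_left mult_ac)
  have pint: "integrable lborel (\<lambda>y. g y * p (E y))" unfolding gp using ii by (intro Bochner_Integration.integrable_sum) auto
  have "(LINT y|lborel. g y * p (E y)) = (\<Sum>i\<le>n. a i * (LINT y|lborel. g y * E y ^ i))"
    unfolding gp using ii by (subst Bochner_Integration.integral_sum) auto
  also have "\<dots> = 0" unfolding Ei by (intro sum.neutral ballI) (simp only: fourier_zero_gaussian[OF g z] of_nat_0_le_iff mult_zero_right)
  finally have p0: "(LINT y|lborel. g y * p (E y)) = 0" .
  have "J = (LINT y|lborel. g y * \<phi> (E y) - g y * p (E y))"
    unfolding J_def using \<phi>i pint p0 by simp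
  also have "\<dots> \<le> (LINT y|lborel. \<epsilon> * \<bar>g y\<bar>)"
  proof (rule integral_mono)
    show "integrable lborel (\<lambda>y. g y * \<phi> (E y) - g y * p (E y))" using \<phi>i pint by simp
    show "integrable lborel (\<lambda>y. \<epsilon> * \<bar>g y\<bar>)" using g by simp
    fix y
    have "g y * \<phi> (E y) - g y * p (E y) = g y * (\<phi> (E y) - p (E y))" by (simp add: algebra_simps)
    also have "\<dots> \<le> \<bar>g y\<bar> * \<bar>\<phi> (E y) - p (E y)\<bar>" by (metis abs_ge_self abs_mult)
    also have "\<dots> \<le> \<bar>g y\<bar> * \<epsilon>" using p(2)[of "E y"] E[of y] by (intro mult_left_mono) auto
    finally show "g y * \<phi> (E y) - g y * p (E y) \<le> \<epsilon> * \<bar>g y\<bar>" by (simp add: mult.commute)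
  qed
  also have "\<dots> = \<epsilon> * L" unfolding L_def by simp
  also have "\<dots> \<le> J / 2"
  proof -
    have "\<epsilon> * L \<le> \<epsilon> * (L + 1)" using e0 by simp
    also have "\<dots> = J / 2"
    proof -
      have "L + 1 \<noteq> 0" using L0 by simp
      then have "x / (2 * (L + 1)) * (L + 1) = x / 2" for x by (simp add: divide_simps del: add_eq_0_iff)
      then show ?thesis unfolding \<epsilon>_def .
    qed
    finally show ?thesis .
  qed
  finally show False using \<open>0 < J\<close> by simp
qed

lemma fourier_inj:
  fixes f1 f2 :: "'a::euclidean_space \<Rightarrow> real"
  assumes i: "integrable lborel f1" "integrable lborel f2" and c: "continuous_on (- {0}) f1" "continuous_on (- {0}) f2"
    and F: "\<And>\<xi>. fourier (\<lambda>x. complex_of_real (f1 x)) \<xi> = fourier (\<lambda>x. complex_of_real (f2 x)) \<xi>" and x: "x \<noteq> 0"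
  shows "f1 x = f2 x"
proof -
  have *: "h1 x \<le> h2 x" if i: "integrable lborel h1" "integrable lborel h2" and c: "continuous_on (- {0}) h1" "continuous_on (- {0}) h2"
    and F: "\<And>\<xi>. fourier (\<lambda>x. complex_of_real (h1 x)) \<xi> = fourier (\<lambda>x. complex_of_real (h2 x)) \<xi>" for h1 h2 :: "'a \<Rightarrow> real"
  proof -
    have "h1 x - h2 x \<le> 0"
    proof (rule fourier_zero_continuous[where g = "\<lambda>x. h1 x - h2 x"])
      show "integrable lborel (\<lambda>x. h1 x - h2 x)" using i by simp
      show "fourier (\<lambda>x. complex_of_real (h1 x - h2 x)) \<xi> = 0" for \<xi>
      proof -
        have ic: "integrable lborel (\<lambda>y. h y * cos (y \<bullet> \<xi>))" if "integrable lborel h" for h by (rule integrable_mult_bounded[OF that, of _ 1]) auto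
        have isn: "integrable lborel (\<lambda>y. h y * sin (y \<bullet> \<xi>))" if "integrable lborel h" for h by (rule integrable_mult_bounded[OF that, of _ 1]) auto
        show ?thesis using F[of \<xi>] i ic isn unfolding fourier_eq[OF i(1)] fourier_eq[OF i(2)] fourier_eq[OF Bochner_Integration.integrable_diff[OF i]]
          by (simp add: left_diff_distrib complex_eq_iff)
      qed
      have "isCont h1 x" "isCont h2 x" using c x by (auto simp: continuous_on_eq_continuous_at open_Compl)
      then show "isCont (\<lambda>x. h1 x - h2 x) x" by (intro continuous_intros)
    qed
    then show ?thesis by simp
  qed
  show ?thesis using *[of f1 f2] *[of f2 f1] assms by (intro antisym) auto
qed

section \<open>Moments of the linear equation and the Mittag-Leffler series\<close>

lemma Gamma_add_ge:
  fixes x a :: real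
  assumes x: "1 < x" and a: "0 < a"
  shows "Gamma x * (x - 1) powr a \<le> Gamma (x + a)"
proof -
  \<comment> \<open>\<open>x\<close> is the convex combination of \<open>x - 1\<close> and
    \<open>x + a\<close> with weights \<open>t\<close> and \<open>1 - t\<close>, and Gamma is
    log-convex.\<close>
  define t where "t = a / (1 + a)"
  have t: "0 \<le> t" "t \<le> 1" "1 - t = 1 / (1 + a)" unfolding t_def using a by (auto simp: field_simps)
  have xe: "(1 - (1 - t)) *\<^sub>R (x - 1) + (1 - t) *\<^sub>R (x + a) = x"
  proof -
    have "(1 - t) * a = t" unfolding t(3) by (simp add: t_def)
    then show ?thesis by (simp add: algebra_simps)
  qed
  have "(ln \<circ> Gamma) ((1 - (1 - t)) *\<^sub>R (x - 1) + (1 - t) *\<^sub>R (x + a)) \<le> (1 - (1 - t)) * (ln \<circ> Gamma) (x - 1) + (1 - t) * (ln \<circ> Gamma) (x + a)"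
    using t x a by (intro convex_onD[OF log_convex_Gamma_real]) auto
  then have "ln (Gamma x) \<le> t * ln (Gamma (x - 1)) + (1 - t) * ln (Gamma (x + a))" unfolding xe by simp
  then have "(1 + a) * ln (Gamma x) \<le> (1 + a) * (t * ln (Gamma (x - 1)) + (1 - t) * ln (Gamma (x + a)))"
    using a by (intro mult_left_mono) auto
  also have "\<dots> = a * ln (Gamma (x - 1)) + ln (Gamma (x + a))"
  proof -
    have "(1 + a) * t = a" "(1 + a) * (1 - t) = 1" unfolding t(3) using a by (simp_all add: t_def)
    then show ?thesis by (simp only: distrib_left mult.assoc[symmetric] mult_1)
  qed
  also have "ln (Gamma (x - 1)) = ln (Gamma x) - ln (x - 1)"
  proof -
    have "x - 1 \<notin> \<int>\<^sub>\<le>\<^sub>0" using x by (auto elim!: nonpos_Ints_cases')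
    from Gamma_plus1[OF this] have G: "Gamma x = (x - 1) * Gamma (x - 1)" by simp
    have p: "0 < x - 1" using x by simp
    show ?thesis unfolding G using ln_mult[of "x - 1" "Gamma (x - 1)"] p Gamma_real_pos[OF p] by (auto split: if_splits)
  qed
  finally have "ln (Gamma x) + a * ln (x - 1) \<le> ln (Gamma (x + a))" by (simp add: algebra_simps)
  then have "exp (ln (Gamma x) + a * ln (x - 1)) \<le> exp (ln (Gamma (x + a)))" by simp
  then show ?thesis using x a Gamma_real_pos[of x] Gamma_real_pos[of "x + a"] by (simp add: exp_add powr_def)
qed

lemma summable_mittag_leffler:
  fixes x \<alpha> :: real
  assumes x: "0 \<le> x" and \<alpha>: "0 < \<alpha>"
  shows "summable (\<lambda>k. x ^ k / Gamma (\<alpha> * real k + 1))"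
proof -
  \<comment> \<open>Beyond this \<open>n\<close> one has
    \<open>(\<alpha> * k) powr \<alpha> \<ge> 2 * x\<close>, so that consecutive terms have ratio at
    most \<open>1/2\<close>.\<close>
  obtain n :: nat where n: "(2 * x) powr (1 / \<alpha>) / \<alpha> \<le> real n" using real_arch_simple by blast
  show ?thesis
  proof (rule summable_ratio_test[of "1/2" "Suc n"])
    fix k assume k: "Suc n \<le> k"
    have G: "0 < Gamma (\<alpha> * real j + 1)" for j using \<alpha> by (intro Gamma_real_pos) (auto intro: add_nonneg_pos)
    have k0: "0 < real k" using k by simp
    have "(2 * x) powr (1 / \<alpha>) / \<alpha> \<le> real k" using n k by simp
    then have "(2 * x) powr (1 / \<alpha>) \<le> \<alpha> * real k" using \<alpha> by (simp add: pos_divide_le_eq mult.commute)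
    then have "((2 * x) powr (1 / \<alpha>)) powr \<alpha> \<le> (\<alpha> * real k) powr \<alpha>" using \<alpha> by (intro powr_mono2) auto
    then have x2: "2 * x \<le> (\<alpha> * real k) powr \<alpha>" using \<alpha> x by (simp add: powr_powr)
    have "Gamma (\<alpha> * real k + 1) * (2 * x) \<le> Gamma (\<alpha> * real k + 1) * (\<alpha> * real k) powr \<alpha>"
      using x2 G[of k] by (intro mult_left_mono) auto
    also have "\<dots> \<le> Gamma (\<alpha> * real k + 1 + \<alpha>)"
      using Gamma_add_ge[of "\<alpha> * real k + 1" \<alpha>] \<alpha> k0 by simp
    finally have g: "Gamma (\<alpha> * real k + 1) * (2 * x) \<le> Gamma (\<alpha> * real (Suc k) + 1)" by (simp add: algebra_simps)
    have "x ^ Suc k / Gamma (\<alpha> * real (Suc k) + 1) \<le> 1/2 * (x ^ k / Gamma (\<alpha> * real k + 1))"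
    proof -
      have "x ^ k * (Gamma (\<alpha> * real k + 1) * (2 * x)) \<le> x ^ k * Gamma (\<alpha> * real (Suc k) + 1)"
        using g x by (intro mult_left_mono) auto
      then show ?thesis using G[of k] G[of "Suc k"] by (simp add: divide_simps mult_ac)
    qed
    then show "norm (x ^ Suc k / Gamma (\<alpha> * real (Suc k) + 1)) \<le> 1/2 * norm (x ^ k / Gamma (\<alpha> * real k + 1))"
      using x G[of k] G[of "Suc k"] by (simp add: less_imp_le)
  qed simp
qed

text \<open>The constant is calibrated, not computed on the ball: polar integration holds with some
  \<open>C\<close> for every radial factor, and the Gaussian, whose moments are known, determines
  it.\<close>

lemma radial_even_moment:
  fixes \<xi> :: "'a::euclidean_space" and G :: "real \<Rightarrow> ennreal"
  assumes [measurable]: "G \<in> borel_measurable borel"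
  shows "(\<integral>\<^sup>+x. ennreal ((x \<bullet> \<xi>) ^ (2 * k)) * G (norm x) \<partial>lborel)
    = (\<integral>\<^sup>+r\<in>{0<..}. ennreal (sphere_area DIM('a) * Gamma (real DIM('a) / 2) * (norm \<xi>) ^ (2 * k) * fact (2 * k)
        / (4 ^ k * fact k * Gamma (real DIM('a) / 2 + real k)) * r powr (real DIM('a) + 2 * real k - 1)) * G r \<partial>lborel)"
proof -
  define h where "h x = (x \<bullet> \<xi>) ^ (2 * k)" for x :: 'a
  have [measurable]: "h \<in> borel_measurable borel" unfolding h_def by measurable
  have "(\<integral>\<^sup>+x\<in>cball 0 1. ennreal (h x) \<partial>lborel) \<le> (\<integral>\<^sup>+x. ennreal ((norm \<xi>) ^ (2 * k)) * indicator (cball (0::'a) 1) x \<partial>lborel)"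
  proof (intro nn_integral_mono)
    fix x :: 'a
    have "h x \<le> (norm \<xi>) ^ (2 * k)" if "norm x \<le> 1"
    proof -
      have "\<bar>x \<bullet> \<xi>\<bar> \<le> norm x * norm \<xi>" by (rule Cauchy_Schwarz_ineq2)
      also have "\<dots> \<le> 1 * norm \<xi>" using that by (intro mult_right_mono) auto
      finally have "\<bar>x \<bullet> \<xi>\<bar> ^ (2 * k) \<le> (norm \<xi>) ^ (2 * k)" by (intro power_mono) auto
      then show ?thesis unfolding h_def by (simp add: power_even_abs)
    qed
    then show "ennreal (h x) * indicator (cball 0 1) x \<le> ennreal ((norm \<xi>) ^ (2 * k)) * indicator (cball (0::'a) 1) x"
      by (auto simp: indicator_def intro: ennreal_leI)
  qed
  also have "\<dots> < \<infinity>" by (simp add: nn_integral_cmult_indicator ennreal_mult_less_top emeasure_cball)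
  finally obtain C where C: "0 \<le> C" "(\<integral>\<^sup>+x\<in>cball 0 1. ennreal (h x) \<partial>lborel) = ennreal C"
    by (cases "\<integral>\<^sup>+x\<in>cball 0 1. ennreal (h x) \<partial>lborel") auto
  have R: "(\<integral>\<^sup>+x. ennreal (h x) * H (norm x) \<partial>lborel)
    = (\<integral>\<^sup>+r\<in>{0<..}. ennreal (C * real (DIM('a) + 2 * k) * r powr (real (DIM('a) + 2 * k) - 1)) * H r \<partial>lborel)"
    if "H \<in> borel_measurable borel" for H :: "real \<Rightarrow> ennreal"
    by (rule nn_integral_homogeneous_radial[OF _ that _ _ C(2,1)]) (auto simp: h_def power_mult_distrib)
  have s: "0 < real DIM('a) / 2 + real k" by (auto intro: add_pos_nonneg)
  have "ennreal (gauss_const TYPE('a) * (norm \<xi>) ^ (2 * k) * fact (2 * k) / (4 ^ k * fact k))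
     = (\<integral>\<^sup>+x. ennreal (h x) * ennreal (exp (- (norm x)\<^sup>2)) \<partial>lborel)"
    unfolding gaussian_even_moment[symmetric] h_def by (simp add: ennreal_mult'')
  also have "\<dots> = (\<integral>\<^sup>+r. ennreal (C * real (DIM('a) + 2 * k)) * (ennreal (r powr (2 * (real DIM('a) / 2 + real k) - 1) * exp (- r\<^sup>2)) * indicator {0<..} r) \<partial>lborel)"
    using C by (subst R[of "\<lambda>r. ennreal (exp (- r\<^sup>2))"], simp, intro nn_integral_cong) (auto simp: indicator_def ennreal_mult' algebra_simps)
  also have "\<dots> = ennreal (C * real (DIM('a) + 2 * k)) * ennreal (Gamma (real DIM('a) / 2 + real k) / 2)"
    using nn_integral_gaussian_radial[OF s] by (subst nn_integral_cmult) auto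
  finally have "gauss_const TYPE('a) * (norm \<xi>) ^ (2 * k) * fact (2 * k) / (4 ^ k * fact k) = C * real (DIM('a) + 2 * k) * (Gamma (real DIM('a) / 2 + real k) / 2)"
    using C s Gamma_real_pos[OF s] gauss_const_pos[where 'a = 'a] by (simp add: ennreal_mult''[symmetric] less_imp_le)
  then have "C * real (DIM('a) + 2 * k) = sphere_area DIM('a) * Gamma (real DIM('a) / 2) * (norm \<xi>) ^ (2 * k) * fact (2 * k)
        / (4 ^ k * fact k * Gamma (real DIM('a) / 2 + real k))"
    unfolding gauss_const_def using Gamma_real_pos[OF s] by (simp add: field_simps)
  then show ?thesis using R[of G] unfolding h_def by simp
qed

context profile_params
begin

text \<open>With \<open>m = 1\<close> and \<open>b = \<alpha> / 2\<close> the Mellin identity at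
  \<open>s = d + 2 k\<close> ties each even moment to the next through a quotient of Gamma values,
  and these quotients telescope.\<close>

lemma sol_one_moments:
  assumes m1: "m = 1" and f: "sol f" and F0: "mom (real d - 1) f = ennreal F0" "0 \<le> F0"
  shows "mom (real d + 2 * real k - 1) f
    = ennreal (F0 * (4 ^ k * fact k * Gamma (real d / 2 + real k)) / (Gamma (real d / 2) * Gamma (\<alpha> * real k + 1)))"
proof (induction k)
  case 0
  have "0 < Gamma (real d / 2)" using d by (intro Gamma_real_pos) auto
  then show ?case using F0 by simp
next
  case (Suc k)
  define Fk where "Fk = F0 * (4 ^ k * fact k * Gamma (real d / 2 + real k)) / (Gamma (real d / 2) * Gamma (\<alpha> * real k + 1))"
  have d1: "1 \<le> real d" using d by simp
  have b: "b = \<alpha> / 2" using m1 by (simp add: b_exp_def)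
  have ak: "0 < \<alpha> * (real k + 1)" "0 < \<alpha> * real k + 1" using \<alpha> by (auto intro: add_nonneg_pos)
  note G = Gamma_real_pos[OF ak(1)] Gamma_real_pos[OF ak(2)]
  define q where "q = QF (real d + 2 * real k + 2)"
  have q0: "0 < q" unfolding q_def using d1 by (intro QF_pos) auto
  have qe: "q = \<alpha> / (2 * (real d + 2 * real k)) * (Gamma (\<alpha> * (real k + 1)) / Gamma (\<alpha> * real k + 1))"
  proof -
    have e1: "b * (real d + 2 * real k + 2 - real d) = \<alpha> * (real k + 1)" unfolding b by (simp add: algebra_simps)
    have e2: "1 - \<alpha> + \<alpha> * (real k + 1) = \<alpha> * real k + 1" by (simp add: algebra_simps)
    have e3: "real d + 2 * real k + 2 - 2 = real d + 2 * real k" by simp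
    show ?thesis unfolding q_def QF_def e1 e2 e3 unfolding b by (simp only: divide_divide_eq_left)
  qed
  have "ennreal Fk = (\<integral>\<^sup>+z\<in>{0<..}. ennreal (z powr (real d + 2 * real k - 1) * f z powr m) \<partial>lborel)"
    unfolding Fk_def Suc.IH[symmetric] mom_def m1 using sol_nonneg[OF f]
    by (intro nn_integral_cong) (auto simp: indicator_def)
  also have "\<dots> = ennreal q * mom (real d + 2 * real k + 1) f"
    unfolding q_def using d1 by (intro sol_mellin f) auto
  finally have e: "ennreal Fk = ennreal q * mom (real d + 2 * real k + 1) f" .
  then obtain y where y: "mom (real d + 2 * real k + 1) f = ennreal y" "0 \<le> y"
    using q0 by (cases "mom (real d + 2 * real k + 1) f") (auto simp: ennreal_mult_top)
  have Fk0: "0 \<le> Fk" unfolding Fk_def using F0 G d1 Gamma_real_pos[of "real d / 2"] Gamma_real_pos[of "real d / 2 + real k"]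
    by (auto intro!: divide_nonneg_nonneg mult_nonneg_nonneg)
  have "Fk = q * y" using e y q0 Fk0 by (simp add: ennreal_mult'[symmetric])
  then have ye: "y = Fk / q" using q0 by simp
  have "y = F0 * (4 ^ Suc k * fact (Suc k) * Gamma (real d / 2 + real (Suc k))) / (Gamma (real d / 2) * Gamma (\<alpha> * real (Suc k) + 1))"
  proof -
    have g1: "Gamma (real d / 2 + real (Suc k)) = (real d / 2 + real k) * Gamma (real d / 2 + real k)"
    proof -
      have "real d / 2 + real k \<notin> \<int>\<^sub>\<le>\<^sub>0" using d1 by (auto elim!: nonpos_Ints_cases')
      from Gamma_plus1[OF this] show ?thesis by (simp add: add_ac)
    qed
    have g2: "Gamma (\<alpha> * real (Suc k) + 1) = \<alpha> * (real k + 1) * Gamma (\<alpha> * (real k + 1))"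
    proof -
      have "\<alpha> * (real k + 1) \<notin> \<int>\<^sub>\<le>\<^sub>0" using ak by (auto elim!: nonpos_Ints_cases')
      from Gamma_plus1[OF this] show ?thesis by (simp add: add_ac)
    qed
    define a1 a2 a3 a4 where "a1 = Gamma (\<alpha> * (real k + 1))" and "a2 = Gamma (\<alpha> * real k + 1)" and "a3 = Gamma (real d / 2)" and "a4 = Gamma (real d / 2 + real k)"
    have nz: "a1 \<noteq> 0" "a2 \<noteq> 0" "a3 \<noteq> 0" "\<alpha> \<noteq> 0" "real k + 1 \<noteq> 0" "real d + 2 * real k \<noteq> 0"
    proof -
      have "0 < real d / 2" using d1 by simp
      from Gamma_real_pos[OF this] show "a1 \<noteq> 0" "a2 \<noteq> 0" "a3 \<noteq> 0"
        unfolding a1_def a2_def a3_def using G by linarith+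
    qed (use \<alpha> d1 in auto)
    have "y = (F0 * (4 ^ k * fact k * a4) / (a3 * a2)) / (\<alpha> / (2 * (real d + 2 * real k)) * (a1 / a2))"
      unfolding ye Fk_def qe a1_def a2_def a3_def a4_def ..
    also have "\<dots> = F0 * (4 ^ k * fact k * a4) * 2 * (real d + 2 * real k) / (a3 * \<alpha> * a1)"
      using nz by (simp add: divide_simps)
    also have "\<dots> = F0 * (4 ^ Suc k * ((real k + 1) * fact k) * ((real d / 2 + real k) * a4)) / (a3 * (\<alpha> * (real k + 1) * a1))"
      using nz by (simp add: divide_simps)
    finally show ?thesis unfolding g1 g2 a1_def a3_def a4_def by (simp add: add.commute)
  qed
  then show ?case using y by (simp add: add_ac)
qed

end

text \<open>The factor \<open>4 ^ k * fact k * Gamma (d/2 + k)\<close> of the radial moment cancels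
  against the one from polar integration. What is left is
  \<open>fact (2 * k) / Gamma (\<alpha> * k + 1)\<close>, so the cosine series becomes the
  Mittag-Leffler series.\<close>

lemma sol_one_fourier:
  fixes f :: "real \<Rightarrow> real"
  assumes P: "profile_params DIM('a::euclidean_space) \<alpha> 1" and f: "profile_params.sol DIM('a) \<alpha> 1 f"
    and F0: "mom (real DIM('a) - 1) f = ennreal F0" "0 \<le> F0"
  shows "integrable lborel (\<lambda>x::'a. f (norm x))" and "continuous_on (- {0}) (\<lambda>x::'a. f (norm x))"
    and "fourier (\<lambda>x::'a. complex_of_real (f (norm x))) \<xi> = complex_of_real (sphere_area DIM('a) * F0 * mittag_leffler \<alpha> (- (norm \<xi>)\<^sup>2))"
proof -
  interpret profile_params "DIM('a)" \<alpha> 1 by (rule P)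
  have [measurable]: "f \<in> borel_measurable borel" using f by (rule sol_measurable)
  have ap: "0 < sphere_area DIM('a)" by (simp add: sphere_area_pos)
  define M where "M \<xi> k = sphere_area DIM('a) * F0 * (norm \<xi>) ^ (2 * k) * fact (2 * k) / Gamma (\<alpha> * real k + 1)" for \<xi> :: 'a and k
  have G: "0 < Gamma (\<alpha> * real k + 1)" for k using \<alpha> by (intro Gamma_real_pos) (auto intro: add_nonneg_pos)
  have M0: "0 \<le> M \<xi> k" for \<xi> k unfolding M_def using ap F0 G[of k] by (auto intro!: divide_nonneg_nonneg mult_nonneg_nonneg simp: less_imp_le)
  have mom_eq: "(\<integral>\<^sup>+x. ennreal ((x \<bullet> \<xi>) ^ (2 * k) * f (norm x)) \<partial>lborel) = ennreal (M \<xi> k)" for \<xi> :: 'a and k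
  proof -
    have s: "0 < real DIM('a) / 2 + real k" "0 < real DIM('a) / 2" by (auto intro: add_pos_nonneg)
    define A where "A = sphere_area DIM('a) * Gamma (real DIM('a) / 2) * (norm \<xi>) ^ (2 * k) * fact (2 * k)
        / (4 ^ k * fact k * Gamma (real DIM('a) / 2 + real k))"
    have A0: "0 \<le> A" unfolding A_def using ap Gamma_real_pos[OF s(1)] Gamma_real_pos[OF s(2)]
      by (auto intro!: divide_nonneg_nonneg mult_nonneg_nonneg simp: less_imp_le)
    have "(\<integral>\<^sup>+x. ennreal ((x \<bullet> \<xi>) ^ (2 * k) * f (norm x)) \<partial>lborel) = (\<integral>\<^sup>+x. ennreal ((x \<bullet> \<xi>) ^ (2 * k)) * ennreal (f (norm x)) \<partial>lborel)"
      by (simp add: ennreal_mult')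
    also have "\<dots> = (\<integral>\<^sup>+r\<in>{0<..}. ennreal (A * r powr (real DIM('a) + 2 * real k - 1)) * ennreal (f r) \<partial>lborel)"
      unfolding A_def by (rule radial_even_moment) simp
    also have "\<dots> = (\<integral>\<^sup>+r. ennreal A * (ennreal (r powr (real DIM('a) + 2 * real k - 1) * f r) * indicator {0<..} r) \<partial>lborel)"
      using A0 by (intro nn_integral_cong) (auto simp: indicator_def ennreal_mult' mult.assoc)
    also have "\<dots> = ennreal A * mom (real DIM('a) + 2 * real k - 1) f"
      unfolding mom_def by (rule nn_integral_cmult) auto
    also have "\<dots> = ennreal (M \<xi> k)"
    proof -
      define G1 G2 G3 where "G1 = Gamma (real DIM('a) / 2)" and "G2 = Gamma (real DIM('a) / 2 + real k)" and "G3 = Gamma (\<alpha> * real k + 1)"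
      have "0 < G1" "0 < G2" "0 < G3" unfolding G1_def G2_def G3_def using G[of k] Gamma_real_pos[OF s(1)] Gamma_real_pos[OF s(2)] by simp_all
      then have "A * (F0 * (4 ^ k * fact k * G2) / (G1 * G3)) = M \<xi> k"
        unfolding A_def M_def G1_def[symmetric] G2_def[symmetric] G3_def[symmetric] by (simp add: divide_simps)
      then show ?thesis
        unfolding sol_one_moments[OF refl f F0] G1_def G2_def G3_def using A0 by (subst ennreal_mult'[symmetric]) simp_all
    qed
    finally show ?thesis .
  qed
  have fi: "(\<integral>\<^sup>+x. ennreal (f (norm x)) \<partial>(lborel :: 'a measure)) = ennreal (M 0 0)" using mom_eq[of 0 0] by simp
  \<comment> \<open>The value of \<open>f\<close> at 0 is arbitrary, so the sign of the integrand is
    known off the origin only.\<close>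
  show int: "integrable lborel (\<lambda>x::'a. f (norm x))"
  proof (rule integrableI_bounded)
    have "(\<integral>\<^sup>+x. ennreal (norm (f (norm x))) \<partial>(lborel :: 'a measure)) = (\<integral>\<^sup>+x. ennreal (f (norm x)) \<partial>(lborel :: 'a measure))"
      by (intro nn_integral_cong_AE eventually_mono[OF AE_lborel_singleton[of "0::'a"]]) (simp add: sol_nonneg[OF f])
    then show "(\<integral>\<^sup>+x. ennreal (norm (f (norm x))) \<partial>(lborel :: 'a measure)) < \<infinity>" using fi by simp
  qed simp
  show "continuous_on (- {0}) (\<lambda>x::'a. f (norm x))"
  proof (rule continuous_on_compose2[OF sol_continuous_on[OF f]])
    have "mom (real DIM('a)) f \<le> mom (real DIM('a) - 1) f + mom (real DIM('a) + 1) f"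
      using f by (intro mom_interpolate) (auto simp: sol_nonneg)
    also have "\<dots> < \<infinity>" using F0 sol_one_moment_finite[OF P f] by simp
    finally show "mom (real DIM('a)) f < \<infinity>" .
  qed (auto intro!: continuous_intros)
  have Msum: "summable (\<lambda>k. M \<xi> k / fact (2 * k))"
  proof -
    have "M \<xi> k / fact (2 * k) = sphere_area DIM('a) * F0 * (((norm \<xi>)\<^sup>2) ^ k / Gamma (\<alpha> * real k + 1))" for k
      unfolding M_def by (simp add: power_mult)
    then show ?thesis using summable_mult[OF summable_mittag_leffler[of "(norm \<xi>)\<^sup>2" \<alpha>]] \<alpha>
      by (simp only:) simp
  qed
  have "(\<lambda>k. (-1) ^ k * M \<xi> k / fact (2 * k)) sums (LINT x|lborel. cos (x \<bullet> \<xi>) * f (norm x))"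
    by (rule cos_transform[OF _ _ mom_eq M0 Msum]) (auto simp: sol_nonneg[OF f])
  moreover have "(-1) ^ k * M \<xi> k / fact (2 * k) = sphere_area DIM('a) * F0 * ((- (norm \<xi>)\<^sup>2) ^ k / Gamma (\<alpha> * real k + 1))" for k
  proof -
    have "(- (norm \<xi>)\<^sup>2) ^ k = (-1) ^ k * ((norm \<xi>)\<^sup>2) ^ k" by (rule power_minus)
    then show ?thesis unfolding M_def by (simp add: power_mult)
  qed
  ultimately have sC: "(\<lambda>k. sphere_area DIM('a) * F0 * ((- (norm \<xi>)\<^sup>2) ^ k / Gamma (\<alpha> * real k + 1))) sums (LINT x|lborel. f (norm x) * cos (x \<bullet> \<xi>))"
    by (simp only: mult.commute[of "cos _"])
  have "summable (\<lambda>k. (- (norm \<xi>)\<^sup>2) ^ k / Gamma (\<alpha> * real k + 1))"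
  proof (rule summable_norm_cancel)
    have e: "norm ((- (norm \<xi>)\<^sup>2) ^ k / Gamma (\<alpha> * real k + 1)) = ((norm \<xi>)\<^sup>2) ^ k / Gamma (\<alpha> * real k + 1)" for k
      using G[of k] by (simp add: power_abs)
    show "summable (\<lambda>k. norm ((- (norm \<xi>)\<^sup>2) ^ k / Gamma (\<alpha> * real k + 1)))"
      unfolding e using summable_mittag_leffler[of "(norm \<xi>)\<^sup>2" \<alpha>] \<alpha> by simp
  qed
  then have "(\<lambda>k. sphere_area DIM('a) * F0 * ((- (norm \<xi>)\<^sup>2) ^ k / Gamma (\<alpha> * real k + 1))) sums (sphere_area DIM('a) * F0 * mittag_leffler \<alpha> (- (norm \<xi>)\<^sup>2))"
    unfolding mittag_leffler_def by (intro sums_mult summable_sums)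
  from sums_unique2[OF sC this] have C: "(LINT x|lborel. f (norm x) * cos (x \<bullet> \<xi>)) = sphere_area DIM('a) * F0 * mittag_leffler \<alpha> (- (norm \<xi>)\<^sup>2)" .
  have "(LINT x|lborel. f (norm x) * sin (x \<bullet> \<xi>)) = (LINT x|lborel. f (norm (- x)) * sin ((- x) \<bullet> \<xi>))"
    by (rule integral_lborel_uminus) simp
  also have "\<dots> = - (LINT x|lborel. f (norm x) * sin (x \<bullet> \<xi>))" by simp
  finally have S: "(LINT x|lborel. f (norm x) * sin (x \<bullet> \<xi>)) = 0" by simp
  show "fourier (\<lambda>x::'a. complex_of_real (f (norm x))) \<xi> = complex_of_real (sphere_area DIM('a) * F0 * mittag_leffler \<alpha> (- (norm \<xi>)\<^sup>2))"
    unfolding fourier_eq[OF int] C S by (simp add: complex_eq_iff)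
qed

section \<open>Profiles of mass \<open>M\<close>\<close>

lemma admissible_canonical:
  fixes e :: "'a::euclidean_space"
  assumes \<alpha>: "0 < \<alpha>" "\<alpha> < 1" and m: "m \<noteq> 1" "1 - 1 / (2 * real DIM('a)) < m"
  shows "profile_params DIM('a) \<alpha> m" "profile_params.admissible DIM('a) \<alpha> m (canonical_profile e \<alpha> m)"
proof -
  have d1: "1 \<le> real DIM('a)" by (simp add: Suc_leI)
  have "1 / (2 * real DIM('a)) \<le> 1 / 2" using d1 by (intro divide_left_mono) auto
  then have m0: "0 < m" using m by linarith
  have md: "real DIM('a) * (1 - m) < 1 / 2" using m(2) d1 by (simp add: field_simps)
  then have "real DIM('a) * (m - 1) > - 1 / 2" by (simp add: algebra_simps)
  then show P: "profile_params DIM('a) \<alpha> m"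
    using \<alpha> m0 by unfold_locales (auto simp: Suc_leI)
  show "profile_params.admissible DIM('a) \<alpha> m (canonical_profile e \<alpha> m)"
  proof (cases "1 < m")
    case True
    have "canonical_profile e \<alpha> m = profile_slow DIM('a) \<alpha> m" unfolding canonical_profile_def using True by auto
    then show ?thesis using profile_params.admissible_profile_slow[OF P True] by simp
  next
    case False
    then have m1: "m < 1" using m by simp
    have "fast_params DIM('a) \<alpha> m" using P m1 md by (simp add: fast_params_def fast_params_axioms_def)
    from fast_params.admissible_profile_fast[OF this]
    have "profile_params.admissible DIM('a) \<alpha> m (profile_fast DIM('a) \<alpha> m)" .
    moreover have "canonical_profile e \<alpha> m = profile_fast DIM('a) \<alpha> m" unfolding canonical_profile_def using m1 by auto
    ultimately show ?thesis by simp
  qed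
qed

text \<open>In dimension \<open>d\<close> the scaling multiplies the mass by
  \<open>A * k powr (-d) = A powr \<beta>\<close> with \<open>\<beta> = 1 + (m - 1) * d / 2\<close>,
  which is why \<open>mass_scale\<close> takes the power \<open>1 / \<beta>\<close>;
  \<open>\<beta> > 0\<close> is again the condition \<open>m > 1 - 2/d\<close>.\<close>

lemma mass_profile_sol:
  fixes e :: "'a::euclidean_space"
  assumes al: "0 < \<alpha>" "\<alpha> < 1" and mm: "m \<noteq> 1" "1 - 1 / (2 * real DIM('a)) < m" and M: "0 < M"
  shows "profile_params.sol DIM('a) \<alpha> m (mass_profile e \<alpha> m M)"
    "mom (real DIM('a) - 1) (mass_profile e \<alpha> m M) = ennreal (M / sphere_area DIM('a))"
    "mom (real DIM('a) + 1) (mass_profile e \<alpha> m M) < \<infinity>"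
proof -
  interpret profile_params "DIM('a)" \<alpha> m by (rule admissible_canonical(1)[OF al mm])
  define u where "u = canonical_profile e \<alpha> m"
  have adm: "admissible u" unfolding u_def by (rule admissible_canonical(2)[OF al mm])
  then have u: "sol u" "0 < mom (real DIM('a) - 1) u" "mom (real DIM('a) - 1) u < \<infinity>" "mom (real DIM('a) + 1) u < \<infinity>"
    unfolding admissible_def by auto
  have [measurable]: "u \<in> borel_measurable borel" using u(1) by (rule sol_measurable)
  have nn: "0 \<le> u z" if "0 < z" for z using sol_nonneg[OF u(1) that] .
  obtain \<mu> where \<mu>: "0 < \<mu>" "mom (real DIM('a) - 1) u = ennreal \<mu>"
    using u(2,3) by (cases "mom (real DIM('a) - 1) u") auto
  have ap: "0 < sphere_area DIM('a)" by (simp add: sphere_area_pos)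
  have "(LINT \<rho>:{0<..}|lborel. u \<rho> * \<rho> ^ (DIM('a) - 1)) = (LINT \<rho>:{0<..}|lborel. \<rho> powr (real DIM('a) - 1) * u \<rho>)"
    unfolding set_lebesgue_integral_def
    by (intro Bochner_Integration.integral_cong) (auto simp: indicator_def powr_realpow[symmetric] of_nat_diff Suc_leI)
  also have "\<dots> = enn2real (mom (real DIM('a) - 1) u)"
    unfolding mom_def using nn by (intro set_lebesgue_integral_nonneg_eq) auto
  finally have cm: "canonical_mass e \<alpha> m = sphere_area DIM('a) * \<mu>"
    unfolding canonical_mass_def u_def[symmetric] using \<mu> by simp
  define A where "A = mass_scale e \<alpha> m M"
  define \<beta> where "\<beta> = 1 + (m - 1) * real DIM('a) / 2"
  have \<beta>: "0 < \<beta>" unfolding \<beta>_def using profile_params.m(2)[OF profile_params_axioms] by (simp add: mult.commute)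
  have Ae: "A = (M / (sphere_area DIM('a) * \<mu>)) powr (1 / \<beta>)" unfolding A_def mass_scale_def cm \<beta>_def ..
  have A0: "0 < A" unfolding Ae using M ap \<mu> by simp
  define k where "k = A powr (- (m - 1) / 2)"
  have k0: "0 < k" unfolding k_def using A0 by simp
  have U: "mass_profile e \<alpha> m M = (\<lambda>z. A * u (k * z))"
    unfolding mass_profile_def A_def[symmetric] Let_def u_def k_def by auto
  show "sol (mass_profile e \<alpha> m M)" unfolding U using u(1) A0 k_def by (rule sol_scale)
  have sc: "mom s (mass_profile e \<alpha> m M) = ennreal (A * k powr (- (s + 1))) * mom s u" for s
    unfolding U using nn A0 k0 by (intro mom_scale) auto
  have "A * k powr (- (real DIM('a) - 1 + 1)) = A powr \<beta>"
  proof -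
    have "k powr (- (real DIM('a) - 1 + 1)) = A powr ((m - 1) * real DIM('a) / 2)"
      unfolding k_def powr_powr by (rule arg_cong[where f = "\<lambda>x. A powr x"]) (simp add: field_simps)
    then show ?thesis unfolding \<beta>_def using A0 by (simp add: powr_add)
  qed
  also have "\<dots> = M / (sphere_area DIM('a) * \<mu>)" unfolding Ae using \<beta> M ap \<mu> by (simp add: powr_powr)
  finally show "mom (real DIM('a) - 1) (mass_profile e \<alpha> m M) = ennreal (M / sphere_area DIM('a))"
    unfolding sc \<mu>(2) using \<mu> by (simp add: ennreal_mult''[symmetric] del: of_nat_diff)
  show "mom (real DIM('a) + 1) (mass_profile e \<alpha> m M) < \<infinity>"
    unfolding sc using u(4) by (simp add: ennreal_mult_less_top)
qed

lemma mass_profile_subseq: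
  fixes e :: "'a::euclidean_space" and X :: "nat \<Rightarrow> real"
  assumes \<alpha>: "0 < \<alpha>" "\<alpha> < 1" and M: "0 < M" and X: "\<And>n. X n \<noteq> 1" "\<And>n. 1 - 1 / (2 * real DIM('a)) < X n" "X \<longlonglongrightarrow> 1"
  shows "\<exists>s f. strict_mono (s :: nat \<Rightarrow> nat) \<and> (\<forall>z>0. (\<lambda>n. mass_profile e \<alpha> (X (s n)) M z) \<longlonglongrightarrow> f z) \<and>
    profile_params.sol DIM('a) \<alpha> 1 f \<and> mom (real DIM('a) - 1) f = ennreal (M / sphere_area DIM('a))"
proof -
  have P1: "profile_params DIM('a) \<alpha> 1" using \<alpha> by unfold_locales (auto simp: Suc_leI)
  have "0 \<le> M / sphere_area DIM('a)" using M sphere_area_pos[of "DIM('a)"] by simp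
  from sol_compactness[OF admissible_canonical(1)[OF \<alpha> X(1,2)] P1 X(3) this mass_profile_sol[OF \<alpha> X(1,2) M], of "\<lambda>_. e"]
  show ?thesis by blast
qed

text \<open>\<open>Z_fun\<close> is a choice, so a function with the required transform has to be
  exhibited: a limit of profiles of mass 1 along exponents decreasing to 1.\<close>

lemma Z_fun_is_inverse_fourier:
  assumes \<alpha>: "0 < \<alpha>" "\<alpha> < 1"
  shows "is_inverse_fourier (\<lambda>\<xi>. complex_of_real (mittag_leffler \<alpha> (- (norm \<xi>)\<^sup>2))) (Z_fun \<alpha> 1 :: 'a::euclidean_space \<Rightarrow> real)"
proof -
  obtain e :: 'a where "e \<in> Basis" using nonempty_Basis by blast
  have P1: "profile_params DIM('a) \<alpha> 1" using \<alpha> by unfold_locales (auto simp: Suc_leI)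
  have ap: "0 < sphere_area DIM('a)" by (simp add: sphere_area_pos)
  define X where "X n = 1 + inverse (real (Suc n))" for n
  have "(\<lambda>n. 1 + inverse (real (Suc n))) \<longlonglongrightarrow> 1 + 0" by (intro tendsto_intros LIMSEQ_inverse_real_of_nat)
  then have X: "X \<longlonglongrightarrow> 1" unfolding X_def by simp
  have X1: "X n \<noteq> 1" "1 - 1 / (2 * real DIM('a)) < X n" for n
  proof -
    have "0 < inverse (real (Suc n))" "0 < 1 / (2 * real DIM('a))" by auto
    then show "X n \<noteq> 1" "1 - 1 / (2 * real DIM('a)) < X n" unfolding X_def by linarith+
  qed
  obtain f where f: "profile_params.sol DIM('a) \<alpha> 1 f" "mom (real DIM('a) - 1) f = ennreal (1 / sphere_area DIM('a))"
    using mass_profile_subseq[OF \<alpha> zero_less_one X1 X, of e] by blast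
  have F0: "0 \<le> 1 / sphere_area DIM('a)" using ap by simp
  have "is_inverse_fourier (\<lambda>\<xi>. complex_of_real (mittag_leffler \<alpha> (- (norm \<xi>)\<^sup>2))) (\<lambda>x::'a. f (norm x))"
    unfolding is_inverse_fourier_def using sol_one_fourier[OF P1 f F0] ap by simp
  then show ?thesis unfolding Z_fun_def by (simp add: someI[of "is_inverse_fourier _"])
qed

lemma sol_one_eq_Z_fun:
  fixes x :: "'a::euclidean_space"
  assumes \<alpha>: "0 < \<alpha>" "\<alpha> < 1" and M: "0 < M"
    and f: "profile_params.sol DIM('a) \<alpha> 1 f" "mom (real DIM('a) - 1) f = ennreal (M / sphere_area DIM('a))" and x: "x \<noteq> 0"
  shows "f (norm x) = M * Z_fun \<alpha> 1 x"
proof -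
  have P1: "profile_params DIM('a) \<alpha> 1" using \<alpha> by unfold_locales (auto simp: Suc_leI)
  have ap: "0 < sphere_area DIM('a)" by (simp add: sphere_area_pos)
  have F0: "0 \<le> M / sphere_area DIM('a)" using ap M by simp
  note Z = Z_fun_is_inverse_fourier[OF \<alpha>, where 'a = 'a, unfolded is_inverse_fourier_def]
  show ?thesis
  proof (rule fourier_inj[where ?f1.0 = "\<lambda>x. f (norm x)" and ?f2.0 = "\<lambda>x. M * Z_fun \<alpha> 1 x"])
    show "fourier (\<lambda>x::'a. complex_of_real (f (norm x))) \<xi> = fourier (\<lambda>x. complex_of_real (M * Z_fun \<alpha> 1 x)) \<xi>" for \<xi>
    proof -
      have "fourier (\<lambda>x::'a. complex_of_real (M * Z_fun \<alpha> 1 x)) \<xi> = complex_of_real M * fourier (\<lambda>x. complex_of_real (Z_fun \<alpha> 1 x)) \<xi>"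
        unfolding fourier_def by (simp add: mult.assoc)
      then show ?thesis unfolding sol_one_fourier(3)[OF P1 f F0] using Z ap by simp
    qed
  qed (use sol_one_fourier[OF P1 f F0] Z x in \<open>auto intro: continuous_intros\<close>)
qed

text \<open>The mass 1 of the canonical profile at \<open>m = 1\<close> is not built into its
  definition; it is read off from the solution \<open>f\<close>. Then \<open>mass_scale\<close> is
  \<open>M\<close>, and the argument is rescaled by a zeroth power.\<close>

lemma mass_profile_one:
  fixes e :: "'a::euclidean_space"
  assumes e: "norm e = 1" and al: "0 < \<alpha>" "\<alpha> < 1" and M: "0 < M"
    and f: "profile_params.sol DIM('a) \<alpha> 1 f" "mom (real DIM('a) - 1) f = ennreal (M / sphere_area DIM('a))" and z: "0 < z"
  shows "mass_profile e \<alpha> 1 M z = f z"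
proof -
  interpret profile_params "DIM('a)" \<alpha> 1 using al by unfold_locales (auto simp: Suc_leI)
  have [measurable]: "f \<in> borel_measurable borel" using f(1) by (rule sol_measurable)
  have ap: "0 < sphere_area DIM('a)" by (simp add: sphere_area_pos)
  have e0: "e \<noteq> 0" using e by auto
  have fz: "f r = M * Z_fun \<alpha> 1 (r *\<^sub>R e)" if "0 < r" for r
    using sol_one_eq_Z_fun[OF al M f, of "r *\<^sub>R e"] e e0 that by simp
  have "(LINT \<rho>:{0<..}|lborel. canonical_profile e \<alpha> 1 \<rho> * \<rho> ^ (DIM('a) - 1)) = (LINT \<rho>:{0<..}|lborel. (1 / M) * (\<rho> powr (real DIM('a) - 1) * f \<rho>))"
    unfolding set_lebesgue_integral_def
  proof (intro Bochner_Integration.integral_cong refl)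
    fix \<rho> :: real
    show "indicator {0<..} \<rho> *\<^sub>R (canonical_profile e \<alpha> 1 \<rho> * \<rho> ^ (DIM('a) - 1)) = indicator {0<..} \<rho> *\<^sub>R (1 / M * (\<rho> powr (real DIM('a) - 1) * f \<rho>))"
    proof (cases "0 < \<rho>")
      case True
      have "\<rho> ^ (DIM('a) - 1) = \<rho> powr (real DIM('a) - 1)" using True by (simp add: powr_realpow[symmetric] of_nat_diff Suc_leI)
      then show ?thesis using True M fz[OF True] by (simp add: canonical_profile_def)
    qed simp
  qed
  also have "\<dots> = 1 / M * (LINT \<rho>:{0<..}|lborel. \<rho> powr (real DIM('a) - 1) * f \<rho>)" by simp
  also have "(LINT \<rho>:{0<..}|lborel. \<rho> powr (real DIM('a) - 1) * f \<rho>) = enn2real (mom (real DIM('a) - 1) f)"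
    unfolding mom_def using sol_nonneg[OF f(1)] by (intro set_lebesgue_integral_nonneg_eq) auto
  also have "\<dots> = M / sphere_area DIM('a)" unfolding f(2) using M ap by simp
  finally have "canonical_mass e \<alpha> 1 = 1" unfolding canonical_mass_def using ap M by simp
  then have "mass_scale e \<alpha> 1 M = M" unfolding mass_scale_def using M by simp
  then show ?thesis unfolding mass_profile_def using M fz[OF z] by (simp add: canonical_profile_def)
qed

theorem theorem1p8:
  fixes e :: "'a::euclidean_space" and \<alpha> M z :: real
  assumes "norm e = 1" and "0 < \<alpha>" and "\<alpha> < 1" and "M > 0" and "z > 0"
  shows "((\<lambda>m. mass_profile e \<alpha> m M z) \<longlongrightarrow> mass_profile e \<alpha> 1 M z) (at 1)"
proof (rule tendstoI)
  fix \<epsilon> :: real assume \<epsilon>: "0 < \<epsilon>"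
  let ?P = "\<lambda>m. dist (mass_profile e \<alpha> m M z) (mass_profile e \<alpha> 1 M z) < \<epsilon>"
  show "\<forall>\<^sub>F m in at 1. ?P m"
  proof (rule sequentially_imp_eventually_at, intro allI impI, elim conjE)
    fix Y :: "nat \<Rightarrow> real" assume Y: "\<forall>n. Y n \<noteq> 1" "Y \<longlonglongrightarrow> 1"
    have "\<forall>\<^sub>F n in sequentially. 1 - 1 / (2 * real DIM('a)) < Y n" using Y(2) by (rule order_tendstoD) simp
    then obtain n0 where n0: "\<And>n. n0 \<le> n \<Longrightarrow> 1 - 1 / (2 * real DIM('a)) < Y n" unfolding eventually_sequentially by blast
    \<comment> \<open>Subsequence principle: exponents violating the estimate would have a
      subsequence along which the profiles converge, and the limit is always the same because the
      linear solution of mass \<open>M\<close> is unique.\<close>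
    show "\<forall>\<^sub>F n in sequentially. ?P (Y n)"
    proof (rule ccontr)
      assume "\<not> (\<forall>\<^sub>F n in sequentially. ?P (Y n))"
      then obtain r where r: "strict_mono (r :: nat \<Rightarrow> nat)" "\<And>n. \<not> ?P (Y (r n))"
        using not_eventually_sequentiallyD[of "\<lambda>n. ?P (Y n)"] by blast
      \<comment> \<open>The shift by \<open>n0\<close> places all exponents in the range covered by
        \<open>admissible_canonical\<close>.\<close>
      define X where "X n = Y (r (n + n0))" for n
      have "n0 \<le> r (n + n0)" for n using seq_suble[OF r(1), of "n + n0"] by simp
      then have X: "X n \<noteq> 1" "1 - 1 / (2 * real DIM('a)) < X n" for n unfolding X_def using Y(1) n0 by auto
      have "X \<longlonglongrightarrow> 1" unfolding X_def
        using LIMSEQ_ignore_initial_segment[OF LIMSEQ_subseq_LIMSEQ[OF Y(2) r(1)], of n0] by (simp add: o_def)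
      from mass_profile_subseq[OF assms(2-4) X this, of e]
      obtain s f where s: "(\<lambda>n. mass_profile e \<alpha> (X (s n)) M z) \<longlonglongrightarrow> f z"
        and f: "profile_params.sol DIM('a) \<alpha> 1 f" "mom (real DIM('a) - 1) f = ennreal (M / sphere_area DIM('a))"
        using assms(5) by blast
      have "mass_profile e \<alpha> 1 M z = f z" by (rule mass_profile_one[OF assms(1-4) f assms(5)])
      with s have "\<forall>\<^sub>F n in sequentially. ?P (X (s n))" using \<epsilon> by (auto dest: tendstoD)
      then show False unfolding X_def using r(2) by (auto dest: eventually_happens)
    qed
  qed
qed

end
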